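(* Let $\Bbbk$ be a field, let $R$ be a standard graded $\Bbbk$-algebra with $h$-polynomial $h(R,x)$, and let $m\ge 1$ be an integer. Then $h(R,x)=\Phi_m(x)$ if and only if $m$ is prime and $R$ is a hypersurface of degree $m$.
   Context: A standard graded $\Bbbk$-algebra is a commutative finitely generated $\mathbb{N}$-graded $\Bbbk$-algebra $R=\bigoplus_{i\in\mathbb{N}}R_i$ with $R_0=\Bbbk$ a field, generated as a $\Bbbk$-algebra by $R_1$. Its Hilbert series is $H(R,x)=\sum_{i\ge0}(\dim_{\Bbbk}R_i)x^i$. If $d$ is the Krull dimension of $R$, then $H(R,x)=h(R,x)/(1-x)^d$ for a unique polynomial $h(R,x)\in\mathbb{Z}[x]$ with $h(R,1)\neq 0$ and $h(R,0)=1$; this is the $h$-polynomial of $R$, i.e. the numerator of the Hilbert series reduced to lowest terms. $\Phi_m(x)=\prod_{1\le j\le m,\ \gcd(j,m)=1}(x-e^{2\pi i j/m})$ denotes the $m$-th cyclotomic polynomial. $R$ is a hypersurface of degree $m$ if $R\cong\Bbbk[x_1,\dots,x_n]/(f)$ as graded algebras, for some $n\ge 1$, with every $x_i$ of degree $1$ and $f$ a nonzero homogeneous polynomial of degree $m$. *)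

theory Defs
  imports
    Complex_Main
    "HOL-Library.Poly_Mapping"
    "HOL-Library.Extended_Nat"
    "HOL-Computational_Algebra.Polynomial_FPS"
begin

section \<open>Standard graded algebras\<close>

text \<open>
  A commutative algebra over the field \<open>'k\<close> is a type \<open>'a\<close> of class \<open>comm_ring_1\<close> together with a
  scalar multiplication \<open>scale\<close>; \<open>A i\<close> is the homogeneous component of degree \<open>i\<close>.
\<close>

definition subalgebra :: "('k::field \<Rightarrow> 'a::comm_ring_1 \<Rightarrow> 'a) \<Rightarrow> 'a set \<Rightarrow> bool" where
  "subalgebra scale B \<longleftrightarrow>
     module.subspace scale B \<and> 1 \<in> B \<and> (\<forall>x\<in>B. \<forall>y\<in>B. x * y \<in> B)"

locale standard_graded_algebra = vector_space scale
  for scale :: "'k::field \<Rightarrow> 'a::comm_ring_1 \<Rightarrow> 'a" +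
  fixes A :: "nat \<Rightarrow> 'a set"
  assumes scale_mult: "scale c (x * y) = scale c x * y"
    and subspace_component: "subspace (A i)"
    and direct_sum: "\<exists>!c. (\<forall>i. c i \<in> A i) \<and> finite {i. c i \<noteq> 0} \<and> x = (\<Sum>i | c i \<noteq> 0. c i)"
    and mult_component: "x \<in> A i \<Longrightarrow> y \<in> A j \<Longrightarrow> x * y \<in> A (i + j)"
    and component_0: "A 0 = range (\<lambda>c. scale c 1)"
    and finitely_generated: "\<exists>X. finite X \<and> subalgebra scale hull X = UNIV"
    and generated_by_component_1: "subalgebra scale hull A 1 = UNIV"

section \<open>Hilbert series, Krull dimension and h-polynomial\<close>

definition hilbert_series :: "('k::field \<Rightarrow> 'a::comm_ring_1 \<Rightarrow> 'a) \<Rightarrow> (nat \<Rightarrow> 'a set) \<Rightarrow> int fps" where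
  "hilbert_series scale A = Abs_fps (\<lambda>i. int (vector_space.dim scale (A i)))"

text \<open>The ideals of a commutative ring are its submodules, as a module over itself.\<close>

definition prime_ideal :: "'a::comm_ring_1 set \<Rightarrow> bool" where
  "prime_ideal P \<longleftrightarrow>
     module.subspace (*) P \<and> P \<noteq> UNIV \<and> (\<forall>x y. x * y \<in> P \<longrightarrow> x \<in> P \<or> y \<in> P)"

definition krull_dim :: "'a::comm_ring_1 itself \<Rightarrow> enat" where
  "krull_dim _ = Sup {enat l | l. \<exists>P :: nat \<Rightarrow> 'a set.
     (\<forall>i\<le>l. prime_ideal (P i)) \<and> (\<forall>i<l. P i \<subset> P (Suc i))}"

text \<open>
  The equation \<open>H = h / (1 - x)\<^sup>d\<close> is written without the division, \<open>1 - x\<close> being invertible as a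
  power series.
\<close>

definition is_h_polynomial ::
    "('k::field \<Rightarrow> 'a::comm_ring_1 \<Rightarrow> 'a) \<Rightarrow> (nat \<Rightarrow> 'a set) \<Rightarrow> int poly \<Rightarrow> bool" where
  "is_h_polynomial scale A h \<longleftrightarrow>
     (\<exists>d. krull_dim TYPE('a) = enat d \<and>
        hilbert_series scale A * (1 - fps_X) ^ d = fps_of_poly h) \<and>
     poly h 1 \<noteq> 0 \<and> poly h 0 = 1"

lemma is_h_polynomial_unique:
  "is_h_polynomial scale A h \<Longrightarrow> is_h_polynomial scale A h' \<Longrightarrow> h = h'"
  unfolding is_h_polynomial_def by (metis enat.inject fps_of_poly_eq_iff)

text \<open>
  Every standard graded algebra has an h-polynomial (Hilbert--Serre and the dimension theorem), so
  that the value \<open>0\<close> only serves to make the function total. It is not an h-polynomial.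
\<close>

definition h_polynomial ::
    "('k::field \<Rightarrow> 'a::comm_ring_1 \<Rightarrow> 'a) \<Rightarrow> (nat \<Rightarrow> 'a set) \<Rightarrow> int poly" where
  "h_polynomial scale A =
     (if \<exists>h. is_h_polynomial scale A h then THE h. is_h_polynomial scale A h else 0)"

lemma h_polynomial_eqI: "is_h_polynomial scale A h \<Longrightarrow> h_polynomial scale A = h"
  unfolding h_polynomial_def by (auto intro: the_equality is_h_polynomial_unique)

definition cyclotomic_poly :: "nat \<Rightarrow> complex poly" where
  "cyclotomic_poly m =
     (\<Prod>j | 1 \<le> j \<and> j \<le> m \<and> coprime j m. [:- exp (2 * pi * \<i> * of_nat j / of_nat m), 1:])"

section \<open>Hypersurfaces\<close>

text \<open>
  The polynomial ring in the variables \<open>1, \<dots>, n\<close>: a monomial is the finitely supported function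
  giving the exponent of each variable, and a polynomial is a finitely supported function giving the
  coefficient of each monomial.
\<close>

definition polys :: "nat \<Rightarrow> ((nat \<Rightarrow>\<^sub>0 nat) \<Rightarrow>\<^sub>0 'k::field) set" where
  "polys n = {p. \<forall>t\<in>Poly_Mapping.keys p. Poly_Mapping.keys t \<subseteq> {1..n}}"

definition homogeneous :: "nat \<Rightarrow> ((nat \<Rightarrow>\<^sub>0 nat) \<Rightarrow>\<^sub>0 'k::field) \<Rightarrow> bool" where
  "homogeneous d p \<longleftrightarrow>
     (\<forall>t\<in>Poly_Mapping.keys p. (\<Sum>i\<in>Poly_Mapping.keys t. Poly_Mapping.lookup t i) = d)"

text \<open>The residue class of \<open>p\<close> modulo the ideal generated by \<open>f\<close> in \<open>polys n\<close>.\<close>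

definition residue_class :: "nat \<Rightarrow> ((nat \<Rightarrow>\<^sub>0 nat) \<Rightarrow>\<^sub>0 'k::field) \<Rightarrow>
    ((nat \<Rightarrow>\<^sub>0 nat) \<Rightarrow>\<^sub>0 'k) \<Rightarrow> ((nat \<Rightarrow>\<^sub>0 nat) \<Rightarrow>\<^sub>0 'k) set" where
  "residue_class n f p = {p + f * q | q. q \<in> polys n}"

text \<open>
  \<open>\<phi>\<close> is an isomorphism of graded algebras from the quotient of \<open>polys n\<close> by \<open>(f)\<close>, the set of
  residue classes with the operations and the grading induced by those of \<open>polys n\<close>.
\<close>

definition graded_quotient_iso :: "('k::field \<Rightarrow> 'a::comm_ring_1 \<Rightarrow> 'a) \<Rightarrow> (nat \<Rightarrow> 'a set) \<Rightarrow>
    nat \<Rightarrow> ((nat \<Rightarrow>\<^sub>0 nat) \<Rightarrow>\<^sub>0 'k) \<Rightarrow> (((nat \<Rightarrow>\<^sub>0 nat) \<Rightarrow>\<^sub>0 'k) set \<Rightarrow> 'a) \<Rightarrow> bool" where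
  "graded_quotient_iso scale A n f \<phi> \<longleftrightarrow>
     bij_betw \<phi> (residue_class n f ` polys n) UNIV \<and>
     \<phi> (residue_class n f 1) = 1 \<and>
     (\<forall>p\<in>polys n. \<forall>q\<in>polys n.
        \<phi> (residue_class n f (p + q)) = \<phi> (residue_class n f p) + \<phi> (residue_class n f q) \<and>
        \<phi> (residue_class n f (p * q)) = \<phi> (residue_class n f p) * \<phi> (residue_class n f q)) \<and>
     (\<forall>c. \<forall>p\<in>polys n.
        \<phi> (residue_class n f (Poly_Mapping.single 0 c * p)) = scale c (\<phi> (residue_class n f p))) \<and>
     (\<forall>d. \<phi> ` residue_class n f ` {p \<in> polys n. homogeneous d p} = A d)"

definition is_hypersurface ::
    "('k::field \<Rightarrow> 'a::comm_ring_1 \<Rightarrow> 'a) \<Rightarrow> (nat \<Rightarrow> 'a set) \<Rightarrow> nat \<Rightarrow> bool" where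
  "is_hypersurface scale A m \<longleftrightarrow>
     (\<exists>n\<ge>1. \<exists>f \<phi>. f \<in> polys n \<and> f \<noteq> 0 \<and> homogeneous m f \<and> graded_quotient_iso scale A n f \<phi>)"

end

theory Submission
  imports Defs
begin

text \<open>
  A standard graded algebra is a quotient \<open>R = S / I\<close> of a polynomial ring in \<open>n\<close> variables; take
  \<open>n = dim R\<^sub>1\<close>. With respect to a degree-compatible order the standard monomials (those which are not
  leading monomials of elements of \<open>I\<close>) form a basis of \<open>R\<close>, so that the Hilbert series only depends on
  the monomial ideal \<open>in(I)\<close>. Let \<open>h = \<Phi>\<^sub>m\<close> and let \<open>d\<close> be the order of the pole of the Hilbert series.
  The coefficient of \<open>x\<close> in \<open>h\<close> is \<open>n - d\<close>, and in \<open>\<Phi>\<^sub>m\<close> it is at most \<open>1\<close>, which leaves the case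
  \<open>d = n - 1\<close>. Let \<open>e\<close> be the degree of the greatest common divisor of \<open>in(I)\<close>. Then
  \<open>(1 - x) \<Phi>\<^sub>m(x) = 1 - x\<^sup>e + x\<^sup>e K(x)\<close>, where \<open>K \<ge> 0\<close> on the unit interval and \<open>K = O((1 - x)\<^sup>2)\<close>
  because the cofactor of the common divisor has codimension at least two. Comparing expansions at
  \<open>x = 1\<close> gives \<open>\<Phi>\<^sub>m(1) = e\<close> and \<open>\<Phi>\<^sub>m'(1) \<le> e (e - 1) / 2\<close>. But \<open>2 \<Phi>\<^sub>m'(1) = \<phi>(m) \<Phi>\<^sub>m(1)\<close>, hence
  \<open>\<phi>(m) < \<Phi>\<^sub>m(1)\<close>, which forces \<open>m\<close> to be prime; then \<open>K = 0\<close>, so \<open>in(I)\<close> and with it \<open>I\<close> is principal.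

  For the converse the Krull dimension has to be identified with the order of the pole. A chain of
  primes makes the dimensions of the pieces of bounded degree grow by one power at each step.
  Conversely a homogeneous ideal which is maximal among those whose quotient has a pole of order at
  least \<open>d\<close> is prime, and dividing its quotient by a linear form lowers the order by at most one.
\<close>

text \<open>The Hilbert series \<open>H\<close> is evaluated at real \<open>x\<close> in
  \<open>[0, 1)\<close>: inclusions between sets of monomials become inequalities, and orders of
  poles become limits at \<open>1\<close> from the left. The cases \<open>d = n\<close> and
  \<open>d = n + 1\<close> fall by comparison with the series \<open>(1 - x)^(-n)\<close> of the
  whole polynomial ring. A relation, or the spare factor \<open>1 - x\<close>, forces
  \<open>h(1) <= 0\<close>, against \<open>\<Phi>_m(1) > 0\<close>; and \<open>d = n\<close> without
  any relation means \<open>h = 1\<close>. The inequality between \<open>\<phi>(m)\<close> and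
  \<open>\<Phi>_m(1)\<close> is decisive because for \<open>m >= 2\<close> the value
  \<open>\<Phi>_m(1)\<close> is \<open>p\<close> if \<open>m\<close> is a power of a prime
  \<open>p\<close>, and \<open>1\<close> otherwise. It exceeds \<open>\<phi>(m)\<close> only for
  \<open>m\<close> prime, and then \<open>(1 - x) \<Phi>_m(x) = 1 - x^m\<close> with
  \<open>e = m\<close> leaves no room for \<open>K\<close>. For one direction it is enough that some
  exponent \<open>d\<close> satisfies \<open>H = h / (1 - x)^d\<close>. In the other,
  \<open>d\<close> has to be the Krull dimension, whose chains consist of arbitrary primes.\<close>

section \<open>Cyclotomic polynomials\<close>

text \<open>Both sides are monic of degree \<open>p\<close>, so a nonzero difference would have
  degree less than \<open>p\<close>; but it vanishes at the \<open>p\<close> distinct numbers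
  \<open>w i\<close>, all of which have \<open>p\<close>-th power \<open>b ^ p\<close>.\<close>

lemma prod_roots_of_unity:
  fixes b :: complex
  assumes p: "p > 0" and b: "b \<noteq> 0"
  shows "(\<Prod>i<p. [:- (exp (2 * pi * \<i> * of_nat i / of_nat p) * b), 1:]) = monom 1 p - [:b ^ p:]"
    (is "?L = ?R")
proof (rule ccontr)
  define w where "w i = exp (2 * pi * \<i> * of_nat i / of_nat p) * b" for i :: nat
  assume "?L \<noteq> ?R"
  then have nz: "?L - ?R \<noteq> 0" by simp
  have degL: "degree ?L = p"
    by (subst degree_prod_eq_sum_degree) auto
  have lcL: "lead_coeff ?L = 1"
    by (simp add: lead_coeff_prod)
  have coR: "coeff ?R p = 1" using p by (cases p) auto
  have "degree ?R \<le> p"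
    by (intro degree_diff_le degree_monom_le) simp
  then have "degree (?L - ?R) \<le> p" using degL by (intro degree_diff_le[of ?L p ?R]) simp_all
  moreover have "coeff (?L - ?R) p = 0" using lcL degL coR by simp
  ultimately have deg: "degree (?L - ?R) < p"
    using nz by (metis leading_coeff_0_iff le_neq_implies_less)
  have inj: "inj_on w {..<p}"
  proof -
    have "inj_on (\<lambda>k. cis (2 * pi * real k / real p)) {..<p}"
      using bij_betw_roots_unity[OF p] unfolding bij_betw_def by blast
    moreover have "cis (2 * pi * real k / real p) = exp (2 * pi * \<i> * of_nat k / of_nat p)" for k
      by (simp add: cis_conv_exp mult_ac)
    ultimately show ?thesis using b by (auto simp: inj_on_def w_def)
  qed
  have wp: "w i ^ p = b ^ p" for i
  proof -
    have "exp (2 * pi * \<i> * of_nat i / of_nat p) ^ p = exp (of_nat p * (2 * pi * \<i> * of_nat i / of_nat p))"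
      by (simp only: exp_of_nat_mult)
    also have "\<dots> = exp (2 * of_nat i * pi * \<i>)" using p by (simp add: mult_ac)
    also have "\<dots> = 1" using cis_multiple_2pi[of "real i"] by (simp add: cis_conv_exp mult_ac)
    finally show ?thesis by (simp add: w_def power_mult_distrib)
  qed
  have "w ` {..<p} \<subseteq> {x. poly (?L - ?R) x = 0}"
  proof safe
    fix i assume i: "i < p"
    have "poly ?L (w i) = 0" using i by (auto simp: poly_prod w_def intro!: bexI[of _ i])
    then show "poly (?L - ?R) (w i) = 0" by (simp add: poly_monom wp)
  qed
  then have "card (w ` {..<p}) \<le> card {x. poly (?L - ?R) x = 0}"
    using nz by (intro card_mono poly_roots_finite)
  also have "\<dots> \<le> degree (?L - ?R)" using nz by (rule card_poly_roots_bound)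
  finally show False using inj deg by (simp add: card_image)
qed

text \<open>Substituting \<open>x^p\<close> replaces each root by its \<open>p\<close>-th roots: the
  root with index \<open>j\<close> over \<open>m\<close> yields the indices
  \<open>j + i * m\<close>, \<open>i < p\<close>, over \<open>m * p\<close>, and these exhaust the
  indices coprime to \<open>m\<close>.\<close>

lemma cyclotomic_poly_pcompose_monom:
  assumes m: "m \<ge> 1" and p: "p > 0"
  shows "pcompose (cyclotomic_poly m) (monom 1 p) =
    (\<Prod>k | 1 \<le> k \<and> k \<le> m * p \<and> coprime k m.
       [:- exp (2 * pi * \<i> * of_nat k / of_nat (m * p)), 1:])"
proof -
  define w where "w j m = exp (2 * pi * \<i> * of_nat j / of_nat m)" for j m :: nat
  define C where "C = {j. 1 \<le> j \<and> j \<le> m \<and> coprime j m}"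
  have wp: "w j (m * p) ^ p = w j m" for j
  proof -
    have "w j (m * p) ^ p = exp (of_nat p * (2 * pi * \<i> * of_nat j / of_nat (m * p)))"
      unfolding w_def by (simp only: exp_of_nat_mult)
    also have "of_nat p * (2 * pi * \<i> * of_nat j / of_nat (m * p)) = 2 * pi * \<i> * of_nat j / of_nat m"
      using p m by (simp add: field_simps)
    finally show ?thesis by (simp add: w_def)
  qed
  have wm: "exp (2 * pi * \<i> * of_nat i / of_nat p) * w j (m * p) = w (j + i * m) (m * p)" for i j
    unfolding w_def using p m by (simp add: field_simps flip: exp_add)
  have bij: "bij_betw (\<lambda>(j, i). j + i * m) (C \<times> {..<p}) {k. 1 \<le> k \<and> k \<le> m * p \<and> coprime k m}"
  \<comment> \<open>The residues \<open>j\<close> are taken in \<open>{1..m}\<close> and not in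
    \<open>{0..<m}\<close>, hence the shift by one around \<open>mod\<close> and
    \<open>div\<close>.\<close>
  proof (rule bij_betw_byWitness[where f' = "\<lambda>k. ((k - 1) mod m + 1, (k - 1) div m)"])
    show "\<forall>a\<in>C \<times> {..<p}. (((case a of (j, i) \<Rightarrow> j + i * m) - 1) mod m + 1,
        ((case a of (j, i) \<Rightarrow> j + i * m) - 1) div m) = a"
    proof
      fix a assume "a \<in> C \<times> {..<p}"
      then obtain k i where "a = (Suc k, i)" "k < m"
        by (cases a) (auto simp: C_def Suc_le_eq dest!: gr0_implies_Suc)
      then show "(((case a of (j, i) \<Rightarrow> j + i * m) - 1) mod m + 1,
          ((case a of (j, i) \<Rightarrow> j + i * m) - 1) div m) = a"
        by simp
    qed
    show "\<forall>k\<in>{k. 1 \<le> k \<and> k \<le> m * p \<and> coprime k m}. (case ((k - 1) mod m + 1, (k - 1) div m) of (j, i) \<Rightarrow> j + i * m) = k"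
      by auto
    show "(\<lambda>(j, i). j + i * m) ` (C \<times> {..<p}) \<subseteq> {k. 1 \<le> k \<and> k \<le> m * p \<and> coprime k m}"
    proof clarify
      fix j i assume j: "j \<in> C" and i: "i < p"
      have "j + i * m \<le> m + i * m" using j by (simp add: C_def)
      also have "\<dots> = Suc i * m" by simp
      also have "\<dots> \<le> p * m" using i by (intro mult_right_mono) auto
      finally have "j + i * m \<le> m * p" by (simp add: mult.commute)
      moreover have "coprime (j + i * m) m" using j gcd_add_mult[of m i j]
        by (simp add: C_def coprime_iff_gcd_eq_1 gcd.commute[of _ m] add.commute)
      ultimately show "1 \<le> j + i * m \<and> j + i * m \<le> m * p \<and> coprime (j + i * m) m"
        using j by (auto simp: C_def)
    qed
    show "(\<lambda>k. ((k - 1) mod m + 1, (k - 1) div m)) ` {k. 1 \<le> k \<and> k \<le> m * p \<and> coprime k m} \<subseteq> C \<times> {..<p}"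
    proof clarify
      fix k assume k: "1 \<le> k" "k \<le> m * p" "coprime k m"
      have eq: "k = ((k - 1) mod m + 1) + (k - 1) div m * m" using k by simp
      have "coprime ((k - 1) mod m + 1) m"
        using k(3) gcd_add_mult[of m "(k - 1) div m" "(k - 1) mod m + 1"] eq
        by (metis add.commute coprime_iff_gcd_eq_1 gcd.commute)
      moreover have "(k - 1) mod m + 1 \<le> m" using m by (simp add: Suc_leI)
      moreover have "(k - 1) div m < p" using k m by (intro div_less_iff_less_mult[THEN iffD2]) (auto simp: mult.commute)
      ultimately show "(k - 1) mod m + 1 \<in> C \<and> (k - 1) div m \<in> {..<p}" by (auto simp: C_def)
    qed
  qed
  have "pcompose [:- c, 1:] (monom 1 p) = monom 1 p - [:c:]" for c :: complex
    by (simp add: pcompose_pCons)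
  then have "pcompose (cyclotomic_poly m) (monom 1 p) = (\<Prod>j\<in>C. monom 1 p - [:w j m:])"
    by (simp add: cyclotomic_poly_def C_def w_def pcompose_prod)
  also have "\<dots> = (\<Prod>j\<in>C. \<Prod>i<p. [:- w (j + i * m) (m * p), 1:])"
  proof (rule prod.cong[OF refl])
    fix j
    have "monom 1 p - [:w j m:] = monom 1 p - [:w j (m * p) ^ p:]" by (simp add: wp)
    also have "\<dots> = (\<Prod>i<p. [:- (exp (2 * pi * \<i> * of_nat i / of_nat p) * w j (m * p)), 1:])"
      by (rule prod_roots_of_unity[symmetric]) (use p in \<open>auto simp: w_def\<close>)
    finally show "monom 1 p - [:w j m:] = (\<Prod>i<p. [:- w (j + i * m) (m * p), 1:])"
      by (simp only: wm)
  qed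
  also have "\<dots> = (\<Prod>(j, i)\<in>C \<times> {..<p}. [:- w (j + i * m) (m * p), 1:])"
    by (simp add: prod.cartesian_product)
  also have "\<dots> = (\<Prod>k | 1 \<le> k \<and> k \<le> m * p \<and> coprime k m. [:- w k (m * p), 1:])"
    using prod.reindex_bij_betw[OF bij, of "\<lambda>k. [:- w k (m * p), 1:]"]
    by (simp add: case_prod_unfold)
  finally show ?thesis by (simp add: w_def)
qed

lemma cyclotomic_poly_mult_prime_dvd:
  assumes "m \<ge> 1" and "prime p" and "p dvd m"
  shows "cyclotomic_poly (m * p) = pcompose (cyclotomic_poly m) (monom 1 p)"
proof -
  have "coprime k m \<longleftrightarrow> coprime k (m * p)" for k
    using assms(3) coprime_divisors[of k k p m] by auto
  then show ?thesis
    using assms by (subst cyclotomic_poly_pcompose_monom) (auto simp: cyclotomic_poly_def prime_gt_0_nat)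
qed

text \<open>The indices coprime to \<open>m\<close> split into those prime to \<open>p\<close>,
  which belong to order \<open>m * p\<close>, and the multiples \<open>p * j\<close>, for which the
  fraction \<open>p * j / (m * p)\<close> reduces to \<open>j / m\<close>.\<close>

lemma cyclotomic_poly_mult_prime_not_dvd:
  assumes m: "m \<ge> 1" and p: "prime p" and nd: "\<not> p dvd m"
  shows "cyclotomic_poly (m * p) * cyclotomic_poly m = pcompose (cyclotomic_poly m) (monom 1 p)"
proof -
  define w where "w j m = exp (2 * pi * \<i> * of_nat j / of_nat m)" for j m :: nat
  have p0: "p > 0" using p by (rule prime_gt_0_nat)
  let ?D = "(*) p ` {j. 1 \<le> j \<and> j \<le> m \<and> coprime j m}"
  let ?C = "{k. 1 \<le> k \<and> k \<le> m * p \<and> coprime k (m * p)}"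
  have cpm: "coprime p m" using p nd by (simp add: prime_imp_coprime)
  have "{k. 1 \<le> k \<and> k \<le> m * p \<and> coprime k m} = ?C \<union> ?D"
  proof (intro equalityI subsetI)
    fix k assume k: "k \<in> {k. 1 \<le> k \<and> k \<le> m * p \<and> coprime k m}"
    show "k \<in> ?C \<union> ?D"
    proof (cases "p dvd k")
      case True
      then obtain j where j: "k = p * j" by (elim dvdE)
      then have "j \<in> {j. 1 \<le> j \<and> j \<le> m \<and> coprime j m}" using k p0 by (auto simp: mult.commute[of m] Suc_le_eq)
      then show ?thesis using j by blast
    next
      case False
      then have "coprime k p" using p by (metis coprime_commute prime_imp_coprime)
      then show ?thesis using k by auto
    qed
  next
    fix k assume "k \<in> ?C \<union> ?D"
    then show "k \<in> {k. 1 \<le> k \<and> k \<le> m * p \<and> coprime k m}"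
      using p0 cpm by (auto simp: mult.commute[of m])
  qed
  moreover have "?C \<inter> ?D = {}"
    using p by (auto simp: not_prime_unit)
  ultimately have "pcompose (cyclotomic_poly m) (monom 1 p) =
      (\<Prod>k\<in>?C. [:- w k (m * p), 1:]) * (\<Prod>k\<in>?D. [:- w k (m * p), 1:])"
    using cyclotomic_poly_pcompose_monom[OF m p0] by (simp add: w_def prod.union_disjoint)
  also have "(\<Prod>k\<in>?D. [:- w k (m * p), 1:]) = (\<Prod>j | 1 \<le> j \<and> j \<le> m \<and> coprime j m. [:- w (p * j) (m * p), 1:])"
    by (subst prod.reindex) (use p0 in \<open>auto simp: inj_on_def\<close>)
  also have "\<dots> = (\<Prod>j | 1 \<le> j \<and> j \<le> m \<and> coprime j m. [:- w j m, 1:])"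
    using p0 m by (intro prod.cong refl) (simp add: w_def field_simps)
  finally show ?thesis by (simp add: cyclotomic_poly_def w_def)
qed

lemma cyclotomic_poly_1: "cyclotomic_poly 1 = [:- 1, 1:]"
proof -
  have "{j::nat. 1 \<le> j \<and> j \<le> 1 \<and> coprime j 1} = {1}" by auto
  then show ?thesis by (simp add: cyclotomic_poly_def)
qed

lemma degree_cyclotomic_poly_pos: "m \<ge> 1 \<Longrightarrow> degree (cyclotomic_poly m) \<ge> 1"
proof -
  assume m: "m \<ge> 1"
  have "degree (cyclotomic_poly m) = card {j. 1 \<le> j \<and> j \<le> m \<and> coprime j m}"
    unfolding cyclotomic_poly_def by (subst degree_prod_eq_sum_degree) auto
  moreover have "card {j. 1 \<le> j \<and> j \<le> m \<and> coprime j m} > 0"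
    by (subst card_gt_0_iff) (use m in auto)
  ultimately show ?thesis by simp
qed

lemma cyclotomic_poly_prime:
  assumes p: "prime p"
  shows "cyclotomic_poly p = (\<Sum>i<p. monom 1 i)"
proof -
  have "cyclotomic_poly (1 * p) * cyclotomic_poly 1 = pcompose (cyclotomic_poly 1) (monom 1 p)"
    using p by (intro cyclotomic_poly_mult_prime_not_dvd) (auto simp: not_prime_unit)
  then have "cyclotomic_poly p * [:- 1, 1:] = monom 1 p - 1"
    by (simp add: cyclotomic_poly_1[simplified] pcompose_pCons one_pCons)
  also have "\<dots> = (monom 1 1 - 1) * (\<Sum>i<p. monom 1 i)"
    using power_diff_1_eq[of "monom 1 1 :: complex poly" p] by (simp add: monom_power)
  also have "monom 1 1 - 1 = [:- 1, 1 :: complex:]"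
    by (simp add: monom_Suc monom_0 one_pCons)
  finally have "cyclotomic_poly p * [:- 1, 1:] = [:- 1, 1:] * (\<Sum>i<p. monom 1 i)" .
  then show ?thesis by (metis mult.commute mult_cancel_left pCons_eq_0_iff one_neq_zero)
qed

text \<open>Prime factors are adjoined one at a time, and every quantity is read off from
  \<open>\<Phi>_m(x^p)\<close>: its values at \<open>0\<close> and \<open>1\<close> are those of
  \<open>\<Phi>_m\<close>, its derivative at \<open>1\<close> is multiplied by \<open>p\<close>. The
  number \<open>b\<close> is \<open>\<Phi>_m(1)\<close>, and the formula for the derivative is the
  one that holds for palindromic polynomials. \<open>\<Phi>_1 = x - 1\<close> is not palindromic,
  hence the condition \<open>m \<ge> 2\<close>.\<close>

lemma cyclotomic_poly_invariants:
  assumes "m \<ge> 1" and "P = cyclotomic_poly m"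
  shows "coeff P 0 \<in> {1, -1} \<and> coeff P 1 \<in> {-1, 0, 1} \<and>
    (m \<ge> 2 \<longrightarrow> coeff P 0 = 1 \<and> (\<exists>b::nat. b > 0 \<and> poly P 1 = of_nat b \<and>
       2 * poly (pderiv P) 1 = of_nat (degree P * b) \<and> (prime m \<or> b \<le> degree P)))"
  using assms(1) unfolding assms(2)
proof (induction m rule: prime_divisors_induct)
  case zero
  then show ?case by simp
next
  case (unit x)
  then show ?case by (simp add: cyclotomic_poly_1[simplified])
next
  case (factor p m)
  let ?P = "cyclotomic_poly m" and ?Q = "cyclotomic_poly (p * m)"
  let ?R = "pcompose ?P (monom 1 p)"
  have p: "prime p" by fact
  have p2: "p \<ge> 2" and p0: "p > 0" using p by (auto intro: prime_ge_2_nat prime_gt_0_nat)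
  have m: "m \<ge> 1" using factor.prems by (cases m) auto
  note IH = factor.IH[OF m]
  have R0: "coeff ?R 0 = coeff ?P 0"
    using p0 by (simp add: poly_0_coeff_0[symmetric] poly_pcompose poly_monom zero_power del: coeff_pcompose_0)
  have R1: "coeff ?R (Suc 0) = 0"
  proof -
    have "coeff ?R (Suc 0) = poly (pderiv ?R) 0" by (simp add: poly_0_coeff_0 coeff_pderiv)
    also have "\<dots> = 0" using p2 by (simp add: pderiv_pcompose pderiv_monom poly_monom)
    finally show ?thesis .
  qed
  have Rv: "poly ?R 1 = poly ?P 1" by (simp add: poly_pcompose poly_monom)
  have Rd: "poly (pderiv ?R) 1 = of_nat p * poly (pderiv ?P) 1"
    by (simp add: pderiv_pcompose pderiv_monom poly_monom poly_pcompose)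
  have Rg: "degree ?R = p * degree ?P" by (simp add: degree_pcompose degree_monom_eq)
  have dP: "degree ?P \<ge> 1" using m by (rule degree_cyclotomic_poly_pos)
  show ?case
  proof (cases "p dvd m")
    case True
    then have QR: "?Q = ?R" using cyclotomic_poly_mult_prime_dvd[OF m p] by (simp add: mult.commute)
    have m2: "m \<ge> 2" using True p2 m by (auto dest: dvd_imp_le)
    then obtain b :: nat where b: "b > 0" "poly ?P 1 = of_nat b"
        "2 * poly (pderiv ?P) 1 = of_nat (degree ?P * b)" "prime m \<or> b \<le> degree ?P"
      using IH by auto
    \<comment> \<open>As \<open>p * m\<close> is composite, the bound itself is required. The
      induction hypothesis yields it unless \<open>m\<close> is prime, and then
      \<open>m = p = b\<close>.\<close>
    have "b \<le> p * degree ?P"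
    proof (cases "prime m")
      case True': True
      then have mp: "m = p" using True p by (metis primes_dvd_imp_eq)
      then have "poly ?P 1 = of_nat p"
        using cyclotomic_poly_prime[OF p] by (simp add: poly_sum poly_monom)
      then have "b = p" using b(2) by simp
      then show ?thesis using dP by simp
    next
      case False
      then have "b \<le> degree ?P" using b by simp
      also have "\<dots> \<le> p * degree ?P" using p0 by simp
      finally show ?thesis .
    qed
    moreover have "2 * (of_nat p * poly (pderiv ?P) 1) = of_nat (p * degree ?P * b)"
      using b(3) by (simp add: mult_ac)
    ultimately show ?thesis using IH b m2 R0 R1 Rv Rd Rg unfolding QR by auto
  next
    case False
    then have QR: "?Q * ?P = ?R" using cyclotomic_poly_mult_prime_not_dvd[OF m p] by (simp add: mult.commute)
    have "coeff ?Q 0 * coeff ?P 0 = coeff ?P 0" using arg_cong[OF QR, of "\<lambda>q. coeff q 0"] R0 by (simp add: coeff_mult_0)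
    then have Q0: "coeff ?Q 0 = 1" using IH by auto
    \<comment> \<open>\<open>\<Phi>_m(x^p)\<close> has no linear term because \<open>p >= 2\<close>;
      hence the linear coefficients of the two factors agree up to sign.\<close>
    have "coeff (?Q * ?P) (Suc 0) = 0" using QR R1 by simp
    then have "coeff ?P (Suc 0) + coeff ?Q (Suc 0) * coeff ?P 0 = 0" using Q0 by (simp add: coeff_mult)
    then have "coeff ?Q (Suc 0) * coeff ?P 0 = - coeff ?P (Suc 0)" by (simp add: eq_neg_iff_add_eq_0 add.commute)
    moreover have "coeff ?P 0 = 1 \<or> coeff ?P 0 = - 1" using IH by simp
    ultimately have "coeff ?Q (Suc 0) = coeff ?P (Suc 0) \<or> coeff ?Q (Suc 0) = - coeff ?P (Suc 0)" by auto
    moreover have "coeff ?P (Suc 0) \<in> {-1, 0, 1}" using IH by simp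
    ultimately have Q1: "coeff ?Q (Suc 0) \<in> {-1, 0, 1}" by auto
    have "\<exists>b::nat. b > 0 \<and> poly ?Q 1 = of_nat b \<and>
       2 * poly (pderiv ?Q) 1 = of_nat (degree ?Q * b) \<and> (prime (p * m) \<or> b \<le> degree ?Q)"
    proof (cases "m = 1")
      case True
      have Q: "?Q = (\<Sum>i<p. monom 1 i)" using cyclotomic_poly_prime[OF p] True by simp
      have v: "poly ?Q 1 = of_nat p" unfolding Q by (simp add: poly_sum poly_monom)
      have "degree (?Q * ?P) = p" using QR Rg True by (simp add: cyclotomic_poly_1[simplified])
      moreover have "?Q \<noteq> 0" using Q0 by auto
      ultimately have d: "degree ?Q = p - 1"
        using True by (subst (asm) degree_mult_eq) (auto simp: cyclotomic_poly_1[simplified])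
      have "poly (pderiv ?Q) 1 = (\<Sum>i<p. of_nat i)"
        using higher_pderiv_sum[of 1 "monom (1::complex)" "{..<p}"] unfolding Q
        by (simp add: pderiv_monom poly_sum poly_monom)
      also have "\<dots> = of_nat (\<Sum>i<p. i)" by simp
      finally have "2 * poly (pderiv ?Q) 1 = of_nat (2 * (\<Sum>i<p. i))" by simp
      also have "2 * (\<Sum>i<p. i) = (p - 1) * p"
      proof -
        have "2 * (\<Sum>i<k. i) = (k - 1) * k" for k :: nat
        proof (induction k)
          case (Suc k)
          then show ?case by (cases k) (simp_all add: algebra_simps)
        qed simp
        then show ?thesis .
      qed
      finally show ?thesis using v d p0 p True by (intro exI[of _ p]) auto
    next
      case False
      then have m2: "m \<ge> 2" using m by simp
      then obtain b :: nat where b: "b > 0" "poly ?P 1 = of_nat b"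
          "2 * poly (pderiv ?P) 1 = of_nat (degree ?P * b)"
        using IH by auto
      \<comment> \<open>Cancelling \<open>\<Phi>_m(1)\<close>, nonzero for \<open>m >= 2\<close>,
        gives the value \<open>1\<close>, which no positive degree can fall below.\<close>
      have "poly ?Q 1 * poly ?P 1 = poly ?P 1" using QR Rv by (metis poly_mult)
      then have v: "poly ?Q 1 = 1" using b by simp
      have P0: "?P \<noteq> 0" using dP by auto
      moreover have "?Q \<noteq> 0" using Q0 by auto
      ultimately have "degree ?Q + degree ?P = p * degree ?P" using QR Rg degree_mult_eq by metis
      then have d: "degree ?Q = (p - 1) * degree ?P" by (simp add: algebra_simps)
      have "poly (pderiv (?Q * ?P)) 1 = poly ?Q 1 * poly (pderiv ?P) 1 + poly ?P 1 * poly (pderiv ?Q) 1"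
        by (simp add: pderiv_mult)
      then have "of_nat p * poly (pderiv ?P) 1 = poly (pderiv ?P) 1 + of_nat b * poly (pderiv ?Q) 1"
        using QR Rd v b by simp
      then have "of_nat b * (2 * poly (pderiv ?Q) 1) = (of_nat p - 1) * (2 * poly (pderiv ?P) 1)"
        by (simp add: algebra_simps)
      also have "\<dots> = of_nat b * of_nat (degree ?Q)"
        unfolding b(3) d using p0 by (simp add: of_nat_diff mult_ac)
      finally have "2 * poly (pderiv ?Q) 1 = of_nat (degree ?Q)" using b by simp
      moreover have "degree ?Q \<ge> 1" using p2 dP unfolding d by (simp add: Suc_le_eq)
      ultimately show ?thesis using v by (intro exI[of _ 1]) simp
    qed
    then show ?thesis using Q0 Q1 by simp
  qed
qed

section \<open>Monomials\<close>

type_synonym mon = "nat \<Rightarrow>\<^sub>0 nat"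

abbreviation exponent :: "mon \<Rightarrow> nat \<Rightarrow> nat" where
  "exponent \<equiv> Poly_Mapping.lookup"

definition mdeg :: "mon \<Rightarrow> nat" where
  "mdeg t = (\<Sum>i\<in>Poly_Mapping.keys t. exponent t i)"

definition mons :: "nat set \<Rightarrow> mon set" where
  "mons V = {t. Poly_Mapping.keys t \<subseteq> V}"

text \<open>Since the degree comes first, only finitely many monomials in finitely many variables
  precede a given one, and replacing a monomial by smaller ones never raises the degree. Ties are
  broken by the linear order on exponent functions, which is compatible with addition.\<close>

definition mless :: "mon \<Rightarrow> mon \<Rightarrow> bool" where
  "mless s t \<longleftrightarrow> mdeg s < mdeg t \<or> mdeg s = mdeg t \<and> s < t"

lemma mdeg_eq_sum: "finite V \<Longrightarrow> t \<in> mons V \<Longrightarrow> mdeg t = (\<Sum>i\<in>V. exponent t i)"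
  unfolding mdeg_def mons_def by (intro sum.mono_neutral_left) (auto simp: in_keys_iff)

lemma keys_add_mon: "Poly_Mapping.keys (s + t) = Poly_Mapping.keys s \<union> Poly_Mapping.keys (t :: mon)"
  by (auto simp: in_keys_iff lookup_add)

lemma mdeg_0 [simp]: "mdeg 0 = 0"
  by (simp add: mdeg_def)

lemma mdeg_single [simp]: "mdeg (Poly_Mapping.single v k) = k"
  by (simp add: mdeg_def)

lemma mdeg_add [simp]: "mdeg (s + t) = mdeg s + mdeg t"
proof -
  let ?V = "Poly_Mapping.keys s \<union> Poly_Mapping.keys t"
  have "finite ?V" "s \<in> mons ?V" "t \<in> mons ?V" "s + t \<in> mons ?V"
    by (auto simp: mons_def keys_add_mon)
  then show ?thesis by (simp add: mdeg_eq_sum[of ?V] lookup_add sum.distrib)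
qed

lemma mdeg_eq_0_iff [simp]: "mdeg t = 0 \<longleftrightarrow> t = 0"
  by (auto simp: mdeg_def in_keys_iff intro!: poly_mapping_eqI)

lemma exponent_le_mdeg: "exponent t v \<le> mdeg t"
proof (cases "v \<in> Poly_Mapping.keys t")
  case True
  then show ?thesis unfolding mdeg_def by (intro member_le_sum) auto
qed (simp add: in_keys_iff)

lemma zero_in_mons [simp]: "0 \<in> mons V"
  by (simp add: mons_def)

lemma add_in_mons_iff [simp]: "s + t \<in> mons V \<longleftrightarrow> s \<in> mons V \<and> t \<in> mons V"
  by (auto simp: mons_def keys_add_mon)

lemma single_in_mons: "v \<in> V \<Longrightarrow> Poly_Mapping.single v k \<in> mons V"
  by (auto simp: mons_def)

lemma finite_mons_le: "finite V \<Longrightarrow> finite {t \<in> mons V. mdeg t \<le> d}"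
proof -
  assume V: "finite V"
  have "inj_on (\<lambda>t. restrict (exponent t) V) {t \<in> mons V. mdeg t \<le> d}"
  proof (rule inj_onI)
    fix s t assume st: "s \<in> {t \<in> mons V. mdeg t \<le> d}" "t \<in> {t \<in> mons V. mdeg t \<le> d}"
      and eq: "restrict (exponent s) V = restrict (exponent t) V"
    show "s = t"
    proof (rule poly_mapping_eqI)
      fix v
      show "exponent s v = exponent t v"
      proof (cases "v \<in> V")
        case True
        then show ?thesis using fun_cong[OF eq, of v] by simp
      next
        case False
        then have "v \<notin> Poly_Mapping.keys s" "v \<notin> Poly_Mapping.keys t" using st by (auto simp: mons_def)
        then show ?thesis by (simp add: in_keys_iff)
      qed
    qed
  qed
  moreover have "(\<lambda>t. restrict (exponent t) V) ` {t \<in> mons V. mdeg t \<le> d} \<subseteq> PiE V (\<lambda>_. {..d})"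
  proof (rule image_subsetI)
    fix t assume "t \<in> {t \<in> mons V. mdeg t \<le> d}"
    then have "exponent t v \<le> d" for v using exponent_le_mdeg[of t v] by simp
    then show "restrict (exponent t) V \<in> PiE V (\<lambda>_. {..d})" by simp
  qed
  moreover have "finite (PiE V (\<lambda>_. {..d}))" using V by (intro finite_PiE) auto
  ultimately show ?thesis using finite_imageD finite_subset by blast
qed

lemma finite_mons_eq: "finite V \<Longrightarrow> U \<subseteq> mons V \<Longrightarrow> finite {t \<in> U. mdeg t = d}"
  by (rule finite_subset[OF _ finite_mons_le[of V d]]) auto

lemma mless_irrefl [simp]: "\<not> mless t t"
  by (simp add: mless_def)

lemma mless_trans: "mless s t \<Longrightarrow> mless t u \<Longrightarrow> mless s u"
  by (auto simp: mless_def)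

lemma mless_linear: "mless s t \<or> s = t \<or> mless t s"
  by (auto simp: mless_def)

lemma mless_imp_mdeg_le: "mless s t \<Longrightarrow> mdeg s \<le> mdeg t"
  by (auto simp: mless_def)

lemma mless_add_left: "mless s t \<Longrightarrow> mless (u + s) (u + t)"
  by (auto simp: mless_def)

lemma finite_mless: "finite V \<Longrightarrow> finite {s \<in> mons V. mless s t}"
  by (rule finite_subset[OF _ finite_mons_le[of V "mdeg t"]]) (auto dest: mless_imp_mdeg_le)

lemma mless_induct [consumes 2, case_names less]:
  assumes "finite V" and "t \<in> mons V"
    and step: "\<And>t. t \<in> mons V \<Longrightarrow> (\<And>s. s \<in> mons V \<Longrightarrow> mless s t \<Longrightarrow> P s) \<Longrightarrow> P t"
  shows "P t"
  using assms(2)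
proof (induction t rule: measure_induct_rule[where f = "\<lambda>t. card {s \<in> mons V. mless s t}"])
  case (less t)
  show ?case
  proof (rule step[OF less.prems])
    fix s assume s: "s \<in> mons V" "mless s t"
    have "{u \<in> mons V. mless u s} \<subset> {u \<in> mons V. mless u t}"
    proof (rule psubsetI)
      show "{u \<in> mons V. mless u s} \<subseteq> {u \<in> mons V. mless u t}"
        using mless_trans[OF _ s(2)] by blast
      show "{u \<in> mons V. mless u s} \<noteq> {u \<in> mons V. mless u t}"
        using s mless_irrefl[of s] by blast
    qed
    then have "card {u \<in> mons V. mless u s} < card {u \<in> mons V. mless u t}"
      by (intro psubset_card_mono finite_mless assms)
    then show "P s" using s by (intro less.IH)
  qed
qed

lemma mless_finite_max:
  assumes "finite K" and "K \<noteq> {}"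
  obtains t where "t \<in> K" and "\<And>s. s \<in> K \<Longrightarrow> s \<noteq> t \<Longrightarrow> mless s t"
  using assms
proof (induction arbitrary: thesis rule: finite_ne_induct)
  case (singleton x)
  then show ?case by blast
next
  case (insert x F)
  obtain t where t: "t \<in> F" "\<And>s. s \<in> F \<Longrightarrow> s \<noteq> t \<Longrightarrow> mless s t" using insert.IH by blast
  show ?case
  proof (cases "mless t x")
    case True
    then show ?thesis using t by (intro insert.prems[of x]) (auto intro: mless_trans)
  next
    case False
    then show ?thesis using t mless_linear[of t x] by (intro insert.prems[of t]) auto
  qed
qed

section \<open>Divisibility of monomials and Dickson's lemma\<close>

definition mdvd :: "mon \<Rightarrow> mon \<Rightarrow> bool" where
  "mdvd s t \<longleftrightarrow> (\<forall>v. exponent s v \<le> exponent t v)"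

lemma mdvd_iff: "mdvd s t \<longleftrightarrow> (\<exists>u. t = s + u)"
proof
  assume d: "mdvd s t"
  have "exponent (t - s) v = exponent t v - exponent s v" for v by transfer simp
  then have "t = s + (t - s)" using d by (intro poly_mapping_eqI) (simp add: lookup_add mdvd_def)
  then show "\<exists>u. t = s + u" by blast
qed (auto simp: mdvd_def lookup_add)

text \<open>There is a monotone subsequence; if it decreases, it is constant once its minimum
  \<open>N\<close> is reached, and dropping the terms before that makes it weakly
  increasing.\<close>

lemma nat_seq_subseq_mono:
  fixes f :: "nat \<Rightarrow> nat"
  obtains g :: "nat \<Rightarrow> nat" where "strict_mono g" and "mono (\<lambda>n. f (g n))"
proof -
  obtain g :: "nat \<Rightarrow> nat" where g: "strict_mono g" "monoseq (\<lambda>n. f (g n))"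
    using seq_monosub by blast
  show ?thesis
  proof (cases "mono (\<lambda>n. f (g n))")
    case True
    then show ?thesis using g that by blast
  next
    case False
    then have dec: "\<And>m n. m \<le> n \<Longrightarrow> f (g n) \<le> f (g m)"
      using g(2) by (auto simp: monoseq_def mono_def)
    define N where "N = (LEAST k. \<exists>n. f (g n) = k)"
    have "\<exists>n. f (g n) = N" unfolding N_def by (rule LeastI_ex) blast
    then obtain n0 where n0: "f (g n0) = N" by blast
    have "N \<le> f (g n)" for n unfolding N_def by (rule Least_le) blast
    then have c: "f (g n) = N" if "n \<ge> n0" for n using dec[OF that] n0 by (simp add: le_antisym)
    have "strict_mono (\<lambda>n. g (n0 + n))" using g(1) by (simp add: strict_mono_def)
    moreover have "mono (\<lambda>n. f (g (n0 + n)))" by (simp add: mono_def c)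
    ultimately show ?thesis by (rule that)
  qed
qed

text \<open>One passes to a further subsequence for each coordinate; the coordinates treated before
  stay monotone.\<close>

lemma dickson:
  fixes f :: "nat \<Rightarrow> nat \<Rightarrow> nat"
  assumes "finite V"
  obtains g :: "nat \<Rightarrow> nat" where "strict_mono g" and "\<And>v. v \<in> V \<Longrightarrow> mono (\<lambda>n. f (g n) v)"
  using assms
proof (induction arbitrary: thesis rule: finite_induct)
  case empty
  show ?case by (rule empty[of id]) (auto simp: strict_mono_def)
next
  case (insert x F)
  obtain g :: "nat \<Rightarrow> nat" where g: "strict_mono g" "\<And>v. v \<in> F \<Longrightarrow> mono (\<lambda>n. f (g n) v)"
    using insert.IH by blast
  obtain h :: "nat \<Rightarrow> nat" where h: "strict_mono h" "mono (\<lambda>n. f (g (h n)) x)"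
    using nat_seq_subseq_mono[of "\<lambda>n. f (g n) x"] by blast
  show ?case
  proof (rule insert.prems)
    show "strict_mono (g \<circ> h)" using g(1) h(1) by (rule strict_mono_o)
    fix v assume "v \<in> insert x F"
    then show "mono (\<lambda>n. f ((g \<circ> h) n) v)"
      using h g(2)[of v] by (auto simp: mono_def strict_mono_less_eq)
  qed
qed

lemma dickson_mons:
  assumes V: "finite V" and t: "\<And>i. t i \<in> mons V"
  obtains i j :: nat where "i < j" and "mdvd (t i) (t j)"
proof -
  obtain g :: "nat \<Rightarrow> nat" where g: "strict_mono g"
      "\<And>v. v \<in> V \<Longrightarrow> mono (\<lambda>n. exponent (t (g n)) v)"
    using dickson[OF V, of "\<lambda>n. exponent (t n)"] by blast
  have "exponent (t (g 0)) v \<le> exponent (t (g 1)) v" for v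
  proof (cases "v \<in> V")
    case True
    then show ?thesis using g(2)[of v] by (auto simp: mono_def)
  next
    case False
    then have "v \<notin> Poly_Mapping.keys (t (g 0))" using t[of "g 0"] by (auto simp: mons_def)
    then show ?thesis by (simp add: in_keys_iff)
  qed
  then show ?thesis using g(1) by (intro that[of "g 0" "g 1"]) (auto simp: mdvd_def strict_mono_def)
qed

section \<open>Generating functions of sets of monomials\<close>

definition cnt :: "mon set \<Rightarrow> nat \<Rightarrow> nat" where
  "cnt U d = card {t \<in> U. mdeg t = d}"

text \<open>A monomial either omits \<open>v\<close> or is \<open>v\<close> times a monomial of
  degree one less. On generating functions this is division by \<open>1 - x\<close>.\<close>

lemma mons_insert_Suc:
  assumes v: "v \<notin> V"
  shows "{t \<in> mons (insert v V). mdeg t = Suc d} =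
    {t \<in> mons V. mdeg t = Suc d} \<union>
    (+) (Poly_Mapping.single v 1) ` {t \<in> mons (insert v V). mdeg t = d}" (is "?A = ?B \<union> ?C")
proof (intro equalityI subsetI)
  fix t assume t: "t \<in> ?A"
  show "t \<in> ?B \<union> ?C"
  proof (cases "exponent t v = 0")
    case True
    then show ?thesis using t by (auto simp: mons_def in_keys_iff)
  next
    case False
    then have "mdvd (Poly_Mapping.single v 1) t" by (auto simp: mdvd_def lookup_single when_def)
    then obtain u where u: "t = Poly_Mapping.single v 1 + u" by (auto simp: mdvd_iff)
    then have "u \<in> {t \<in> mons (insert v V). mdeg t = d}" using t by auto
    then show ?thesis using u by blast
  qed
next
  fix t assume "t \<in> ?B \<union> ?C"
  then show "t \<in> ?A" by (auto simp: single_in_mons) (auto simp: mons_def)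
qed

lemma cnt_mons_insert:
  assumes V: "finite V" and v: "v \<notin> V"
  shows "cnt (mons (insert v V)) (Suc d) = cnt (mons V) (Suc d) + cnt (mons (insert v V)) d"
    and "cnt (mons (insert v V)) 0 = 1"
proof -
  have "{t \<in> mons V. mdeg t = Suc d} \<inter>
      (+) (Poly_Mapping.single v 1) ` {t \<in> mons (insert v V). mdeg t = d} = {}"
    using v by (auto simp: mons_def keys_add_mon)
  then show "cnt (mons (insert v V)) (Suc d) = cnt (mons V) (Suc d) + cnt (mons (insert v V)) d"
    unfolding cnt_def mons_insert_Suc[OF v]
    using V by (subst card_Un_disjoint) (auto simp: card_image finite_mons_eq intro: finite_mons_eq[of "insert v V"])
  have "{t \<in> mons (insert v V). mdeg t = 0} = {0}" by auto
  then show "cnt (mons (insert v V)) 0 = 1" by (simp add: cnt_def)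
qed

lemma cnt_mons_0: "cnt (mons V) 0 = 1"
proof -
  have "{t \<in> mons V. mdeg t = 0} = {0}" by auto
  then show ?thesis by (simp add: cnt_def)
qed

lemma cnt_mons_empty: "cnt (mons {}) d = (if d = 0 then 1 else 0)"
proof -
  have "{t \<in> mons {}. mdeg t = d} = (if d = 0 then {0} else {})" by (auto simp: mons_def)
  then show ?thesis by (simp add: cnt_def)
qed

lemma fps_cnt_mons:
  assumes "finite V"
  shows "Abs_fps (\<lambda>d. of_nat (cnt (mons V) d)) * (1 - fps_X) ^ card V = (1 :: 'a::comm_ring_1 fps)"
  using assms
proof (induction rule: finite_induct)
  case empty
  show ?case by (auto simp: fps_eq_iff cnt_mons_empty)
next
  case (insert v V)
  have "Abs_fps (\<lambda>d. of_nat (cnt (mons (insert v V)) d)) * (1 - fps_X) =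
      (Abs_fps (\<lambda>d. of_nat (cnt (mons V) d)) :: 'a fps)"
  proof (rule fps_ext)
    fix d
    show "fps_nth (Abs_fps (\<lambda>d. of_nat (cnt (mons (insert v V)) d)) * (1 - fps_X)) d =
      fps_nth (Abs_fps (\<lambda>d. of_nat (cnt (mons V) d)) :: 'a fps) d"
      using insert.hyps by (cases d) (simp_all add: right_diff_distrib cnt_mons_insert cnt_mons_0)
  qed
  then show ?case using insert.IH insert.hyps by (simp add: mult.assoc[symmetric])
qed

section \<open>Hilbert series as functions on the unit interval\<close>

lemma sums_mult_one_minus:
  fixes F G :: "nat \<Rightarrow> real"
  assumes "(\<lambda>d. F d * x ^ d) sums S" and "G 0 = F 0" and "\<And>d. G (Suc d) = F (Suc d) - F d"
  shows "(\<lambda>d. G d * x ^ d) sums ((1 - x) * S)"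
proof -
  have "(\<lambda>d. F (Suc d) * x ^ Suc d) sums (S - F 0)"
    using assms(1) by (subst sums_Suc_iff) simp
  moreover have "(\<lambda>d. x * (F d * x ^ d)) sums (x * S)" using assms(1) by (rule sums_mult)
  ultimately have "(\<lambda>d. F (Suc d) * x ^ Suc d - x * (F d * x ^ d)) sums (S - F 0 - x * S)"
    by (rule sums_diff)
  then have "(\<lambda>d. G (Suc d) * x ^ Suc d) sums ((1 - x) * S - G 0)"
    by (simp add: assms algebra_simps)
  then show ?thesis by (subst (asm) sums_Suc_iff) simp
qed

text \<open>\<open>G\<close> is the sequence of partial sums of \<open>F\<close>, that is, its
  Cauchy product with the geometric series; nonnegativity of \<open>F\<close> supplies the absolute
  convergence.\<close>

lemma sums_divide_one_minus:
  fixes F G :: "nat \<Rightarrow> real"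
  assumes F: "(\<lambda>d. F d * x ^ d) sums S" "\<And>d. F d \<ge> 0" and x: "0 \<le> x" "x < 1"
    and G: "G 0 = F 0" "\<And>d. G (Suc d) = F (Suc d) + G d"
  shows "(\<lambda>d. G d * x ^ d) sums (S / (1 - x))"
proof -
  have Geq: "G d * x ^ d = (\<Sum>i\<le>d. F i * x ^ i * x ^ (d - i))" for d
  proof -
    have "G d = (\<Sum>i\<le>d. F i)" by (induction d) (auto simp: G)
    moreover have "F i * x ^ d = F i * x ^ i * x ^ (d - i)" if "i \<le> d" for i
      using that by (simp flip: power_add add: mult.assoc)
    then have "(\<Sum>i\<le>d. F i * x ^ d) = (\<Sum>i\<le>d. F i * x ^ i * x ^ (d - i))"
      by (intro sum.cong) auto
    ultimately show ?thesis by (simp add: sum_distrib_right)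
  qed
  have "summable (\<lambda>d. norm (F d * x ^ d))"
    using F x by (simp add: sums_iff)
  moreover have "summable (\<lambda>d. norm (x ^ d))" using x by (simp add: summable_geometric)
  ultimately have "(\<lambda>d. \<Sum>i\<le>d. F i * x ^ i * x ^ (d - i)) sums (suminf (\<lambda>d. F d * x ^ d) * suminf (\<lambda>d. x ^ d))"
    by (rule Cauchy_product_sums)
  then show ?thesis using F(1) x by (simp add: Geq suminf_geometric sums_iff)
qed

text \<open>For \<open>U \<subseteq> mons V\<close> with \<open>V\<close> finite and
  \<open>0 \<le> x < 1\<close> the series converges, being dominated by that of all monomials; only
  there is \<open>val\<close> meaningful.\<close>

definition val :: "mon set \<Rightarrow> real \<Rightarrow> real" where
  "val U x = suminf (\<lambda>d. real (cnt U d) * x ^ d)"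

lemma cnt_mons_sums:
  assumes "finite V" and x: "0 \<le> x" "x < 1"
  shows "(\<lambda>d. real (cnt (mons V) d) * x ^ d) sums (1 / (1 - x) ^ card V)"
  using assms(1)
proof (induction rule: finite_induct)
  case empty
  have "(\<lambda>d. real (cnt (mons {}) d) * x ^ d) = (\<lambda>d. if d = 0 then 1 else 0)"
    by (auto simp: cnt_mons_empty)
  then show ?case using sums_If_finite_set[of "{0}" "\<lambda>_. 1::real"] by simp
next
  case (insert v V)
  have "(\<lambda>d. real (cnt (mons (insert v V)) d) * x ^ d) sums (1 / (1 - x) ^ card V / (1 - x))"
    by (rule sums_divide_one_minus[OF insert.IH])
      (use insert.hyps x in \<open>auto simp: cnt_mons_insert cnt_mons_0\<close>)
  then show ?case using insert.hyps by (simp add: mult.commute)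
qed

lemma cnt_mono: "finite V \<Longrightarrow> U \<subseteq> U' \<Longrightarrow> U' \<subseteq> mons V \<Longrightarrow> cnt U d \<le> cnt U' d"
  unfolding cnt_def by (intro card_mono finite_mons_eq[of V]) auto

lemma val_sums:
  assumes V: "finite V" and U: "U \<subseteq> mons V" and x: "0 \<le> x" "x < 1"
  shows "(\<lambda>d. real (cnt U d) * x ^ d) sums val U x"
  unfolding val_def
proof (rule summable_sums, rule summable_comparison_test)
  show "summable (\<lambda>d. real (cnt (mons V) d) * x ^ d)"
    using cnt_mons_sums[OF V x] by (rule sums_summable)
  show "\<exists>N. \<forall>d\<ge>N. norm (real (cnt U d) * x ^ d) \<le> real (cnt (mons V) d) * x ^ d"
    using x by (auto intro!: mult_right_mono cnt_mono[OF V U])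
qed

lemma val_mons: "finite V \<Longrightarrow> 0 \<le> x \<Longrightarrow> x < 1 \<Longrightarrow> val (mons V) x = 1 / (1 - x) ^ card V"
  using cnt_mons_sums val_sums[of V "mons V"] by (metis order_refl sums_unique2)

lemma val_nonneg: "finite V \<Longrightarrow> U \<subseteq> mons V \<Longrightarrow> 0 \<le> x \<Longrightarrow> x < 1 \<Longrightarrow> 0 \<le> val U x"
  by (rule sums_le[OF _ sums_zero val_sums]) auto

lemma val_mono:
  "finite V \<Longrightarrow> U \<subseteq> U' \<Longrightarrow> U' \<subseteq> mons V \<Longrightarrow> 0 \<le> x \<Longrightarrow> x < 1 \<Longrightarrow> val U x \<le> val U' x"
  by (rule sums_le[OF _ val_sums[of V] val_sums[of V]]) (auto intro!: mult_right_mono cnt_mono)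

lemma val_empty [simp]: "val {} x = 0"
  by (simp add: val_def cnt_def)

lemma val_ge_power:
  assumes V: "finite V" and U: "U \<subseteq> mons V" and t: "t \<in> U" and x: "0 \<le> x" "x < 1"
  shows "x ^ mdeg t \<le> val U x"
proof -
  have "real (cnt U (mdeg t)) * x ^ mdeg t \<le> val U x"
    using sum_le_suminf[of "\<lambda>d. real (cnt U d) * x ^ d" "{mdeg t}"] val_sums[OF V U x] x
    unfolding val_def by (auto simp: sums_iff)
  moreover have "cnt U (mdeg t) \<ge> 1"
    unfolding cnt_def using t finite_mons_eq[OF V U] by (auto simp: Suc_le_eq card_gt_0_iff)
  then have "x ^ mdeg t \<le> real (cnt U (mdeg t)) * x ^ mdeg t"
    using x mult_right_mono[of 1 "real (cnt U (mdeg t))" "x ^ mdeg t"] by simp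
  ultimately show ?thesis by linarith
qed

lemma cnt_Un_le:
  "finite V \<Longrightarrow> U \<subseteq> mons V \<Longrightarrow> U' \<subseteq> mons V \<Longrightarrow> cnt (U \<union> U') d \<le> cnt U d + cnt U' d"
proof -
  have "{t \<in> U \<union> U'. mdeg t = d} = {t \<in> U. mdeg t = d} \<union> {t \<in> U'. mdeg t = d}" by auto
  then show ?thesis unfolding cnt_def by (simp add: card_Un_le)
qed

lemma val_Un_le:
  assumes V: "finite V" and U: "U \<subseteq> mons V" "U' \<subseteq> mons V" and x: "0 \<le> x" "x < 1"
  shows "val (U \<union> U') x \<le> val U x + val U' x"
proof (rule sums_le)
  show "(\<lambda>d. real (cnt (U \<union> U') d) * x ^ d) sums val (U \<union> U') x"
    using U by (intro val_sums[OF V _ x]) auto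
  show "(\<lambda>d. real (cnt U d) * x ^ d + real (cnt U' d) * x ^ d) sums (val U x + val U' x)"
    using U by (intro sums_add val_sums[OF V _ x])
  show "real (cnt (U \<union> U') d) * x ^ d \<le> real (cnt U d) * x ^ d + real (cnt U' d) * x ^ d" for d
  proof -
    have "real (cnt (U \<union> U') d) \<le> real (cnt U d) + real (cnt U' d)"
      using cnt_Un_le[OF V U, of d] by linarith
    then show ?thesis
      using mult_right_mono[of _ "real (cnt U d) + real (cnt U' d)" "x ^ d"] x
      by (simp add: distrib_right)
  qed
qed

lemma val_Un_disjoint:
  assumes V: "finite V" and U: "U \<subseteq> mons V" "U' \<subseteq> mons V" and x: "0 \<le> x" "x < 1"
    and disj: "U \<inter> U' = {}"
  shows "val (U \<union> U') x = val U x + val U' x"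
proof (rule sums_unique2)
  show "(\<lambda>d. real (cnt (U \<union> U') d) * x ^ d) sums val (U \<union> U') x"
    using U by (intro val_sums[OF V _ x]) auto
  have "cnt (U \<union> U') d = cnt U d + cnt U' d" for d
  proof -
    have "{t \<in> U \<union> U'. mdeg t = d} = {t \<in> U. mdeg t = d} \<union> {t \<in> U'. mdeg t = d}" by auto
    then show ?thesis unfolding cnt_def using disj U V
      by (subst card_Un_disjoint[symmetric]) (auto simp: finite_mons_eq)
  qed
  then show "(\<lambda>d. real (cnt (U \<union> U') d) * x ^ d) sums (val U x + val U' x)"
    using sums_add[OF val_sums[OF V U(1) x] val_sums[OF V U(2) x]] by (simp add: algebra_simps)
qed

lemma val_UN_le:
  assumes V: "finite V" and I: "finite I" and U: "\<And>i. i \<in> I \<Longrightarrow> U i \<subseteq> mons V"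
    and x: "0 \<le> x" "x < 1"
  shows "val (\<Union>i\<in>I. U i) x \<le> (\<Sum>i\<in>I. val (U i) x)"
  using I U
proof (induction rule: finite_induct)
  case (insert i I)
  have "val (U i \<union> (\<Union>i\<in>I. U i)) x \<le> val (U i) x + val (\<Union>i\<in>I. U i) x"
    using insert.prems by (intro val_Un_le[OF V _ _ x]) auto
  then show ?case using insert by simp
qed simp

lemma cnt_shift:
  "cnt ((+) s ` U) d = (if mdeg s \<le> d then cnt U (d - mdeg s) else 0)"
proof (cases "mdeg s \<le> d")
  case True
  then have "{t \<in> (+) s ` U. mdeg t = d} = (+) s ` {t \<in> U. mdeg t = d - mdeg s}" by auto
  then show ?thesis using True by (simp add: cnt_def card_image)
next
  case False
  then have "{t \<in> (+) s ` U. mdeg t = d} = {}" by auto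
  then have "cnt ((+) s ` U) d = 0" unfolding cnt_def by (simp only: card.empty)
  then show ?thesis using False by simp
qed

lemma sums_shift_power:
  fixes f :: "nat \<Rightarrow> real"
  assumes "(\<lambda>d. f d * x ^ d) sums S"
  shows "(\<lambda>d. (if s \<le> d then f (d - s) else 0) * x ^ d) sums (x ^ s * S)"
proof -
  let ?g = "\<lambda>d. (if s \<le> d then f (d - s) else 0) * x ^ d"
  have "(\<lambda>d. ?g (d + s)) sums (x ^ s * S)"
    using sums_mult[OF assms, of "x ^ s"] by (simp add: power_add mult_ac)
  then have "?g sums (x ^ s * S + (\<Sum>d<s. ?g d))"
    by (subst (asm) sums_iff_shift)
  then show ?thesis by simp
qed

lemma val_shift:
  assumes V: "finite V" and U: "U \<subseteq> mons V" and x: "0 \<le> x" "x < 1" and s: "s \<in> mons V"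
  shows "val ((+) s ` U) x = x ^ mdeg s * val U x"
proof (rule sums_unique2)
  let ?f = "\<lambda>d. real (cnt ((+) s ` U) d) * x ^ d"
  show "?f sums val ((+) s ` U) x"
    using U s by (intro val_sums[OF V _ x]) auto
  have "real (cnt ((+) s ` U) d) = (if mdeg s \<le> d then real (cnt U (d - mdeg s)) else 0)" for d
    by (simp add: cnt_shift)
  then show "?f sums (x ^ mdeg s * val U x)"
    using sums_shift_power[OF val_sums[OF V U x], of "mdeg s"] by simp
qed

text \<open>
  A monomial of \<open>U\<close> is not divisible by \<open>u v\<close>, so some exponent \<open>j\<close> of it is bounded; it is not
  divisible by \<open>u j\<close> either, so another exponent is bounded as well.
\<close>

lemma val_codim_two:
  assumes V: "finite V" "V \<noteq> {}" and U: "U \<subseteq> mons V"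
    and u: "\<And>v. v \<in> V \<Longrightarrow> u v \<in> mons V" "\<And>v. v \<in> V \<Longrightarrow> exponent (u v) v = 0"
      "\<And>v t. v \<in> V \<Longrightarrow> t \<in> U \<Longrightarrow> \<not> mdvd (u v) t"
  obtains C where "\<forall>x. 0 \<le> x \<and> x < 1 \<longrightarrow> (1 - x) ^ card V * val U x \<le> C * (1 - x)\<^sup>2"
proof -
  define B where "B = Max ((\<lambda>v. mdeg (u v)) ` V)"
  have B: "mdeg (u v) \<le> B" if "v \<in> V" for v unfolding B_def using V that by (intro Max_ge) auto
  define I where "I = {(j, k, a, b). j \<in> V \<and> k \<in> V - {j} \<and> a \<le> B \<and> b \<le> B}"
  have "finite I"
    by (rule finite_subset[of _ "V \<times> V \<times> {..B} \<times> {..B}"]) (use V in \<open>auto simp: I_def\<close>)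
  \<comment> \<open>The monomials with prescribed exponents at two distinct variables form a
    translate of \<open>mons (V - {j, k})\<close>, whose series has a pole of order only
    \<open>card V - 2\<close>. Finitely many such sets will cover \<open>U\<close>.\<close>
  define W where "W = (\<lambda>(j, k, a, b). (+) (Poly_Mapping.single j a + Poly_Mapping.single k b) ` mons (V - {j, k}))"
  have bd: "\<exists>j\<in>V - {v}. exponent t j \<le> B" if vt: "v \<in> V" "t \<in> U" for v t
  proof -
    obtain j where j: "exponent t j < exponent (u v) j"
      using u(3)[OF vt] by (auto simp: mdvd_def not_le)
    then have "j \<in> Poly_Mapping.keys (u v)" by (auto simp: in_keys_iff)
    then have "j \<in> V" "j \<noteq> v" using u(1,2)[OF vt(1)] by (auto simp: mons_def in_keys_iff)
    moreover have "exponent t j \<le> B"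
      using j exponent_le_mdeg[of "u v" j] B[OF vt(1)] by linarith
    ultimately show ?thesis by blast
  qed
  have sub: "U \<subseteq> (\<Union>i\<in>I. W i)"
  proof
    fix t assume t: "t \<in> U"
    obtain v where "v \<in> V" using V by blast
    then obtain j where j: "j \<in> V" "exponent t j \<le> B" using bd[OF _ t] by blast
    \<comment> \<open>The same bound is applied again with \<open>j\<close> in the role of
      \<open>v\<close>, which produces a second variable different from the first.\<close>
    then obtain k where k: "k \<in> V - {j}" "exponent t k \<le> B" using bd[OF _ t] by blast
    let ?s = "Poly_Mapping.single j (exponent t j) + Poly_Mapping.single k (exponent t k)"
    have "mdvd ?s t" using k by (auto simp: mdvd_def lookup_add lookup_single when_def)
    then obtain w where w: "t = ?s + w" by (auto simp: mdvd_iff)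
    have "exponent w j = 0" "exponent w k = 0"
      using arg_cong[OF w, of "\<lambda>t. exponent t j"] arg_cong[OF w, of "\<lambda>t. exponent t k"] k
      by (auto simp: lookup_add lookup_single when_def split: if_splits)
    moreover have "w \<in> mons V" using t U w by (metis add_in_mons_iff subsetD)
    ultimately have "w \<in> mons (V - {j, k})" by (auto simp: mons_def in_keys_iff)
    then have "t \<in> W (j, k, exponent t j, exponent t k)" using w by (auto simp: W_def)
    moreover have "(j, k, exponent t j, exponent t k) \<in> I" using j k by (simp add: I_def)
    ultimately show "t \<in> (\<Union>i\<in>I. W i)" by blast
  qed
  have WV: "W i \<subseteq> mons V" if "i \<in> I" for i
    using that by (auto simp: W_def I_def single_in_mons) (auto simp: mons_def)
  have W: "(1 - x) ^ card V * val (W i) x \<le> (1 - x)\<^sup>2" if "i \<in> I" and x: "0 \<le> x" "x < 1" for i x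
  proof -
    obtain j k a b where i: "i = (j, k, a, b)" by (cases i) auto
    have jk: "j \<in> V" "k \<in> V" "j \<noteq> k" using that i by (auto simp: I_def)
    have "card {j, k} \<le> card V" using jk V by (intro card_mono) auto
    then have c: "card V = card (V - {j, k}) + 2" using jk V by (subst card_Diff_subset) auto
    have "val (W i) x = x ^ (a + b) * val (mons (V - {j, k})) x"
      unfolding W_def i using jk by (simp only: prod.case, subst val_shift[OF V(1) _ x])
        (auto simp: single_in_mons, auto simp: mons_def)
    also have "\<dots> \<le> 1 * val (mons (V - {j, k})) x"
      using x V by (intro mult_right_mono power_le_one val_nonneg[of V]) (auto simp: mons_def)
    also have "\<dots> = 1 / (1 - x) ^ card (V - {j, k})" using V x by (simp add: val_mons)
    finally have "(1 - x) ^ card V * val (W i) x \<le> (1 - x) ^ card V * (1 / (1 - x) ^ card (V - {j, k}))"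
      using x by (intro mult_left_mono) auto
    also have "\<dots> = (1 - x)\<^sup>2" unfolding c power_add using x by simp
    finally show ?thesis .
  qed
  show ?thesis
  proof (rule that, intro allI impI)
    fix x :: real assume "0 \<le> x \<and> x < 1"
    then have x: "0 \<le> x" "x < 1" by auto
    have "val U x \<le> val (\<Union>i\<in>I. W i) x" by (rule val_mono[OF V(1) sub UN_least[OF WV] x])
    also have "\<dots> \<le> (\<Sum>i\<in>I. val (W i) x)" by (rule val_UN_le[OF V(1) \<open>finite I\<close> WV x])
    finally have "(1 - x) ^ card V * val U x \<le> (1 - x) ^ card V * (\<Sum>i\<in>I. val (W i) x)"
      using x by (intro mult_left_mono) auto
    also have "\<dots> \<le> (\<Sum>i\<in>I. (1 - x)\<^sup>2)" unfolding sum_distrib_left by (intro sum_mono W x)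
    finally show "(1 - x) ^ card V * val U x \<le> real (card I) * (1 - x)\<^sup>2" by simp
  qed
qed

section \<open>Ideals and homogeneous components\<close>

definition ideal :: "'a::comm_ring_1 set \<Rightarrow> bool" where
  "ideal J \<longleftrightarrow> module.subspace (*) J"

lemma ideal_iff:
  "ideal J \<longleftrightarrow> 0 \<in> J \<and> (\<forall>x\<in>J. \<forall>y\<in>J. x + y \<in> J) \<and> (\<forall>a. \<forall>x\<in>J. a * x \<in> J)"
proof -
  interpret ring_module: module "(*) :: 'a \<Rightarrow> 'a \<Rightarrow> 'a"
    by unfold_locales (auto simp: algebra_simps)
  show ?thesis unfolding ideal_def ring_module.subspace_def ..
qed

lemma prime_ideal_iff:
  "prime_ideal P \<longleftrightarrow> ideal P \<and> P \<noteq> UNIV \<and> (\<forall>x y. x * y \<in> P \<longrightarrow> x \<in> P \<or> y \<in> P)"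
  by (simp add: prime_ideal_def ideal_def)

lemma ideal_0: "ideal J \<Longrightarrow> 0 \<in> J"
  and ideal_add: "ideal J \<Longrightarrow> x \<in> J \<Longrightarrow> y \<in> J \<Longrightarrow> x + y \<in> J"
  and ideal_mult: "ideal J \<Longrightarrow> x \<in> J \<Longrightarrow> a * x \<in> J"
  by (auto simp: ideal_iff)

lemma ideal_mult': "ideal J \<Longrightarrow> x \<in> J \<Longrightarrow> x * a \<in> J"
  using ideal_mult[of J x a] by (simp add: mult.commute)

lemma ideal_diff: "ideal J \<Longrightarrow> x \<in> J \<Longrightarrow> y \<in> J \<Longrightarrow> x - y \<in> J"
  using ideal_add[of J x "- 1 * y"] ideal_mult[of J y "- 1"] by simp

lemma ideal_singleton_0: "ideal {0}"
  by (simp add: ideal_iff)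

lemma ideal_eq_UNIV: "ideal J \<Longrightarrow> 1 \<in> J \<Longrightarrow> J = UNIV"
  using ideal_mult[of J 1] by auto

text \<open>\<open>ideal_adjoin J a\<close> and \<open>ideal_colon J a\<close> are
  \<open>J + aR\<close> and \<open>J : a\<close>. They belong to the exact sequence
  \<open>0 -> R/(J : a) -> R/J -> R/(J + aR) -> 0\<close>, whose first map is multiplication by
  \<open>a\<close>.\<close>

definition ideal_adjoin :: "'a::comm_ring_1 set \<Rightarrow> 'a \<Rightarrow> 'a set" where
  "ideal_adjoin J a = {x + a * y | x y. x \<in> J}"

definition ideal_colon :: "'a::comm_ring_1 set \<Rightarrow> 'a \<Rightarrow> 'a set" where
  "ideal_colon J a = {x. a * x \<in> J}"

lemma ideal_ideal_adjoin:
  assumes J: "ideal J"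
  shows "ideal (ideal_adjoin J a)"
  unfolding ideal_iff
proof (intro conjI ballI allI)
  show "0 \<in> ideal_adjoin J a"
    unfolding ideal_adjoin_def using ideal_0[OF J] by (auto intro!: exI[of _ 0])
next
  fix u v assume "u \<in> ideal_adjoin J a" "v \<in> ideal_adjoin J a"
  then obtain x y x' y' where u: "u = x + a * y" "x \<in> J" and v: "v = x' + a * y'" "x' \<in> J"
    by (auto simp: ideal_adjoin_def)
  have "u + v = (x + x') + a * (y + y')" by (simp add: u v algebra_simps)
  then show "u + v \<in> ideal_adjoin J a" using ideal_add[OF J u(2) v(2)] by (auto simp: ideal_adjoin_def)
next
  fix c u assume "u \<in> ideal_adjoin J a"
  then obtain x y where u: "u = x + a * y" "x \<in> J" by (auto simp: ideal_adjoin_def)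
  have "c * u = c * x + a * (c * y)" by (simp add: u algebra_simps)
  then show "c * u \<in> ideal_adjoin J a" using ideal_mult[OF J u(2)] by (auto simp: ideal_adjoin_def)
qed

lemma ideal_ideal_colon: "ideal J \<Longrightarrow> ideal (ideal_colon J a)"
  by (auto simp: ideal_iff ideal_colon_def distrib_left mult.left_commute)

lemma ideal_subset_adjoin: "J \<subseteq> ideal_adjoin J a"
proof
  fix x assume "x \<in> J"
  moreover have "x = x + a * 0" by simp
  ultimately show "x \<in> ideal_adjoin J a" unfolding ideal_adjoin_def by blast
qed

lemma ideal_adjoin_self: "ideal J \<Longrightarrow> a \<in> ideal_adjoin J a"
proof -
  assume "ideal J"
  then have "0 \<in> J" by (rule ideal_0)
  moreover have "a = 0 + a * 1" by simp
  ultimately show "a \<in> ideal_adjoin J a" unfolding ideal_adjoin_def by blast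
qed

lemma ideal_subset_colon: "ideal J \<Longrightarrow> J \<subseteq> ideal_colon J a"
  by (auto simp: ideal_colon_def ideal_mult)

lemma ideal_colon_prime: "prime_ideal P \<Longrightarrow> a \<notin> P \<Longrightarrow> ideal_colon P a = P"
  by (auto simp: ideal_colon_def prime_ideal_iff ideal_mult)

section \<open>Homogeneous parts and homogeneous ideals\<close>

context standard_graded_algebra
begin

lemma mult_scale_right: "x * scale c y = scale c (x * y)"
  by (metis mult.commute scale_mult)

lemma ideal_subspace: "ideal J \<Longrightarrow> subspace J"
proof (rule subspaceI)
  fix c x assume "ideal J" "x \<in> J"
  then show "scale c x \<in> J" using ideal_mult[of J x "scale c 1"] by (simp add: scale_mult[symmetric])
qed (auto simp: ideal_0 ideal_add)

lemma mult_in_span: "x \<in> span S \<Longrightarrow> a * x \<in> span ((*) a ` S)"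
proof (induction rule: span_induct)
  case base
  then show ?case by (rule subspaceI) (auto simp: distrib_left mult_scale_right intro: span_zero span_add span_scale)
next
  case (step x)
  then show ?case by (intro span_base) auto
qed

definition part :: "nat \<Rightarrow> 'a \<Rightarrow> 'a" where
  "part i x = (THE c. (\<forall>i. c i \<in> A i) \<and> finite {i. c i \<noteq> 0} \<and> x = (\<Sum>i | c i \<noteq> 0. c i)) i"

lemma
  shows part_in: "part i x \<in> A i" and finite_part: "finite {i. part i x \<noteq> 0}"
    and sum_part: "x = (\<Sum>i | part i x \<noteq> 0. part i x)"
  using theI'[OF direct_sum[of x]] unfolding part_def by blast+

lemma part_eqI:
  assumes "\<And>i. c i \<in> A i" and S: "finite S" "\<And>i. i \<notin> S \<Longrightarrow> c i = 0" and x: "x = (\<Sum>i\<in>S. c i)"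
  shows "part i x = c i"
proof -
  have sub: "{i. c i \<noteq> 0} \<subseteq> S" using S by blast
  then have "x = (\<Sum>i | c i \<noteq> 0. c i)" unfolding x using S
    by (intro sum.mono_neutral_right) auto
  then have "(THE c. (\<forall>i. c i \<in> A i) \<and> finite {i. c i \<noteq> 0} \<and> x = (\<Sum>i | c i \<noteq> 0. c i)) = c"
    using direct_sum[of x] assms(1) finite_subset[OF sub S(1)] by (intro the1_equality) auto
  then show ?thesis by (simp add: part_def)
qed

lemma part_bound: "\<exists>N. (\<forall>i>N. part i x = 0) \<and> x = (\<Sum>i\<le>N. part i x)"
proof -
  obtain N where N: "\<forall>i\<in>{i. part i x \<noteq> 0}. i \<le> N"
    using finite_part finite_nat_set_iff_bounded_le by blast
  have "x = (\<Sum>i | part i x \<noteq> 0. part i x)" by (rule sum_part)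
  also have "\<dots> = (\<Sum>i\<le>N. part i x)" using N by (intro sum.mono_neutral_left) auto
  finally show ?thesis using N by (intro exI[of _ N]) force
qed

lemma zero_in_component: "0 \<in> A i"
  by (rule subspace_0[OF subspace_component])

lemma part_component:
  assumes "x \<in> A j"
  shows "part i x = (if i = j then x else 0)"
  by (rule part_eqI[where S = "{j}"]) (use assms in \<open>auto simp: zero_in_component\<close>)

lemma part_0 [simp]: "part i 0 = 0"
  using part_component[OF zero_in_component, of i i] by simp

lemma part_add: "part i (x + y) = part i x + part i y"
proof (rule part_eqI[where S = "{i. part i x \<noteq> 0} \<union> {i. part i y \<noteq> 0}"])
  let ?S = "{i. part i x \<noteq> 0} \<union> {i. part i y \<noteq> 0}"
  have fin: "finite ?S" by (simp add: finite_part)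
  have "x = (\<Sum>i\<in>?S. part i x)" "y = (\<Sum>i\<in>?S. part i y)"
    by (subst sum_part, rule sum.mono_neutral_left, auto simp: finite_part)+
  then show "x + y = (\<Sum>i\<in>?S. part i x + part i y)" by (simp add: sum.distrib)
qed (auto simp: finite_part part_in subspace_add[OF subspace_component])

lemma part_scale: "part i (scale c x) = scale c (part i x)"
proof (rule part_eqI[where S = "{i. part i x \<noteq> 0}"])
  show "scale c x = (\<Sum>i | part i x \<noteq> 0. scale c (part i x))"
    using arg_cong[OF sum_part[of x], of "scale c"] by (simp add: scale_sum_right)
qed (auto simp: finite_part part_in subspace_scale[OF subspace_component])

lemma part_sum: "part i (sum f S) = (\<Sum>s\<in>S. part i (f s))"
  by (induction S rule: infinite_finite_induct) (auto simp: part_add)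

lemma part_mult:
  assumes a: "a \<in> A s"
  shows "part i (a * x) = (if s \<le> i then a * part (i - s) x else 0)"
proof (rule part_eqI[where S = "(+) s ` {i. part i x \<noteq> 0}"])
  fix i
  show "(if s \<le> i then a * part (i - s) x else 0) \<in> A i"
    using mult_component[OF a part_in[of "i - s" x]] by (auto simp: zero_in_component)
  show "(if s \<le> i then a * part (i - s) x else 0) = 0" if "i \<notin> (+) s ` {i. part i x \<noteq> 0}"
    using that by (auto simp: image_iff) (metis le_add_diff_inverse mult_zero_right)
next
  have "a * x = (\<Sum>i | part i x \<noteq> 0. a * part i x)"
    using arg_cong[OF sum_part[of x], of "(*) a"] by (simp add: sum_distrib_left)
  also have "\<dots> = (\<Sum>i\<in>(+) s ` {i. part i x \<noteq> 0}. if s \<le> i then a * part (i - s) x else 0)"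
    by (subst sum.reindex) auto
  finally show "a * x = \<dots>" .
qed (auto simp: finite_part)

lemma part_product: "part m (x * y) = (\<Sum>k\<le>m. part k x * part (m - k) y)"
proof -
  obtain N where N: "\<forall>k>N. part k x = 0" "x = (\<Sum>k\<le>N. part k x)"
    using part_bound[of x] by blast
  let ?f = "\<lambda>k. if k \<le> m then part k x * part (m - k) y else 0"
  have "part m (x * y) = (\<Sum>k\<le>N. part m (part k x * y))"
    by (subst N(2)) (simp add: sum_distrib_right part_sum)
  also have "\<dots> = (\<Sum>k\<le>N. ?f k)"
    by (intro sum.cong refl) (simp add: part_mult[OF part_in])
  also have "\<dots> = (\<Sum>k\<le>max N m. ?f k)"
    by (intro sum.mono_neutral_left) (auto simp: N(1))
  also have "\<dots> = (\<Sum>k\<le>m. ?f k)"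
    by (intro sum.mono_neutral_right) auto
  also have "\<dots> = (\<Sum>k\<le>m. part k x * part (m - k) y)"
    by (intro sum.cong) auto
  finally show ?thesis .
qed

lemma one_in_component_0: "1 \<in> A 0"
  using component_0 scale_one by (metis rangeI)

text \<open>The degree-one part of \<open>x * y\<close> is a combination of those of
  \<open>x\<close> and \<open>y\<close>, because the degree-zero parts are scalars. So the elements
  whose degree-one part lies in the span of \<open>?B\<close> form a subalgebra, and it contains the
  generators.\<close>

lemma finite_spanning_component_1: "\<exists>B. finite B \<and> A 1 \<subseteq> span B"
proof -
  obtain X where X: "finite X" "subalgebra scale hull X = UNIV" using finitely_generated by blast
  let ?B = "part 1 ` X"
  let ?W = "{x. part 1 x \<in> span ?B}"
  have "subspace ?W" by (rule subspaceI) (auto simp: part_add part_scale intro: span_zero span_add span_scale)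
  moreover have "1 \<in> ?W" by (simp add: part_component[OF one_in_component_0] span_zero)
  moreover have "x * y \<in> ?W" if "x \<in> ?W" "y \<in> ?W" for x y
  proof -
    obtain c d where "part 0 x = scale c 1" "part 0 y = scale d 1"
      using part_in[of 0] unfolding component_0 by blast
    then have "part 1 (x * y) = scale c (part 1 y) + scale d (part 1 x)"
      by (simp add: part_product scale_mult[symmetric] mult_scale_right)
    then show ?thesis using that by (simp add: span_add span_scale)
  qed
  ultimately have "subalgebra scale ?W" by (simp add: subalgebra_def)
  moreover have "X \<subseteq> ?W" by (auto intro: span_base)
  ultimately have "subalgebra scale hull X \<subseteq> ?W" by (rule hull_minimal[rotated])
  then have "part 1 x \<in> span ?B" for x using X(2) by blast
  then have "A 1 \<subseteq> span ?B" using part_component[of _ 1 1] by (metis subsetI)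
  then show ?thesis using X(1) by blast
qed

definition homogeneous_ideal :: "'a set \<Rightarrow> bool" where
  "homogeneous_ideal J \<longleftrightarrow> ideal J \<and> (\<forall>x\<in>J. \<forall>i. part i x \<in> J)"

lemma homogeneous_ideal_singleton_0: "homogeneous_ideal {0}"
  by (simp add: homogeneous_ideal_def ideal_singleton_0)

lemma homogeneous_ideal_adjoin:
  assumes J: "homogeneous_ideal J" and a: "a \<in> A s"
  shows "homogeneous_ideal (ideal_adjoin J a)"
  unfolding homogeneous_ideal_def
proof (intro conjI ballI allI)
  show "ideal (ideal_adjoin J a)" using J by (simp add: homogeneous_ideal_def ideal_ideal_adjoin)
  fix u i assume "u \<in> ideal_adjoin J a"
  then obtain x y where u: "u = x + a * y" "x \<in> J" by (auto simp: ideal_adjoin_def)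
  have "part i u = part i x + a * (if s \<le> i then part (i - s) y else 0)"
    by (simp add: u part_add part_mult[OF a])
  then show "part i u \<in> ideal_adjoin J a" using J u(2)
    unfolding homogeneous_ideal_def ideal_adjoin_def by blast
qed

lemma homogeneous_ideal_colon:
  assumes J: "homogeneous_ideal J" and a: "a \<in> A s"
  shows "homogeneous_ideal (ideal_colon J a)"
  unfolding homogeneous_ideal_def
proof (intro conjI ballI allI)
  show "ideal (ideal_colon J a)" using J by (simp add: homogeneous_ideal_def ideal_ideal_colon)
  fix x i assume "x \<in> ideal_colon J a"
  then have "part (s + i) (a * x) \<in> J" using J by (simp add: homogeneous_ideal_def ideal_colon_def)
  then show "part i x \<in> ideal_colon J a" by (simp add: part_mult[OF a] ideal_colon_def)
qed

text \<open>Exchange argument in the quotient by \<open>J\<close>, carried out on representatives: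
  each \<open>v k\<close> is congruent to some \<open>w k\<close> in \<open>span B\<close>, and the
  \<open>w k\<close> inherit the independence. The family is indexed, so that vectors of two kinds
  can be mixed without comparing them as elements.\<close>

lemma card_le_of_independent_modulo:
  assumes J: "subspace J" and K: "finite K" and B: "finite B"
    and indep: "\<And>c k. (\<Sum>k\<in>K. scale (c k) (v k)) \<in> J \<Longrightarrow> k \<in> K \<Longrightarrow> c k = 0"
    and span: "\<And>k. k \<in> K \<Longrightarrow> v k \<in> span (J \<union> B)"
  shows "card K \<le> card B"
proof -
  have "\<exists>w. w \<in> span B \<and> v k - w \<in> J" if k: "k \<in> K" for k
  proof -
    obtain j w where "v k = j + w" "j \<in> span J" "w \<in> span B"
      using span[OF k] unfolding span_Un by blast
    moreover have "span J = J" using J by simp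
    ultimately show ?thesis by (intro exI[of _ w]) simp
  qed
  then obtain w where w: "\<And>k. k \<in> K \<Longrightarrow> w k \<in> span B" "\<And>k. k \<in> K \<Longrightarrow> v k - w k \<in> J"
    by metis
  have windep: "c k = 0" if "(\<Sum>k\<in>K. scale (c k) (w k)) = 0" "k \<in> K" for c k
  proof (rule indep[OF _ that(2)])
    have "(\<Sum>k\<in>K. scale (c k) (v k)) = (\<Sum>k\<in>K. scale (c k) (v k - w k))"
      using that(1) by (simp add: scale_right_diff_distrib sum_subtractf)
    also have "\<dots> \<in> J" by (intro subspace_sum[OF J] subspace_scale[OF J] w)
    finally show "(\<Sum>k\<in>K. scale (c k) (v k)) \<in> J" .
  qed
  have inj: "inj_on w K"
  proof (rule inj_onI, rule ccontr)
    fix k l assume kl: "k \<in> K" "l \<in> K" "w k = w l" "k \<noteq> l"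
    define c where "c i = (if i = k then 1 else if i = l then - 1 else 0 :: 'k)" for i
    have "(\<Sum>i\<in>K. scale (c i) (w i)) = (\<Sum>i\<in>{k, l}. scale (c i) (w i))"
      using kl K by (intro sum.mono_neutral_right) (auto simp: c_def)
    also have "\<dots> = 0" using kl by (simp add: c_def)
    finally have "c k = 0" using windep kl by blast
    then show False by (simp add: c_def)
  qed
  have "independent (w ` K)"
  proof (rule independent_if_scalars_zero)
    fix f x assume "(\<Sum>x\<in>w ` K. scale (f x) x) = 0" and x: "x \<in> w ` K"
    then have "(\<Sum>k\<in>K. scale (f (w k)) (w k)) = 0" by (simp add: sum.reindex[OF inj])
    then show "f x = 0" using windep[of "\<lambda>k. f (w k)"] x by blast
  qed (use K in simp)
  moreover have "w ` K \<subseteq> span B" using w by blast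
  ultimately have "card (w ` K) \<le> card B" using independent_span_bound[OF B] by blast
  then show ?thesis by (simp add: card_image inj)
qed

end

section \<open>Standard monomials\<close>

text \<open>The \<open>r i\<close> are the images of the variables. The number \<open>n\<close>
  stays a parameter: one direction takes \<open>dim (A 1)\<close>, the other the number of variables
  of the given polynomial ring.\<close>

locale presented_algebra = standard_graded_algebra scale A
  for scale :: "'k::field \<Rightarrow> 'a::comm_ring_1 \<Rightarrow> 'a" and A +
  fixes r :: "nat \<Rightarrow> 'a" and n :: nat
  assumes r_in: "i \<in> {1..n} \<Longrightarrow> r i \<in> A 1"
    and r_span: "A 1 \<subseteq> span (r ` {1..n})"
begin

abbreviation E :: "mon set" where "E \<equiv> mons {1..n}"

definition mp :: "mon \<Rightarrow> 'a" where
  "mp t = (\<Prod>i\<in>{1..n}. r i ^ exponent t i)"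

lemma mp_0 [simp]: "mp 0 = 1"
  by (simp add: mp_def)

lemma mp_add: "mp (s + t) = mp s * mp t"
  by (simp add: mp_def lookup_add power_add prod.distrib)

lemma mp_single: "i \<in> {1..n} \<Longrightarrow> mp (Poly_Mapping.single i 1) = r i"
proof -
  assume i: "i \<in> {1..n}"
  have "mp (Poly_Mapping.single i 1) = (\<Prod>j\<in>{1..n}. if j = i then r i else 1)"
    unfolding mp_def by (intro prod.cong refl) (auto simp: lookup_single when_def)
  also have "\<dots> = r i" using i by simp
  finally show ?thesis .
qed

lemma power_in_component: "x \<in> A i \<Longrightarrow> x ^ k \<in> A (i * k)"
  by (induction k) (auto simp: one_in_component_0 mult_component)

lemma mp_in_component:
  assumes "t \<in> E"
  shows "mp t \<in> A (mdeg t)"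
proof -
  have "(\<Prod>i\<in>S. r i ^ exponent t i) \<in> A (\<Sum>i\<in>S. exponent t i)" if "finite S" "S \<subseteq> {1..n}" for S
    using that
  proof (induction rule: finite_induct)
    case (insert i S)
    then have "r i \<in> A 1" by (intro r_in) auto
    from mult_component[OF power_in_component[OF this] insert.IH]
    show ?case using insert by simp
  qed (simp add: one_in_component_0)
  then show ?thesis using assms by (simp add: mp_def mdeg_eq_sum[of "{1..n}"])
qed

lemma part_mp: "t \<in> E \<Longrightarrow> part i (mp t) = (if i = mdeg t then mp t else 0)"
  by (rule part_component[OF mp_in_component])

text \<open>The span of the monomials is closed under multiplication and contains \<open>1\<close>
  and \<open>A 1\<close>, so it is a subalgebra containing the generators.\<close>

lemma span_mp: "span (mp ` E) = UNIV"
proof -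
  let ?W = "span (mp ` E)"
  have mult: "x * y \<in> ?W" if x: "x \<in> ?W" and y: "y \<in> ?W" for x y
  proof -
    have "mp s * y \<in> ?W" if s: "s \<in> E" for s
    proof -
      have "(*) (mp s) ` mp ` E \<subseteq> mp ` E"
      proof clarify
        fix t assume "t \<in> E"
        then have "s + t \<in> E" using s by simp
        then show "mp s * mp t \<in> mp ` E" by (metis image_eqI mp_add)
      qed
      then show ?thesis using mult_in_span[OF y, of "mp s"] span_mono by blast
    qed
    then have "(*) y ` mp ` E \<subseteq> ?W" by (auto simp: mult.commute)
    then show ?thesis using mult_in_span[OF x, of y] span_minimal[OF _ subspace_span]
      by (metis mult.commute subsetD)
  qed
  have "r ` {1..n} \<subseteq> mp ` E"
  proof clarify
    fix i assume "i \<in> {1..n}"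
    then show "r i \<in> mp ` E" using mp_single[of i] single_in_mons[of i "{1..n}" 1] by (metis image_eqI)
  qed
  then have "A 1 \<subseteq> ?W" using r_span span_mono by blast
  moreover have "1 \<in> ?W" by (rule span_base) (metis image_eqI mp_0 zero_in_mons)
  then have "subalgebra scale ?W" unfolding subalgebra_def using mult by auto
  ultimately have "subalgebra scale hull A 1 \<subseteq> ?W" by (rule hull_minimal)
  then show ?thesis using generated_by_component_1 by auto
qed

lemma part_in_span:
  assumes "x \<in> span (mp ` S)" and "S \<subseteq> E"
  shows "part i x \<in> span (mp ` {t \<in> S. mdeg t = i})"
  using assms(1)
proof (induction rule: span_induct)
  case base
  then show ?case by (rule subspaceI) (auto simp: part_add part_scale intro: span_zero span_add span_scale)
next
  case (step y)
  then obtain t where "t \<in> S" "t \<in> E" "y = mp t" using assms(2) by blast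
  then show ?case by (auto simp: part_mp intro: span_base span_zero)
qed

lemma component_subset_span: "A d \<subseteq> span (mp ` {t \<in> E. mdeg t = d})"
proof
  fix x assume x: "x \<in> A d"
  have "x \<in> span (mp ` E)" unfolding span_mp by (rule UNIV_I)
  from part_in_span[OF this order_refl, of d] show "x \<in> span (mp ` {t \<in> E. mdeg t = d})" using part_component[OF x] by simp
qed

text \<open>
  If \<open>mp t\<close> is congruent modulo \<open>J\<close> to a combination of smaller monomials, then \<open>t\<close> is the leading
  monomial of an element of the preimage of \<open>J\<close> in the polynomial ring.
\<close>

definition std :: "'a set \<Rightarrow> mon set" where
  "std J = {t \<in> E. mp t \<notin> span (J \<union> mp ` {s \<in> E. mless s t})}"

lemma std_subset: "std J \<subseteq> E"
  by (auto simp: std_def)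

text \<open>Reduction to normal form: a nonstandard monomial is congruent modulo \<open>J\<close> to
  a combination of smaller ones, to which the induction hypothesis applies.\<close>

lemma mp_in_span_std:
  assumes "t \<in> E"
  shows "mp t \<in> span (J \<union> mp ` {s \<in> std J. s = t \<or> mless s t})"
proof -
  have "finite {1..n}" by simp
  from this assms show ?thesis
  proof (induction rule: mless_induct)
    case (less t)
    show ?case
    proof (cases "t \<in> std J")
      case True
      then show ?thesis by (intro span_base) blast
    next
      case False
      let ?S = "span (J \<union> mp ` {s \<in> std J. s = t \<or> mless s t})"
      have "mp s \<in> ?S" if s: "s \<in> E" "mless s t" for s
      proof -
        have "{u \<in> std J. u = s \<or> mless u s} \<subseteq> {s \<in> std J. s = t \<or> mless s t}"
          using s mless_trans by blast
        then have "span (J \<union> mp ` {u \<in> std J. u = s \<or> mless u s}) \<subseteq> ?S"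
          by (intro span_mono) blast
        then show ?thesis using less.IH[OF s] by blast
      qed
      moreover have "J \<subseteq> ?S" using span_superset by blast
      ultimately have "span (J \<union> mp ` {s \<in> E. mless s t}) \<subseteq> ?S"
        by (intro span_minimal subspace_span) blast
      moreover have "mp t \<in> span (J \<union> mp ` {s \<in> E. mless s t})" using False less.hyps by (simp add: std_def)
      ultimately show ?thesis by blast
    qed
  qed
qed

text \<open>Reduction does not raise the degree because the order refines it. With the bound
  \<open>\<le> d\<close> in place of equality this covers inhomogeneous \<open>J\<close> as
  well.\<close>

lemma span_std_le:
  assumes "x \<in> span (mp ` {t \<in> E. mdeg t \<le> d})"
  shows "x \<in> span (J \<union> mp ` {t \<in> std J. mdeg t \<le> d})"
proof -
  have "mp t \<in> span (J \<union> mp ` {t \<in> std J. mdeg t \<le> d})" if t: "t \<in> E" "mdeg t \<le> d" for t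
  proof -
    have "{s \<in> std J. s = t \<or> mless s t} \<subseteq> {t \<in> std J. mdeg t \<le> d}"
      using t mless_imp_mdeg_le by force
    then have "span (J \<union> mp ` {s \<in> std J. s = t \<or> mless s t}) \<subseteq> span (J \<union> mp ` {t \<in> std J. mdeg t \<le> d})"
      by (intro span_mono) blast
    then show ?thesis using mp_in_span_std[OF t(1)] by blast
  qed
  then have "span (mp ` {t \<in> E. mdeg t \<le> d}) \<subseteq> span (J \<union> mp ` {t \<in> std J. mdeg t \<le> d})"
    by (intro span_minimal subspace_span) blast
  then show ?thesis using assms by blast
qed

lemma span_std: "x \<in> span (J \<union> mp ` std J)"
proof -
  have "mp t \<in> span (J \<union> mp ` std J)" if t: "t \<in> E" for t
  proof -
    have "span (J \<union> mp ` {s \<in> std J. s = t \<or> mless s t}) \<subseteq> span (J \<union> mp ` std J)"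
      by (intro span_mono) blast
    then show ?thesis using mp_in_span_std[OF t] by blast
  qed
  then have "span (mp ` E) \<subseteq> span (J \<union> mp ` std J)" by (intro span_minimal subspace_span) blast
  then show ?thesis using span_mp by blast
qed

text \<open>In a nontrivial relation the greatest monomial with nonzero coefficient could be
  expressed through \<open>J\<close> and smaller monomials, contrary to being standard.\<close>

lemma std_independent:
  assumes J: "subspace J" and K: "finite K" "K \<subseteq> std J"
    and sum: "(\<Sum>t\<in>K. scale (c t) (mp t)) \<in> J" and s: "s \<in> K"
  shows "c s = 0"
proof (rule ccontr)
  assume "c s \<noteq> 0"
  let ?K = "{t \<in> K. c t \<noteq> 0}"
  have fin: "finite ?K" and ne: "?K \<noteq> {}" using K s \<open>c s \<noteq> 0\<close> by auto
  obtain t where t: "t \<in> ?K" and max: "\<And>u. u \<in> ?K \<Longrightarrow> u \<noteq> t \<Longrightarrow> mless u t"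
    using mless_finite_max[OF fin ne] by blast
  let ?S = "span (J \<union> mp ` {s \<in> E. mless s t})"
  have "(\<Sum>u\<in>K. scale (c u) (mp u)) = (\<Sum>u\<in>?K. scale (c u) (mp u))"
    using K by (intro sum.mono_neutral_right) auto
  also have "\<dots> = scale (c t) (mp t) + (\<Sum>u\<in>?K - {t}. scale (c u) (mp u))"
    using t fin by (intro sum.remove) auto
  finally have eq: "scale (c t) (mp t) =
      (\<Sum>u\<in>K. scale (c u) (mp u)) - (\<Sum>u\<in>?K - {t}. scale (c u) (mp u))" by simp
  have "(\<Sum>u\<in>K. scale (c u) (mp u)) \<in> ?S" using sum by (intro span_base) blast
  moreover have "(\<Sum>u\<in>?K - {t}. scale (c u) (mp u)) \<in> ?S"
  proof (intro span_sum span_scale span_base)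
    fix u assume u: "u \<in> ?K - {t}"
    then have "mless u t" "u \<in> E" using max K std_subset by auto
    then show "mp u \<in> J \<union> mp ` {s \<in> E. mless s t}" by blast
  qed
  ultimately have "scale (c t) (mp t) \<in> ?S" unfolding eq by (rule span_diff)
  then have "scale (1 / c t) (scale (c t) (mp t)) \<in> ?S" by (rule span_scale)
  then have "mp t \<in> ?S" using t by simp
  then show False using t K by (auto simp: std_def)
qed

text \<open>Multiplication by \<open>mp u\<close> maps the ideal \<open>J\<close> to itself and
  respects the order, so it carries a reduction of \<open>t\<close> to one of \<open>u + t\<close>:
  the nonstandard monomials form a monomial ideal.\<close>

lemma std_up_closed:
  assumes J: "ideal J" and t: "t \<in> E" "t \<notin> std J" and u: "u \<in> E"
  shows "u + t \<notin> std J"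
proof -
  have "mp t \<in> span (J \<union> mp ` {s \<in> E. mless s t})" using t by (simp add: std_def)
  then have "mp u * mp t \<in> span ((*) (mp u) ` (J \<union> mp ` {s \<in> E. mless s t}))" by (rule mult_in_span)
  moreover have "(*) (mp u) ` (J \<union> mp ` {s \<in> E. mless s t}) \<subseteq> J \<union> mp ` {s \<in> E. mless s (u + t)}"
  proof -
    have "mp u * mp s \<in> mp ` {s \<in> E. mless s (u + t)}" if "s \<in> E" "mless s t" for s
      using that u mless_add_left by (intro image_eqI[of _ _ "u + s"]) (auto simp: mp_add)
    then show ?thesis using ideal_mult[OF J] by blast
  qed
  ultimately have "mp (u + t) \<in> span (J \<union> mp ` {s \<in> E. mless s (u + t)})"
    unfolding mp_add using span_mono by blast
  then show ?thesis by (simp add: std_def)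
qed

lemma std_antimono: "J \<subseteq> J' \<Longrightarrow> std J' \<subseteq> std J"
proof -
  assume "J \<subseteq> J'"
  then have "span (J \<union> mp ` {s \<in> E. mless s t}) \<subseteq> span (J' \<union> mp ` {s \<in> E. mless s t})" for t
    by (intro span_mono) blast
  then show ?thesis by (auto simp: std_def)
qed

lemma span_mp_explicit:
  assumes "x \<in> span (mp ` S)"
  obtains K c where "finite K" "K \<subseteq> S" "x = (\<Sum>t\<in>K. scale (c t) (mp t))"
proof -
  obtain T f where T: "finite T" "T \<subseteq> mp ` S" "x = (\<Sum>a\<in>T. scale (f a) a)"
    using assms unfolding span_explicit by blast
  obtain K where K: "K \<subseteq> S" "inj_on mp K" "T = mp ` K"
    using iffD1[OF subset_image_inj T(2)] by auto
  have "finite K" using T(1) K(2,3) by (auto dest: finite_imageD)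
  moreover have "x = (\<Sum>t\<in>K. scale (f (mp t)) (mp t))" using K T by (simp add: sum.reindex)
  ultimately show ?thesis using K(1) by (intro that[of K "\<lambda>t. f (mp t)"]) simp_all
qed

lemma std_decomp:
  assumes J: "subspace J"
  obtains j K c where "j \<in> J" "finite K" "K \<subseteq> std J" "x = j + (\<Sum>t\<in>K. scale (c t) (mp t))"
proof -
  obtain j w where jw: "x = j + w" "j \<in> span J" "w \<in> span (mp ` std J)"
    using span_std[of x J] unfolding span_Un by blast
  have "j \<in> J" using jw(2) span_minimal[OF order_refl J] by blast
  moreover obtain K c where "finite K" "K \<subseteq> std J" "w = (\<Sum>t\<in>K. scale (c t) (mp t))"
    using span_mp_explicit[OF jw(3)] .
  ultimately show ?thesis using jw(1) by (intro that[of j K c]) simp_all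
qed

text \<open>The normal form modulo \<open>J\<close> of an element of \<open>J'\<close> again lies in
  \<open>J'\<close>; being a combination of monomials standard for \<open>J'\<close>, it is
  zero.\<close>

lemma std_eq_imp_eq:
  assumes J: "subspace J" "subspace J'" and sub: "J \<subseteq> J'" and eq: "std J = std J'"
  shows "J = J'"
proof (intro equalityI sub subsetI)
  fix x assume x: "x \<in> J'"
  obtain j K c where d: "j \<in> J" "finite K" "K \<subseteq> std J" "x = j + (\<Sum>t\<in>K. scale (c t) (mp t))"
    using std_decomp[OF J(1)] .
  have "(\<Sum>t\<in>K. scale (c t) (mp t)) = x - j" using d by simp
  also have "\<dots> \<in> J'" using x d sub J by (intro subspace_diff) auto
  finally have "c t = 0" if "t \<in> K" for t
    using std_independent[OF J(2) d(2)] d(3) eq that by blast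
  then show "x \<in> J" using d by simp
qed

lemma std_UNIV: "std UNIV = {}"
  by (auto simp: std_def intro: span_base)

lemma zero_in_std:
  assumes J: "subspace J" and "1 \<notin> J"
  shows "0 \<in> std J"
proof -
  have "J \<union> mp ` {s \<in> E. mless s 0} = J" by (auto simp: mless_def)
  then have "mp 0 \<notin> span (J \<union> mp ` {s \<in> E. mless s 0})"
    using assms span_minimal[OF order_refl J] by auto
  then show ?thesis unfolding std_def by simp
qed

text \<open>This is the Noetherian property. Without a maximal element there is a strictly ascending
  chain, and at each step some monomial \<open>t k\<close> ceases to be standard. Dickson's lemma
  gives \<open>i < j\<close> with \<open>t i\<close> dividing \<open>t j\<close>, so
  \<open>t j\<close> was already nonstandard at stage \<open>j\<close>.\<close>

lemma ideal_maximal: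
  fixes I0 :: "'a set"
  assumes I0: "P I0" and ideal: "\<And>I. P I \<Longrightarrow> ideal I"
  obtains I where "P I" "I0 \<subseteq> I" "\<And>J. P J \<Longrightarrow> I \<subseteq> J \<Longrightarrow> J = I"
proof (rule ccontr)
  assume nt: "\<not> thesis"
  note found = that
  have step: "\<exists>J. (P J \<and> I0 \<subseteq> J) \<and> I \<subset> J" if I: "P I \<and> I0 \<subseteq> I" for I
    using I nt found by blast
  have "\<exists>f. \<forall>k. (P (f k) \<and> I0 \<subseteq> f k) \<and> f k \<subset> f (Suc k)"
  proof (rule dependent_nat_choice[of "\<lambda>_ I. P I \<and> I0 \<subseteq> I" "\<lambda>_ I J. I \<subset> J"])
    show "\<exists>I. P I \<and> I0 \<subseteq> I" using I0 by blast
  qed (rule step)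
  then obtain f :: "nat \<Rightarrow> 'a set" where f: "\<And>k. P (f k)" "\<And>k. f k \<subset> f (Suc k)" by blast
  have "\<exists>t. t \<in> std (f k) \<and> t \<notin> std (f (Suc k))" for k
    using std_eq_imp_eq[of "f k" "f (Suc k)"] std_antimono[of "f k" "f (Suc k)"] f(2)[of k]
      ideal_subspace[OF ideal[OF f(1)]] by blast
  then obtain t where t: "\<And>k. t k \<in> std (f k)" "\<And>k. t k \<notin> std (f (Suc k))" by metis
  have tE: "t k \<in> E" for k using t(1) std_subset by blast
  obtain i j where ij: "i < j" "mdvd (t i) (t j)"
    by (rule dickson_mons[of "{1..n}" t]) (simp_all only: finite_atLeastAtMost tE)
  then obtain u where u: "t j = t i + u" by (auto simp: mdvd_iff)
  have "f (Suc i) \<subseteq> f j" by (rule lift_Suc_mono_le[of f, OF less_imp_le[OF f(2)]]) (use ij(1) in simp)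
  then have "t i \<notin> std (f j)" using t(2)[of i] std_antimono by blast
  moreover have "u \<in> E" using tE[of j] u by simp
  ultimately have "u + t i \<notin> std (f j)" by (intro std_up_closed ideal f tE)
  then show False using t(1)[of j] u by (simp add: add.commute)
qed

text \<open>Project the normal form onto degree \<open>d\<close>: homogeneity keeps the part from
  \<open>J\<close> inside \<open>J\<close>, and only monomials of degree \<open>d\<close>
  survive.\<close>

lemma component_subset_span_std:
  assumes J: "homogeneous_ideal J"
  shows "A d \<subseteq> span (J \<union> mp ` {t \<in> std J. mdeg t = d})"
proof
  fix x assume x: "x \<in> A d"
  have sub: "subspace J" using J by (simp add: homogeneous_ideal_def ideal_subspace)
  obtain j K c where dec: "j \<in> J" "finite K" "K \<subseteq> std J" "x = j + (\<Sum>t\<in>K. scale (c t) (mp t))"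
    using std_decomp[OF sub] .
  have "x = part d x" using part_component[OF x] by simp
  also have "\<dots> = part d j + (\<Sum>t\<in>K. scale (c t) (part d (mp t)))"
    unfolding dec(4) by (simp add: part_add part_sum part_scale)
  also have "\<dots> \<in> span (J \<union> mp ` {t \<in> std J. mdeg t = d})"
  proof (intro span_add span_sum span_scale)
    show "part d j \<in> span (J \<union> mp ` {t \<in> std J. mdeg t = d})"
      using J dec(1) by (intro span_base) (simp add: homogeneous_ideal_def)
    fix t assume "t \<in> K"
    then have "t \<in> std J" "t \<in> E" using dec std_subset by auto
    then show "part d (mp t) \<in> span (J \<union> mp ` {t \<in> std J. mdeg t = d})"
      by (auto simp: part_mp intro: span_zero span_base)
  qed
  finally show "x \<in> span (J \<union> mp ` {t \<in> std J. mdeg t = d})" .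
qed

lemma finite_std_eq: "finite {t \<in> std J. mdeg t = d}"
  by (rule finite_mons_eq[OF _ std_subset]) simp

text \<open>The standard monomials of degree \<open>d\<close> are independent and, by the projected
  normal form, span \<open>A d\<close>; this makes the Hilbert function a count of
  monomials.\<close>

lemma dim_component: "dim (A d) = cnt (std {0}) d"
proof -
  let ?K = "{t \<in> std {0}. mdeg t = d}"
  have inj: "inj_on mp ?K" and ind: "independent (mp ` ?K)"
  proof -
    have K: "c s = 0" if "(\<Sum>t\<in>?K. scale (c t) (mp t)) = 0" "s \<in> ?K" for c s
      using std_independent[of "{0}" ?K c s] finite_std_eq that by auto
    show inj: "inj_on mp ?K"
    proof (rule inj_onI, rule ccontr)
      fix k l assume kl: "k \<in> ?K" "l \<in> ?K" "mp k = mp l" "k \<noteq> l"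
      define c where "c i = (if i = k then 1 else if i = l then - 1 else 0 :: 'k)" for i
      have "(\<Sum>i\<in>?K. scale (c i) (mp i)) = (\<Sum>i\<in>{k, l}. scale (c i) (mp i))"
        using kl finite_std_eq by (intro sum.mono_neutral_right) (auto simp: c_def)
      also have "\<dots> = 0" using kl by (simp add: c_def)
      finally have "c k = 0" using K kl by blast
      then show False by (simp add: c_def)
    qed
    show "independent (mp ` ?K)"
    proof (rule independent_if_scalars_zero)
      fix f x assume "(\<Sum>x\<in>mp ` ?K. scale (f x) x) = 0" and x: "x \<in> mp ` ?K"
      then have "(\<Sum>k\<in>?K. scale (f (mp k)) (mp k)) = 0" by (simp add: sum.reindex[OF inj])
      then show "f x = 0" using K[of "\<lambda>k. f (mp k)"] x by blast
    qed (use finite_std_eq in simp)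
  qed
  have "mp ` ?K \<subseteq> A d" using mp_in_component std_subset by auto
  moreover have "A d \<subseteq> span (mp ` ?K)"
    using component_subset_span_std[OF homogeneous_ideal_singleton_0, of d] span_Un[of "{0}" "mp ` ?K"]
      span_insert_0[of "mp ` ?K"] by simp
  ultimately have "dim (A d) = card (mp ` ?K)" using ind basis_card_eq_dim by metis
  then show ?thesis by (simp add: card_image[OF inj] cnt_def)
qed

end

section \<open>Krull dimension\<close>

lemma eventually_at_left_1: "eventually (\<lambda>x::real. 0 < x \<and> x < 1) (at_left 1)"
  using eventually_at_left_real[of 0 "1::real"] by (auto elim: eventually_mono)

lemma tendsto_0_between:
  fixes f g :: "real \<Rightarrow> real"
  assumes "(g \<longlongrightarrow> 0) (at_left 1)" and "\<And>x. 0 < x \<Longrightarrow> x < 1 \<Longrightarrow> 0 \<le> f x"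
    and "\<And>x. 0 < x \<Longrightarrow> x < 1 \<Longrightarrow> f x \<le> g x"
  shows "(f \<longlongrightarrow> 0) (at_left 1)"
proof (rule real_tendsto_sandwich[OF _ _ tendsto_const assms(1)])
  show "eventually (\<lambda>x. 0 \<le> f x) (at_left 1)" "eventually (\<lambda>x. f x \<le> g x) (at_left 1)"
    using eventually_at_left_1 by (auto elim!: eventually_mono intro: assms)
qed

lemma tendsto_one_minus_power: "k > 0 \<Longrightarrow> ((\<lambda>x::real. (1 - x) ^ k) \<longlongrightarrow> 0) (at_left 1)"
proof -
  assume k: "k > 0"
  have "((\<lambda>x::real. (1 - x) ^ k) \<longlongrightarrow> (1 - 1) ^ k) (at_left 1)" by (intro tendsto_intros)
  then show ?thesis using k by (simp add: zero_power)
qed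

context standard_graded_algebra
begin

text \<open>If neither factor lies in \<open>J\<close>, let \<open>i\<close> and \<open>j\<close> be
  the highest degrees in which their parts lie outside \<open>J\<close>. In degree
  \<open>i + j\<close> of the product all other summands lie in \<open>J\<close>, so the product of
  these two parts does too.\<close>

lemma homogeneous_ideal_primeI:
  assumes J: "homogeneous_ideal J" "J \<noteq> UNIV"
    and prime: "\<And>a b i j. a \<in> A i \<Longrightarrow> b \<in> A j \<Longrightarrow> a * b \<in> J \<Longrightarrow> a \<in> J \<or> b \<in> J"
  shows "prime_ideal J"
  unfolding prime_ideal_iff
proof (intro conjI allI impI)
  show ideal: "ideal J" using J by (simp add: homogeneous_ideal_def)
  show "J \<noteq> UNIV" by fact
  fix x y assume xy: "x * y \<in> J"
  show "x \<in> J \<or> y \<in> J"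
  proof (rule ccontr)
    assume ne: "\<not> (x \<in> J \<or> y \<in> J)"
    have top: "\<exists>i. part i z \<notin> J \<and> (\<forall>k>i. part k z \<in> J)" if z: "z \<notin> J" for z
    proof -
      let ?S = "{i. part i z \<notin> J}"
      have "?S \<subseteq> {i. part i z \<noteq> 0}" using ideal_0[OF ideal] by auto
      then have "finite ?S" using finite_part finite_subset by blast
      moreover have "?S \<noteq> {}"
      proof
        assume "?S = {}"
        then have "(\<Sum>i | part i z \<noteq> 0. part i z) \<in> J"
          by (intro subspace_sum ideal_subspace ideal) auto
        then show False using z sum_part[of z] by simp
      qed
      ultimately obtain M where M: "M \<in> ?S" "\<And>k. k \<in> ?S \<Longrightarrow> k \<le> M"
        using Max_in[of ?S] Max_ge[of ?S] by metis
      then have "part k z \<in> J" if "k > M" for k using that by (metis mem_Collect_eq not_less)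
      then show ?thesis using M(1) by blast
    qed
    obtain i where i: "part i x \<notin> J" "\<And>k. k > i \<Longrightarrow> part k x \<in> J" using top ne by blast
    obtain j where j: "part j y \<notin> J" "\<And>k. k > j \<Longrightarrow> part k y \<in> J" using top ne by blast
    let ?f = "\<lambda>k. part k x * part (i + j - k) y"
    have "part (i + j) (x * y) = ?f i + (\<Sum>k\<in>{..i + j} - {i}. ?f k)"
      unfolding part_product by (intro sum.remove) auto
    then have eq: "part i x * part j y = part (i + j) (x * y) - (\<Sum>k\<in>{..i + j} - {i}. ?f k)" by simp
    have "?f k \<in> J" if "k \<noteq> i" "k \<le> i + j" for k
    proof (cases "k > i")
      case True
      then show ?thesis using i(2) ideal_mult'[OF ideal] by blast
    next
      case False
      then have "part (i + j - k) y \<in> J" using that by (intro j(2)) auto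
      then show ?thesis using ideal_mult[OF ideal] by blast
    qed
    then have "(\<Sum>k\<in>{..i + j} - {i}. ?f k) \<in> J" by (intro subspace_sum ideal_subspace ideal) auto
    moreover have "part (i + j) (x * y) \<in> J" using J xy by (simp add: homogeneous_ideal_def)
    ultimately have "part i x * part j y \<in> J" unfolding eq by (intro ideal_diff ideal)
    then show False using prime[OF part_in part_in] i(1) j(1) by blast
  qed
qed

end

section \<open>Exact sequences, chains of primes and the order of the pole\<close>

context presented_algebra
begin

lemma finite_vars: "finite {1..n}"
  by simp

text \<open>Degree \<open>d\<close> of the exact sequence for \<open>I\<close>,
  \<open>I + aR\<close> and \<open>I : a\<close>: modulo \<open>I\<close>, the monomials standard
  for \<open>I + aR\<close> together with the \<open>a\<close>-multiples of those standard for
  \<open>I : a\<close> span everything of degree \<open>d\<close>.\<close>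

lemma cnt_std_exact:
  assumes I: "homogeneous_ideal I" and a: "a \<in> A s"
  shows "cnt (std I) d \<le> cnt (std (ideal_adjoin I a)) d +
    (if s \<le> d then cnt (std (ideal_colon I a)) (d - s) else 0)"
proof -
  have ideal: "ideal I" using I by (simp add: homogeneous_ideal_def)
  let ?I = "ideal_adjoin I a" and ?C = "ideal_colon I a"
  let ?B1 = "mp ` {t \<in> std ?I. mdeg t = d}"
  let ?B2 = "if s \<le> d then (\<lambda>t. a * mp t) ` {t \<in> std ?C. mdeg t = d - s} else {}"
  have "mp t \<in> span (I \<union> (?B1 \<union> ?B2))" if t: "t \<in> std I" "mdeg t = d" for t
  proof -
    have tA: "mp t \<in> A d" using t mp_in_component std_subset by blast
    then have "mp t \<in> span (?I \<union> ?B1)"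
      using component_subset_span_std[OF homogeneous_ideal_adjoin[OF I a]] by blast
    then obtain u b where ub: "mp t = u + b" "u \<in> span ?I" "b \<in> span ?B1" unfolding span_Un by blast
    have "u \<in> ?I"
      using ub(2) span_minimal[OF order_refl ideal_subspace[OF ideal_ideal_adjoin[OF ideal]]] by blast
    then obtain x y where xy: "u = x + a * y" "x \<in> I" by (auto simp: ideal_adjoin_def)
    \<comment> \<open>Since \<open>b\<close> is homogeneous of degree \<open>d\<close>, so is
      \<open>u\<close>. It may thus be replaced by its part of degree \<open>d\<close>, which
      confines the cofactor of \<open>a\<close> to degree \<open>d - s\<close>.\<close>
    have "?B1 \<subseteq> A d" using mp_in_component std_subset by auto
    then have "b \<in> A d" using ub(3) span_minimal[OF _ subspace_component] by blast
    then have "u \<in> A d" using tA ub(1) subspace_diff[OF subspace_component, of "mp t" d b] by simp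
    then have "u = part d u" using part_component by simp
    also have "\<dots> = part d x + (if s \<le> d then a * part (d - s) y else 0)"
      by (simp add: xy part_add part_mult[OF a])
    finally have u: "u = part d x + (if s \<le> d then a * part (d - s) y else 0)" .
    have "part d x \<in> I" using I xy by (simp add: homogeneous_ideal_def)
    then have "part d x \<in> span (I \<union> ?B2)" by (intro span_base) blast
    moreover have "(if s \<le> d then a * part (d - s) y else 0) \<in> span (I \<union> ?B2)"
    proof (cases "s \<le> d")
      case True
      have "part (d - s) y \<in> span (?C \<union> mp ` {t \<in> std ?C. mdeg t = d - s})"
        using component_subset_span_std[OF homogeneous_ideal_colon[OF I a]] part_in by blast
      then have "a * part (d - s) y \<in> span ((*) a ` (?C \<union> mp ` {t \<in> std ?C. mdeg t = d - s}))"
        by (rule mult_in_span)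
      moreover have "(*) a ` (?C \<union> mp ` {t \<in> std ?C. mdeg t = d - s}) \<subseteq> I \<union> ?B2"
        using True by (auto simp: ideal_colon_def)
      ultimately show ?thesis using True span_mono by (metis (no_types, lifting) subsetD)
    qed (simp add: span_zero)
    ultimately have "u \<in> span (I \<union> ?B2)" unfolding u by (rule span_add)
    then have "u \<in> span (I \<union> (?B1 \<union> ?B2))" using span_mono[of "I \<union> ?B2" "I \<union> (?B1 \<union> ?B2)"] by blast
    moreover have "b \<in> span (I \<union> (?B1 \<union> ?B2))" using ub(3) span_mono[of ?B1 "I \<union> (?B1 \<union> ?B2)"] by blast
    ultimately show ?thesis unfolding ub(1) by (rule span_add)
  qed
  then have "card {t \<in> std I. mdeg t = d} \<le> card (?B1 \<union> ?B2)"
    using std_independent[OF ideal_subspace[OF ideal] finite_std_eq]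
    by (intro card_le_of_independent_modulo[OF ideal_subspace[OF ideal], where v = mp])
      (auto simp: finite_std_eq)
  also have "\<dots> \<le> card ?B1 + card ?B2" by (rule card_Un_le)
  also have "\<dots> \<le> card {t \<in> std ?I. mdeg t = d} +
      (if s \<le> d then card {t \<in> std ?C. mdeg t = d - s} else 0)"
    by (intro add_mono) (auto intro: card_image_le simp: finite_std_eq)
  finally show ?thesis unfolding cnt_def .
qed

lemma val_std_sums: "0 \<le> x \<Longrightarrow> x < 1 \<Longrightarrow> (\<lambda>d. real (cnt (std J) d) * x ^ d) sums val (std J) x"
  by (rule val_sums[OF finite_vars std_subset])

lemma val_std_nonneg: "0 \<le> x \<Longrightarrow> x < 1 \<Longrightarrow> 0 \<le> val (std J) x"
  by (rule val_nonneg[OF finite_vars std_subset])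

lemma val_std_antimono: "J \<subseteq> J' \<Longrightarrow> 0 \<le> x \<Longrightarrow> x < 1 \<Longrightarrow> val (std J') x \<le> val (std J) x"
  by (rule val_mono[OF finite_vars std_antimono std_subset])

lemma val_std_exact:
  assumes I: "homogeneous_ideal I" and a: "a \<in> A s" and x: "0 \<le> x" "x < 1"
  shows "val (std I) x \<le> val (std (ideal_adjoin I a)) x + x ^ s * val (std (ideal_colon I a)) x"
proof (rule sums_le[OF _ val_std_sums[OF x] sums_add[OF val_std_sums[OF x] sums_shift_power[OF val_std_sums[OF x]]]])
  fix d
  have "real (cnt (std I) d) \<le> real (cnt (std (ideal_adjoin I a)) d) +
      (if s \<le> d then real (cnt (std (ideal_colon I a)) (d - s)) else 0)"
    using cnt_std_exact[OF I a, of d] by (auto split: if_splits)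
  then show "real (cnt (std I) d) * x ^ d \<le> real (cnt (std (ideal_adjoin I a)) d) * x ^ d +
      (if s \<le> d then real (cnt (std (ideal_colon I a)) (d - s)) else 0) * x ^ d"
    unfolding distrib_right[symmetric] using x by (intro mult_right_mono) auto
qed

text \<open>\<open>I\<close> is small of order \<open>d\<close> if \<open>R / I\<close> has dimension less than \<open>d\<close>.\<close>

definition small :: "nat \<Rightarrow> 'a set \<Rightarrow> bool" where
  "small d I \<longleftrightarrow> ((\<lambda>x. (1 - x) ^ d * val (std I) x) \<longlongrightarrow> 0) (at_left 1)"

lemma small_UNIV: "small d UNIV"
  by (simp add: small_def std_UNIV)

lemma smallI:
  assumes "((\<lambda>x. (1 - x) ^ d * f x) \<longlongrightarrow> 0) (at_left 1)"
    and "\<And>x. 0 < x \<Longrightarrow> x < 1 \<Longrightarrow> val (std I) x \<le> f x"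
  shows "small d I"
  unfolding small_def
  by (rule tendsto_0_between[OF assms(1)]) (auto intro!: mult_left_mono assms(2) simp: val_std_nonneg)

text \<open>If \<open>a * b \<in> I\<close> with both homogeneous factors outside, then
  \<open>I + aR\<close> and \<open>I : a\<close> are strictly larger than \<open>I\<close>, hence
  small, and the exact sequence makes \<open>I\<close> small.\<close>

lemma prime_ideal_of_maximal:
  assumes I: "homogeneous_ideal I" "\<not> small d I"
    and max: "\<And>J. homogeneous_ideal J \<Longrightarrow> \<not> small d J \<Longrightarrow> I \<subseteq> J \<Longrightarrow> J = I"
  shows "prime_ideal I"
proof (rule homogeneous_ideal_primeI[OF I(1)])
  show "I \<noteq> UNIV" using I(2) small_UNIV by blast
  fix a b s t assume a: "a \<in> A s" and b: "b \<in> A t" and ab: "a * b \<in> I"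
  show "a \<in> I \<or> b \<in> I"
  proof (rule ccontr)
    assume ne: "\<not> (a \<in> I \<or> b \<in> I)"
    have ideal: "ideal I" using I(1) by (simp add: homogeneous_ideal_def)
    have "small d (ideal_adjoin I a)"
      using max[OF homogeneous_ideal_adjoin[OF I(1) a]] ideal_subset_adjoin ideal_adjoin_self[OF ideal] ne
      by blast
    moreover have "b \<in> ideal_colon I a" using ab by (simp add: ideal_colon_def)
    then have "small d (ideal_colon I a)"
      using max[OF homogeneous_ideal_colon[OF I(1) a]] ideal_subset_colon[OF ideal] ne by blast
    ultimately have lim: "((\<lambda>x. (1 - x) ^ d * (val (std (ideal_adjoin I a)) x + val (std (ideal_colon I a)) x)) \<longlongrightarrow> 0) (at_left 1)"
      unfolding small_def distrib_left using tendsto_add by fastforce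
    have "small d I"
    proof (rule smallI[OF lim])
      fix x :: real assume x: "0 < x" "x < 1"
      have "val (std I) x \<le> val (std (ideal_adjoin I a)) x + x ^ s * val (std (ideal_colon I a)) x"
        using x by (intro val_std_exact I a) auto
      also have "x ^ s * val (std (ideal_colon I a)) x \<le> 1 * val (std (ideal_colon I a)) x"
        using x by (intro mult_right_mono power_le_one val_std_nonneg) auto
      finally show "val (std I) x \<le> val (std (ideal_adjoin I a)) x + val (std (ideal_colon I a)) x" by simp
    qed
    then show False using I(2) by blast
  qed
qed

text \<open>The chain grows upwards: its least member is a maximal \<open>P\<close> above
  \<open>I\<close>, and the remaining ones are found above \<open>P + aR\<close> for a linear form
  \<open>a\<close> outside \<open>P\<close>, with \<open>d\<close> lowered by one.\<close>

lemma prime_chain_exists: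
  assumes "homogeneous_ideal I" and "\<not> small d I"
  shows "\<exists>P. (\<forall>i\<le>d. prime_ideal (P i)) \<and> (\<forall>i<d. P i \<subset> P (Suc i)) \<and> I \<subseteq> P 0"
  using assms
proof (induction d arbitrary: I)
  case (0 I)
  obtain P where P: "homogeneous_ideal P \<and> \<not> small 0 P" "I \<subseteq> P"
      "\<And>J. homogeneous_ideal J \<and> \<not> small 0 J \<Longrightarrow> P \<subseteq> J \<Longrightarrow> J = P"
    using ideal_maximal[of "\<lambda>J. homogeneous_ideal J \<and> \<not> small 0 J" I] 0
    unfolding homogeneous_ideal_def by (metis (no_types, lifting))
  then have "prime_ideal P" by (intro prime_ideal_of_maximal[of P 0]) auto
  then show ?case using P(2) by (intro exI[of _ "\<lambda>_. P"]) auto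
next
  case (Suc d I)
  obtain P where P: "homogeneous_ideal P \<and> \<not> small (Suc d) P" "I \<subseteq> P"
      "\<And>J. homogeneous_ideal J \<and> \<not> small (Suc d) J \<Longrightarrow> P \<subseteq> J \<Longrightarrow> J = P"
    using ideal_maximal[of "\<lambda>J. homogeneous_ideal J \<and> \<not> small (Suc d) J" I] Suc.prems
    unfolding homogeneous_ideal_def by (metis (no_types, lifting))
  then have prime: "prime_ideal P" by (intro prime_ideal_of_maximal[of P "Suc d"]) auto
  have ideal: "ideal P" using P(1) by (simp add: homogeneous_ideal_def)
  \<comment> \<open>If \<open>P\<close> contained all linear forms, the monomial \<open>1\<close>
    alone could be standard, and a bounded series is small of order \<open>Suc d\<close>.\<close>
  have "\<exists>a\<in>A 1. a \<notin> P"
  proof (rule ccontr)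
    assume "\<not> (\<exists>a\<in>A 1. a \<notin> P)"
    then have rP: "r i \<in> P" if "i \<in> {1..n}" for i using r_in[OF that] by blast
    have "std P \<subseteq> mons {}"
    proof
      fix t assume t: "t \<in> std P"
      show "t \<in> mons {}"
      proof (rule ccontr)
        assume "t \<notin> mons {}"
        then obtain i where i: "i \<in> Poly_Mapping.keys t" unfolding mons_def by blast
        have "t \<in> E" using t std_subset by blast
        then have iV: "i \<in> {1..n}" using i unfolding mons_def by blast
        have "mdvd (Poly_Mapping.single i 1) t"
          using i by (auto simp: mdvd_def lookup_single when_def in_keys_iff)
        then obtain u where "t = Poly_Mapping.single i 1 + u" by (auto simp: mdvd_iff)
        then have "mp t = r i * mp u" using mp_single[OF iV] by (simp only: mp_add)
        then have "mp t \<in> P" using rP[OF iV] ideal_mult'[OF ideal] by simp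
        then show False using t by (auto simp: std_def intro: span_base)
      qed
    qed
    then have "val (std P) x \<le> 1" if "0 < x" "x < 1" for x
      using val_mono[of "{}" "std P" "mons {}" x] val_mons[of "{}" x] that by simp
    moreover have "((\<lambda>x::real. (1 - x) ^ Suc d * 1) \<longlongrightarrow> 0) (at_left 1)"
      using tendsto_one_minus_power[of "Suc d"] by simp
    ultimately have "small (Suc d) P" by (rule smallI[rotated])
    then show False using P(1) by blast
  qed
  then obtain a where a: "a \<in> A 1" "a \<notin> P" by blast
  let ?J = "ideal_adjoin P a"
  have "\<not> small d ?J"
  proof
    assume sm: "small d ?J"
    have "small (Suc d) P"
      unfolding small_def
    proof (rule tendsto_0_between[OF sm[unfolded small_def]])
      fix x :: real assume x: "0 < x" "x < 1"
      show "0 \<le> (1 - x) ^ Suc d * val (std P) x" using x by (simp add: val_std_nonneg)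
      \<comment> \<open>As \<open>P\<close> is prime and \<open>a\<close> lies outside it,
        \<open>P : a\<close> is \<open>P\<close> itself, and the inequality can be solved for
        \<open>(1 - x) * val (std P) x\<close>.\<close>
      have "val (std P) x \<le> val (std ?J) x + x ^ 1 * val (std (ideal_colon P a)) x"
        using P(1) a x by (intro val_std_exact) auto
      then have "(1 - x) * val (std P) x \<le> val (std ?J) x"
        by (simp add: ideal_colon_prime[OF prime a(2)] algebra_simps)
      then have "(1 - x) ^ d * ((1 - x) * val (std P) x) \<le> (1 - x) ^ d * val (std ?J) x"
        using x by (intro mult_left_mono) auto
      then show "(1 - x) ^ Suc d * val (std P) x \<le> (1 - x) ^ d * val (std ?J) x"
        by (simp add: mult_ac)
    qed
    then show False using P(1) by blast
  qed
  then obtain Q where Q: "\<forall>i\<le>d. prime_ideal (Q i)" "\<forall>i<d. Q i \<subset> Q (Suc i)" "?J \<subseteq> Q 0"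
    using Suc.IH[OF homogeneous_ideal_adjoin] P(1) a(1) by metis
  have "P \<subset> Q 0"
    using ideal_subset_adjoin[of P a] ideal_adjoin_self[OF ideal, of a] a(2) Q(3) by blast
  then have "(\<forall>i\<le>Suc d. prime_ideal (case_nat P Q i)) \<and>
      (\<forall>i<Suc d. case_nat P Q i \<subset> case_nat P Q (Suc i)) \<and> I \<subseteq> case_nat P Q 0"
    using Q prime P(2) by (auto split: nat.split)
  then show ?case by blast
qed

text \<open>The Hilbert function of the filtration by degree. It is adapted to inhomogeneous ideals,
  and its generating function has one more factor \<open>1 / (1 - x)\<close>.\<close>

definition cnt_le :: "mon set \<Rightarrow> nat \<Rightarrow> nat" where
  "cnt_le U d = card {t \<in> U. mdeg t \<le> d}"

lemma finite_std_le: "finite {t \<in> std J. mdeg t \<le> d}"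
  by (rule finite_subset[OF _ finite_mons_le[OF finite_vars, of d]]) (use std_subset in auto)

lemma cnt_le_sums:
  assumes x: "0 \<le> x" "x < 1"
  shows "(\<lambda>d. real (cnt_le (std J) d) * x ^ d) sums (val (std J) x / (1 - x))"
proof (rule sums_divide_one_minus[OF val_std_sums[OF x] _ x])
  show "real (cnt_le (std J) 0) = real (cnt (std J) 0)"
    by (simp add: cnt_le_def cnt_def)
  fix d
  have "{t \<in> std J. mdeg t \<le> Suc d} = {t \<in> std J. mdeg t = Suc d} \<union> {t \<in> std J. mdeg t \<le> d}" by auto
  then have "cnt_le (std J) (Suc d) = cnt (std J) (Suc d) + cnt_le (std J) d"
    unfolding cnt_le_def cnt_def by (simp add: card_Un_disjoint finite_std_eq finite_std_le disjoint_iff)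
  then show "real (cnt_le (std J) (Suc d)) = real (cnt (std J) (Suc d)) + real (cnt_le (std J) d)" by simp
qed simp

lemma mult_in_span_le:
  assumes "x \<in> span (mp ` {t \<in> E. mdeg t \<le> d})" and "y \<in> span (mp ` {t \<in> E. mdeg t \<le> e})"
  shows "x * y \<in> span (mp ` {t \<in> E. mdeg t \<le> d + e})"
proof -
  let ?S = "span (mp ` {t \<in> E. mdeg t \<le> d + e})"
  have "mp t * x \<in> ?S" if t: "t \<in> E" "mdeg t \<le> e" for t
  proof -
    have "(*) (mp t) ` mp ` {t \<in> E. mdeg t \<le> d} \<subseteq> mp ` {t \<in> E. mdeg t \<le> d + e}"
    proof clarify
      fix s assume "s \<in> E" "mdeg s \<le> d"
      then have "t + s \<in> {t \<in> E. mdeg t \<le> d + e}" using t by simp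
      then show "mp t * mp s \<in> mp ` {t \<in> E. mdeg t \<le> d + e}" by (metis (no_types, lifting) image_eqI mp_add)
    qed
    then show ?thesis using mult_in_span[OF assms(1), of "mp t"] span_mono by blast
  qed
  then have "(*) x ` mp ` {t \<in> E. mdeg t \<le> e} \<subseteq> ?S" by (auto simp: mult.commute)
  then show ?thesis using mult_in_span[OF assms(2), of x] span_minimal[OF _ subspace_span] by blast
qed

text \<open>
  Multiplication by \<open>a \<in> Q - P\<close> is injective on \<open>R / P\<close>, so that \<open>R / P\<close> contains, up to degree \<open>d + s\<close>,
  a copy of itself up to degree \<open>d\<close> which dies in \<open>R / Q\<close>.
\<close>

lemma cnt_le_prime:
  assumes P: "prime_ideal P" and Q: "ideal Q" and PQ: "P \<subseteq> Q" and a: "a \<in> Q" "a \<notin> P"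
    and as: "a \<in> span (mp ` {t \<in> E. mdeg t \<le> s})"
  shows "cnt_le (std P) d + cnt_le (std Q) (d + s) \<le> cnt_le (std P) (d + s)"
proof -
  have ideal: "ideal P" using P by (simp add: prime_ideal_iff)
  have sP: "subspace P" and sQ: "subspace Q" using ideal Q ideal_subspace by auto
  let ?KP = "{t \<in> std P. mdeg t \<le> d}" and ?KQ = "{t \<in> std Q. mdeg t \<le> d + s}"
  let ?B = "mp ` {t \<in> std P. mdeg t \<le> d + s}"
  \<comment> \<open>The disjoint sum keeps the copy of \<open>R / P\<close> multiplied by
    \<open>a\<close> apart from the monomials standard for \<open>Q\<close>.\<close>
  define v where "v = case_sum (\<lambda>t. a * mp t) mp"
  have "card (?KP <+> ?KQ) \<le> card ?B"
  proof (rule card_le_of_independent_modulo[OF sP, where v = v])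
    fix c k assume sum: "(\<Sum>k\<in>?KP <+> ?KQ. scale (c k) (v k)) \<in> P" and k: "k \<in> ?KP <+> ?KQ"
    let ?x = "\<Sum>t\<in>?KP. scale (c (Inl t)) (mp t)" and ?y = "\<Sum>t\<in>?KQ. scale (c (Inr t)) (mp t)"
    have "(\<Sum>k\<in>?KP <+> ?KQ. scale (c k) (v k)) = a * ?x + ?y"
      by (subst sum.Plus) (auto simp: finite_std_le v_def sum_distrib_left mult_scale_right)
    then have xy: "a * ?x + ?y \<in> P" using sum by simp
    \<comment> \<open>Modulo \<open>Q\<close> the multiple of \<open>a\<close> disappears, so the
      coefficients of \<open>?y\<close> vanish first. There remains \<open>a * ?x \<in> P\<close>,
      from which primality removes \<open>a\<close>.\<close>
    then have "a * ?x + ?y \<in> Q" using PQ by blast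
    moreover have "a * ?x \<in> Q" using a(1) ideal_mult'[OF Q] by blast
    ultimately have yQ: "?y \<in> Q" using ideal_diff[OF Q] by fastforce
    have cQ: "c (Inr t) = 0" if "t \<in> ?KQ" for t
      using std_independent[OF sQ finite_std_le _ yQ that] by blast
    then have "?y = 0" by simp
    then have "a * ?x \<in> P" using xy by simp
    then have xP: "?x \<in> P" using P a(2) by (auto simp: prime_ideal_iff)
    have cP: "c (Inl t) = 0" if "t \<in> ?KP" for t
      using std_independent[OF sP finite_std_le _ xP that] by blast
    show "c k = 0" using k cP cQ by blast
  next
    fix k assume k: "k \<in> ?KP <+> ?KQ"
    show "v k \<in> span (P \<union> ?B)"
    proof (rule span_std_le)
      have "a * mp t \<in> span (mp ` {t \<in> E. mdeg t \<le> d + s})" if "t \<in> ?KP" for t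
      proof -
        have "mp t \<in> span (mp ` {t \<in> E. mdeg t \<le> d})" using that std_subset by (intro span_base) auto
        then show ?thesis by (subst mult.commute) (rule mult_in_span_le[OF _ as])
      qed
      moreover have "mp t \<in> span (mp ` {t \<in> E. mdeg t \<le> d + s})" if "t \<in> ?KQ" for t
        using that std_subset by (intro span_base) auto
      ultimately show "v k \<in> span (mp ` {t \<in> E. mdeg t \<le> d + s})" using k by (auto simp: v_def)
    qed
  qed (auto simp: finite_std_le)
  also have "card ?B \<le> card {t \<in> std P. mdeg t \<le> d + s}" by (rule card_image_le[OF finite_std_le])
  finally show ?thesis by (simp add: cnt_le_def card_Plus finite_std_le)
qed

text \<open>Writing \<open>V\<close> for \<open>val\<close>, the counting inequality sums to
  \<open>x^s V_P + V_Q <= V_P\<close>, where the common factor \<open>1 / (1 - x)\<close> has been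
  cancelled. Then \<open>1 - x^s\<close> is bounded by a multiple of \<open>1 - x\<close>.\<close>

lemma val_prime_less:
  assumes P: "prime_ideal P" and Q: "ideal Q" and PQ: "P \<subset> Q"
  obtains C where "C > 0" "\<And>x. 0 < x \<Longrightarrow> x < 1 \<Longrightarrow> val (std Q) x \<le> C * (1 - x) * val (std P) x"
proof -
  obtain a where a: "a \<in> Q" "a \<notin> P" using PQ by blast
  have "\<exists>s. a \<in> span (mp ` {t \<in> E. mdeg t \<le> s})"
  proof -
    obtain N where N: "a = (\<Sum>k\<le>N. part k a)" using part_bound[of a] by blast
    have "part k a \<in> span (mp ` {t \<in> E. mdeg t \<le> N})" if "k \<le> N" for k
    proof -
      have "span (mp ` {t \<in> E. mdeg t = k}) \<subseteq> span (mp ` {t \<in> E. mdeg t \<le> N})"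
        using that by (intro span_mono) auto
      then show ?thesis using component_subset_span part_in by blast
    qed
    then have "(\<Sum>k\<le>N. part k a) \<in> span (mp ` {t \<in> E. mdeg t \<le> N})" by (intro span_sum) auto
    then show ?thesis using N by auto
  qed
  then obtain s where s: "a \<in> span (mp ` {t \<in> E. mdeg t \<le> s})" by blast
  show ?thesis
  proof (rule that)
    \<comment> \<open>The factor \<open>s\<close> would bound \<open>1 - x^s\<close>; its successor
      remains positive when \<open>s = 0\<close>.\<close>
    show "real (Suc s) > 0" by simp
    fix x :: real assume x: "0 < x" "x < 1"
    have "x ^ s * (val (std P) x / (1 - x)) + val (std Q) x / (1 - x) \<le> val (std P) x / (1 - x)"
    proof (rule sums_le)
      show "(\<lambda>d. (if s \<le> d then real (cnt_le (std P) (d - s)) else 0) * x ^ d + real (cnt_le (std Q) d) * x ^ d)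
        sums (x ^ s * (val (std P) x / (1 - x)) + val (std Q) x / (1 - x))"
        using x by (intro sums_add sums_shift_power cnt_le_sums) auto
      show "(\<lambda>d. real (cnt_le (std P) d) * x ^ d) sums (val (std P) x / (1 - x))"
        using x by (intro cnt_le_sums) auto
      fix d
      have "(if s \<le> d then cnt_le (std P) (d - s) else 0) + cnt_le (std Q) d \<le> cnt_le (std P) d"
      proof (cases "s \<le> d")
        case True
        then show ?thesis using cnt_le_prime[OF P Q _ a s, of "d - s"] PQ by auto
      next
        case False
        have "std Q \<subseteq> std P" using PQ by (intro std_antimono) auto
        then have "cnt_le (std Q) d \<le> cnt_le (std P) d"
          unfolding cnt_le_def by (intro card_mono finite_std_le) auto
        then show ?thesis using False by simp
      qed
      then have "real (if s \<le> d then cnt_le (std P) (d - s) else 0) + real (cnt_le (std Q) d) \<le> real (cnt_le (std P) d)"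
        by linarith
      then have "(if s \<le> d then real (cnt_le (std P) (d - s)) else 0) + real (cnt_le (std Q) d) \<le> real (cnt_le (std P) d)"
        by (cases "s \<le> d") auto
      then show "(if s \<le> d then real (cnt_le (std P) (d - s)) else 0) * x ^ d + real (cnt_le (std Q) d) * x ^ d
          \<le> real (cnt_le (std P) d) * x ^ d"
        unfolding distrib_right[symmetric] using x by (intro mult_right_mono) auto
    qed
    then have "(x ^ s * val (std P) x + val (std Q) x) / (1 - x) \<le> val (std P) x / (1 - x)"
      by (simp add: add_divide_distrib)
    then have "x ^ s * val (std P) x + val (std Q) x \<le> val (std P) x"
      using x by (simp add: divide_le_cancel)
    then have "val (std Q) x \<le> (1 - x ^ s) * val (std P) x" by (simp add: algebra_simps)
    also have "1 - x ^ s \<le> real (Suc s) * (1 - x)"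
    proof -
      have "1 - x ^ s = (1 - x) * (\<Sum>i<s. x ^ i)" by (rule one_diff_power_eq)
      also have "\<dots> \<le> (1 - x) * (\<Sum>i<s. 1)" using x by (intro mult_left_mono sum_mono power_le_one) auto
      also have "\<dots> \<le> real (Suc s) * (1 - x)" using x by (simp add: algebra_simps)
      finally show ?thesis .
    qed
    then have "(1 - x ^ s) * val (std P) x \<le> real (Suc s) * (1 - x) * val (std P) x"
      using x by (intro mult_right_mono val_std_nonneg) auto
    finally show "val (std Q) x \<le> real (Suc s) * (1 - x) * val (std P) x" .
  qed
qed

text \<open>Each inclusion costs a factor \<open>1 - x\<close>. At the top of the chain the ideal is
  proper, so the monomial \<open>1\<close> is standard and the series is at least
  \<open>1\<close>.\<close>

lemma val_prime_chain:
  assumes "\<forall>i\<le>l. prime_ideal (P i)" and "\<forall>i<l. P i \<subset> P (Suc i)"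
  shows "\<exists>c>0. \<forall>x. 0 < x \<and> x < 1 \<longrightarrow> c \<le> (1 - x) ^ l * val (std (P 0)) x"
  using assms
proof (induction l arbitrary: P)
  case (0 P)
  have id: "ideal (P 0)" "P 0 \<noteq> UNIV" using 0 by (auto simp: prime_ideal_iff)
  then have "0 \<in> std (P 0)" using ideal_eq_UNIV by (intro zero_in_std ideal_subspace) auto
  then have "1 \<le> val (std (P 0)) x" if "0 < x" "x < 1" for x
    using val_ge_power[OF finite_vars std_subset _ _ that(2)] that by fastforce
  then show ?case by (intro exI[of _ 1]) auto
next
  case (Suc l P)
  obtain c where c: "c > 0" "\<And>x. 0 < x \<Longrightarrow> x < 1 \<Longrightarrow> c \<le> (1 - x) ^ l * val (std (P 1)) x"
    using Suc.IH[of "\<lambda>i. P (Suc i)"] Suc.prems by auto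
  obtain C where C: "C > 0"
      "\<And>x. 0 < x \<Longrightarrow> x < 1 \<Longrightarrow> val (std (P 1)) x \<le> C * (1 - x) * val (std (P 0)) x"
    using val_prime_less[of "P 0" "P 1"] Suc.prems by (auto simp: prime_ideal_iff)
  have "c / C \<le> (1 - x) ^ Suc l * val (std (P 0)) x" if x: "0 < x" "x < 1" for x
  proof -
    have "c \<le> (1 - x) ^ l * val (std (P 1)) x" using c x by blast
    also have "\<dots> \<le> (1 - x) ^ l * (C * (1 - x) * val (std (P 0)) x)"
      using x by (intro mult_left_mono C) auto
    finally show ?thesis using C(1) by (simp add: field_simps)
  qed
  then show ?case using c(1) C(1) by (intro exI[of _ "c / C"]) auto
qed

text \<open>A chain of length \<open>l > d\<close> would keep \<open>(1 - x)^l H\<close> away from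
  zero, although it is a convergent function times \<open>(1 - x)^(l - d)\<close>. Conversely the
  nonzero limit says that \<open>{0}\<close> is not small of order \<open>d\<close>, which yields a
  chain of length \<open>d\<close>.\<close>

theorem krull_dim_eq_pole_order:
  assumes lim: "((\<lambda>x. (1 - x) ^ d * val (std {0}) x) \<longlongrightarrow> L) (at_left 1)" and L: "L \<noteq> 0"
  shows "krull_dim TYPE('a) = enat d"
proof (rule antisym)
  show "krull_dim TYPE('a) \<le> enat d"
    unfolding krull_dim_def
  proof (rule Sup_least)
    fix e assume "e \<in> {enat l |l. \<exists>P :: nat \<Rightarrow> 'a set. (\<forall>i\<le>l. prime_ideal (P i)) \<and> (\<forall>i<l. P i \<subset> P (Suc i))}"
    then obtain l and P :: "nat \<Rightarrow> 'a set" where e: "e = enat l"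
      and P: "\<forall>i\<le>l. prime_ideal (P i)" "\<forall>i<l. P i \<subset> P (Suc i)" by blast
    obtain c where c: "c > 0" "\<forall>x. 0 < x \<and> x < 1 \<longrightarrow> c \<le> (1 - x) ^ l * val (std (P 0)) x"
      using val_prime_chain[OF P] by blast
    have "l \<le> d"
    proof (rule ccontr)
      assume "\<not> l \<le> d"
      then have ld: "l = (l - d) + d" "l - d > 0" by auto
      have "((\<lambda>x. (1 - x) ^ (l - d) * ((1 - x) ^ d * val (std {0}) x)) \<longlongrightarrow> 0 * L) (at_left 1)"
        by (intro tendsto_mult lim tendsto_one_minus_power ld)
      moreover have "eventually (\<lambda>x. c \<le> (1 - x) ^ (l - d) * ((1 - x) ^ d * val (std {0}) x)) (at_left 1)"
        using eventually_at_left_1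
      proof eventually_elim
        case (elim x)
        have "{0} \<subseteq> P 0" using P(1) by (auto simp: prime_ideal_iff ideal_0)
        then have "val (std (P 0)) x \<le> val (std {0}) x" using elim by (intro val_std_antimono) auto
        then have "(1 - x) ^ l * val (std (P 0)) x \<le> (1 - x) ^ l * val (std {0}) x"
          using elim by (intro mult_left_mono) auto
        moreover have "c \<le> (1 - x) ^ l * val (std (P 0)) x" using c elim by blast
        moreover have "(1 - x) ^ l = (1 - x) ^ (l - d) * (1 - x) ^ d"
          by (subst ld(1)) (rule power_add)
        ultimately show ?case by (simp add: mult.assoc)
      qed
      ultimately have "c \<le> 0 * L" by (intro tendsto_lowerbound) auto
      then show False using c(1) by simp
    qed
    then show "e \<le> enat d" by (simp add: e)
  qed
  have "\<not> small d {0}"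
    unfolding small_def using tendsto_unique[OF _ lim] L by auto
  then obtain P :: "nat \<Rightarrow> 'a set" where "(\<forall>i\<le>d. prime_ideal (P i)) \<and> (\<forall>i<d. P i \<subset> P (Suc i))"
    using prime_chain_exists[OF homogeneous_ideal_singleton_0 \<open>\<not> small d {0}\<close>] by blast
  then show "enat d \<le> krull_dim TYPE('a)" unfolding krull_dim_def by (intro Sup_upper) blast
qed

end

section \<open>Hypersurfaces\<close>

type_synonym 'k mpoly = "mon \<Rightarrow>\<^sub>0 'k"

section \<open>Polynomials and their leading monomials\<close>

lemma mpoly_decomp: "p = (\<Sum>t\<in>Poly_Mapping.keys p. Poly_Mapping.single t (Poly_Mapping.lookup p t))"
proof (rule poly_mapping_eqI)
  fix k
  have "Poly_Mapping.lookup (\<Sum>t\<in>Poly_Mapping.keys p. Poly_Mapping.single t (Poly_Mapping.lookup p t)) k =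
      (\<Sum>t\<in>Poly_Mapping.keys p. if t = k then Poly_Mapping.lookup p k else 0)"
    unfolding lookup_sum lookup_single when_def by (intro sum.cong) auto
  also have "\<dots> = Poly_Mapping.lookup p k" by (simp add: in_keys_iff)
  finally show "Poly_Mapping.lookup p k =
      Poly_Mapping.lookup (\<Sum>t\<in>Poly_Mapping.keys p. Poly_Mapping.single t (Poly_Mapping.lookup p t)) k" ..
qed

lemma polys_iff: "p \<in> polys n \<longleftrightarrow> Poly_Mapping.keys p \<subseteq> mons {1..n}"
  by (auto simp: polys_def mons_def)

lemma zero_in_polys [simp]: "0 \<in> polys n"
  by (simp add: polys_iff)

lemma one_in_polys [simp]: "1 \<in> polys n"
  by (simp add: polys_iff)

lemma add_in_polys: "p \<in> polys n \<Longrightarrow> q \<in> polys n \<Longrightarrow> p + q \<in> polys n"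
  unfolding polys_iff using keys_add[of p q] by blast

lemma diff_in_polys: "p \<in> polys n \<Longrightarrow> q \<in> polys n \<Longrightarrow> p - q \<in> polys n"
  unfolding polys_iff using keys_diff[of p q] by blast

lemma mult_in_polys: "p \<in> polys n \<Longrightarrow> q \<in> polys n \<Longrightarrow> p * q \<in> polys n"
proof -
  assume "p \<in> polys n" "q \<in> polys n"
  moreover have "{a + b |a b. a \<in> Poly_Mapping.keys p \<and> b \<in> Poly_Mapping.keys q} \<subseteq> mons {1..n}"
    if "Poly_Mapping.keys p \<subseteq> mons {1..n}" "Poly_Mapping.keys q \<subseteq> mons {1..n}"
    using that by (auto simp del: One_nat_def)
  ultimately show "p * q \<in> polys n" unfolding polys_iff using keys_mult[of p q] by blast
qed

lemma single_in_polys: "t \<in> mons {1..n} \<Longrightarrow> Poly_Mapping.single t c \<in> polys n"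
  by (simp add: polys_iff)

lemma sum_in_polys: "(\<And>i. i \<in> I \<Longrightarrow> f i \<in> polys n) \<Longrightarrow> sum f I \<in> polys n"
  by (induction I rule: infinite_finite_induct) (auto intro: add_in_polys)

lemma homogeneous_iff: "homogeneous d p \<longleftrightarrow> (\<forall>t\<in>Poly_Mapping.keys p. mdeg t = d)"
  by (simp add: homogeneous_def mdeg_def)

lemma mpoly_mult:
  "p * q = (\<Sum>s\<in>Poly_Mapping.keys p. \<Sum>t\<in>Poly_Mapping.keys q.
     Poly_Mapping.single (s + t) (Poly_Mapping.lookup p s * Poly_Mapping.lookup q t))"
  for p q :: "'k::field mpoly"
  by (subst (1) mpoly_decomp[of p], subst (1) mpoly_decomp[of q])
    (simp add: sum_product mult_single)

text \<open>Strict compatibility of the order with addition lets only the pair \<open>(s, t)\<close>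
  contribute to \<open>s + t\<close>, and its coefficient is a product of two nonzero field
  elements.\<close>

lemma leading_monomial_mult:
  fixes p q :: "'k::field mpoly"
  assumes s: "s \<in> Poly_Mapping.keys p" "\<And>s'. s' \<in> Poly_Mapping.keys p \<Longrightarrow> s' \<noteq> s \<Longrightarrow> mless s' s"
    and t: "t \<in> Poly_Mapping.keys q" "\<And>t'. t' \<in> Poly_Mapping.keys q \<Longrightarrow> t' \<noteq> t \<Longrightarrow> mless t' t"
  shows "s + t \<in> Poly_Mapping.keys (p * q)"
    and "\<And>u. u \<in> Poly_Mapping.keys (p * q) \<Longrightarrow> u \<noteq> s + t \<Longrightarrow> mless u (s + t)"
proof -
  have less: "mless (s' + t') (s + t)"
    if "s' \<in> Poly_Mapping.keys p" "t' \<in> Poly_Mapping.keys q" "(s', t') \<noteq> (s, t)" for s' t'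
  proof (cases "s' = s")
    case True
    then show ?thesis using that t(2) by (auto intro: mless_add_left)
  next
    case False
    then have "mless (s' + t') (s + t')"
      using s(2)[OF that(1)] mless_add_left[of s' s t'] by (simp add: add.commute)
    moreover have "t' = t \<or> mless (s + t') (s + t)"
      using t(2)[OF that(2)] mless_add_left by blast
    ultimately show ?thesis using mless_trans by blast
  qed
  have "Poly_Mapping.lookup (p * q) (s + t) = (\<Sum>(s', t')\<in>Poly_Mapping.keys p \<times> Poly_Mapping.keys q.
      if (s', t') = (s, t) then Poly_Mapping.lookup p s * Poly_Mapping.lookup q t else 0)"
  proof -
    have "Poly_Mapping.lookup (p * q) (s + t) = (\<Sum>(s', t')\<in>Poly_Mapping.keys p \<times> Poly_Mapping.keys q.
      Poly_Mapping.lookup (Poly_Mapping.single (s' + t') (Poly_Mapping.lookup p s' * Poly_Mapping.lookup q t')) (s + t))"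
      by (subst mpoly_mult) (simp add: lookup_sum sum.cartesian_product case_prod_unfold)
    also have "\<dots> = (\<Sum>(s', t')\<in>Poly_Mapping.keys p \<times> Poly_Mapping.keys q.
      if (s', t') = (s, t) then Poly_Mapping.lookup p s * Poly_Mapping.lookup q t else 0)"
    proof (intro sum.cong refl, clarify)
      fix s' t' assume st: "s' \<in> Poly_Mapping.keys p" "t' \<in> Poly_Mapping.keys q"
      show "Poly_Mapping.lookup (Poly_Mapping.single (s' + t') (Poly_Mapping.lookup p s' * Poly_Mapping.lookup q t')) (s + t) =
        (if (s', t') = (s, t) then Poly_Mapping.lookup p s * Poly_Mapping.lookup q t else 0)"
      proof (cases "(s', t') = (s, t)")
        case False
        then have "s' + t' \<noteq> s + t" using less[OF st False] mless_irrefl by metis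
        then show ?thesis unfolding if_not_P[OF False] by (rule lookup_single_not_eq)
      qed auto
    qed
    finally show ?thesis .
  qed
  also have "\<dots> = Poly_Mapping.lookup p s * Poly_Mapping.lookup q t"
  proof -
    have "(\<lambda>(s', t'). if (s', t') = (s, t) then Poly_Mapping.lookup p s * Poly_Mapping.lookup q t else 0) =
        (\<lambda>x. if x = (s, t) then Poly_Mapping.lookup p s * Poly_Mapping.lookup q t else 0)" by auto
    then show ?thesis using s(1) t(1) by (simp add: sum.delta)
  qed
  also have "\<dots> \<noteq> 0" using s(1) t(1) by (simp add: in_keys_iff)
  finally show "s + t \<in> Poly_Mapping.keys (p * q)" by (simp add: in_keys_iff)
  show "mless u (s + t)" if u: "u \<in> Poly_Mapping.keys (p * q)" "u \<noteq> s + t" for u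
  proof -
    obtain s' t' where "u = s' + t'" "s' \<in> Poly_Mapping.keys p" "t' \<in> Poly_Mapping.keys q"
      using keys_mult[of p q] u(1) by blast
    then show ?thesis using less[of s' t'] u(2) by blast
  qed
qed

section \<open>The presentation map and its kernel\<close>

context presented_algebra
begin

text \<open>The map from the polynomial ring onto \<open>R\<close>. As \<open>mp\<close> only looks
  at exponents in \<open>{1..n}\<close>, any other variable is sent to \<open>1\<close>, so
  \<open>ev\<close> is multiplicative on the whole type.\<close>

definition ev :: "'k mpoly \<Rightarrow> 'a" where
  "ev p = (\<Sum>t\<in>Poly_Mapping.keys p. scale (Poly_Mapping.lookup p t) (mp t))"

lemma ev_superset:
  "finite S \<Longrightarrow> Poly_Mapping.keys p \<subseteq> S \<Longrightarrow> ev p = (\<Sum>t\<in>S. scale (Poly_Mapping.lookup p t) (mp t))"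
  unfolding ev_def by (intro sum.mono_neutral_left) (auto simp: in_keys_iff)

lemma ev_0 [simp]: "ev 0 = 0"
  by (simp add: ev_def)

lemma ev_single [simp]: "ev (Poly_Mapping.single t c) = scale c (mp t)"
  by (simp add: ev_def)

lemma ev_add: "ev (p + q) = ev p + ev q"
proof -
  let ?S = "Poly_Mapping.keys p \<union> Poly_Mapping.keys q"
  have "finite ?S" "Poly_Mapping.keys (p + q) \<subseteq> ?S" using keys_add[of p q] by auto
  then show ?thesis by (simp add: ev_superset[of ?S] lookup_add scale_left_distrib sum.distrib)
qed

lemma ev_diff: "ev (p - q) = ev p - ev q"
  using ev_add[of "p - q" q] by simp

lemma ev_sum: "ev (sum f I) = (\<Sum>i\<in>I. ev (f i))"
  by (induction I rule: infinite_finite_induct) (auto simp: ev_add)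

lemma ev_mult: "ev (p * q) = ev p * ev q"
proof -
  have "ev (p * q) = (\<Sum>s\<in>Poly_Mapping.keys p. \<Sum>t\<in>Poly_Mapping.keys q.
      scale (Poly_Mapping.lookup p s) (mp s) * scale (Poly_Mapping.lookup q t) (mp t))"
    by (subst mpoly_mult) (simp add: ev_sum mp_add mult_scale_right scale_mult[symmetric] mult.commute)
  also have "\<dots> = ev p * ev q" by (simp add: ev_def sum_product)
  finally show ?thesis .
qed

text \<open>Solving the relation \<open>p\<close> for its leading term links leading monomials of
  the kernel with the intrinsic definition of \<open>std\<close>.\<close>

lemma mp_leading_in_span:
  assumes ev: "ev p = 0" and s: "s \<in> Poly_Mapping.keys p"
    and max: "\<And>s'. s' \<in> Poly_Mapping.keys p \<Longrightarrow> s' \<noteq> s \<Longrightarrow> mless s' s" and p: "p \<in> polys n"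
  shows "mp s \<in> span (mp ` {t \<in> E. mless t s})"
proof -
  let ?c = "Poly_Mapping.lookup p"
  have "ev p = scale (?c s) (mp s) + (\<Sum>t\<in>Poly_Mapping.keys p - {s}. scale (?c t) (mp t))"
    unfolding ev_def using s by (intro sum.remove) auto
  then have "scale (?c s) (mp s) = - (\<Sum>t\<in>Poly_Mapping.keys p - {s}. scale (?c t) (mp t))"
    using ev by (simp add: eq_neg_iff_add_eq_0)
  also have "\<dots> \<in> span (mp ` {t \<in> E. mless t s})"
    by (intro span_neg span_sum span_scale span_base imageI) (use max p in \<open>auto simp: polys_iff\<close>)
  finally have "scale (1 / ?c s) (scale (?c s) (mp s)) \<in> span (mp ` {t \<in> E. mless t s})"
    by (rule span_scale)
  then show ?thesis using s by (simp add: in_keys_iff)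
qed

lemma not_std_0_iff: "t \<in> E \<Longrightarrow> t \<notin> std {0} \<longleftrightarrow> mp t \<in> span (mp ` {s \<in> E. mless s t})"
  by (simp add: std_def)

lemma ev_in_component:
  assumes "p \<in> polys n" and "homogeneous d p"
  shows "ev p \<in> A d"
  unfolding ev_def
proof (intro subspace_sum[OF subspace_component] subspace_scale[OF subspace_component])
  fix t assume "t \<in> Poly_Mapping.keys p"
  then have "t \<in> E" "mdeg t = d" using assms by (auto simp only: polys_iff homogeneous_iff)
  then show "mp t \<in> A d" using mp_in_component by blast
qed

text \<open>
  If the standard monomials are those not divisible by \<open>\<mu>\<close>, the relation \<open>f\<close> with leading monomial
  \<open>\<mu>\<close> generates all relations, by division with remainder.
\<close>

lemma is_hypersurface_of_std:
  assumes n: "n \<ge> 1" and \<mu>: "\<mu> \<in> E" "mdeg \<mu> = m" and std: "std {0} = {t \<in> E. \<not> mdvd \<mu> t}"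
  shows "is_hypersurface scale A m"
proof -
  have "\<mu> \<notin> std {0}" by (simp add: std mdvd_def)
  then have "mp \<mu> \<in> span (mp ` {s \<in> E. mless s \<mu>})" using not_std_0_iff \<mu>(1) by blast
  \<comment> \<open>Projecting onto degree \<open>m\<close> discards the smaller monomials of lower
    degree, so the relation becomes homogeneous.\<close>
  then have "part m (mp \<mu>) \<in> span (mp ` {t \<in> {s \<in> E. mless s \<mu>}. mdeg t = m})"
    by (rule part_in_span) auto
  then have span_\<mu>: "mp \<mu> \<in> span (mp ` {t \<in> {s \<in> E. mless s \<mu>}. mdeg t = m})"
    using \<mu> by (simp add: part_mp)
  obtain K c where K: "finite K" "K \<subseteq> {t \<in> {s \<in> E. mless s \<mu>}. mdeg t = m}"
      "mp \<mu> = (\<Sum>t\<in>K. scale (c t) (mp t))" using span_mp_explicit[OF span_\<mu>] .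
  define g where "g = (\<Sum>t\<in>K. Poly_Mapping.single t (c t))"
  define f where "f = Poly_Mapping.single \<mu> 1 - g"
  have gK: "Poly_Mapping.keys g \<subseteq> K" unfolding g_def
    using keys_sum[of "\<lambda>t. Poly_Mapping.single t (c t)" K] by (auto split: if_splits)
  have keys_f: "Poly_Mapping.keys f \<subseteq> insert \<mu> K"
    unfolding f_def using keys_diff[of "Poly_Mapping.single \<mu> 1" g] gK by auto
  have ev_f: "ev f = 0" by (simp add: f_def g_def ev_diff ev_sum K(3))
  have f: "f \<in> polys n" "homogeneous m f"
    using keys_f K(2) \<mu> by (auto simp: polys_iff homogeneous_iff simp del: One_nat_def)
  have "\<mu> \<notin> Poly_Mapping.keys g" using gK K(2) by auto
  then have "Poly_Mapping.lookup f \<mu> = 1" by (simp add: f_def lookup_minus in_keys_iff)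
  then have f0: "f \<noteq> 0" by auto

  \<comment> \<open>The polynomials which admit division by \<open>f\<close> with a remainder
    supported on standard monomials.\<close>
  define D where "D = {p. \<exists>q p'. q \<in> polys n \<and> p' \<in> polys n \<and> Poly_Mapping.keys p' \<subseteq> std {0} \<and> p = f * q + p'}"
  have DI: "f * q + p' \<in> D" if "q \<in> polys n" "p' \<in> polys n" "Poly_Mapping.keys p' \<subseteq> std {0}" for q p'
    unfolding D_def using that by blast
  have D_0: "0 \<in> D" using DI[of 0 0] by simp
  have D_add: "p + q \<in> D" if pq: "p \<in> D" "q \<in> D" for p q
  proof -
    obtain u p' where p: "u \<in> polys n" "p' \<in> polys n" "Poly_Mapping.keys p' \<subseteq> std {0}" "p = f * u + p'"
      using pq(1) by (auto simp: D_def)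
    obtain v q' where q: "v \<in> polys n" "q' \<in> polys n" "Poly_Mapping.keys q' \<subseteq> std {0}" "q = f * v + q'"
      using pq(2) by (auto simp: D_def)
    have "p + q = f * (u + v) + (p' + q')" by (simp add: p q algebra_simps)
    also have "\<dots> \<in> D"
      using keys_add[of p' q'] p(3) q(3) by (intro DI add_in_polys p q) blast
    finally show ?thesis .
  qed
  have D_scale: "Poly_Mapping.single 0 a * p \<in> D" if pq: "p \<in> D" for p a
  proof -
    obtain u p' where p: "u \<in> polys n" "p' \<in> polys n" "Poly_Mapping.keys p' \<subseteq> std {0}" "p = f * u + p'"
      using pq(1) by (auto simp: D_def)
    have "Poly_Mapping.single 0 a * p = f * (Poly_Mapping.single 0 a * u) + Poly_Mapping.single 0 a * p'"
      by (simp add: p algebra_simps)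
    also have "\<dots> \<in> D"
      using keys_mult[of "Poly_Mapping.single 0 a" p'] p(3)
      by (intro DI mult_in_polys single_in_polys p) (auto split: if_splits)
    finally show ?thesis .
  qed
  have D_sum: "sum h I \<in> D" if "\<And>i. i \<in> I \<Longrightarrow> h i \<in> D" for h :: "mon \<Rightarrow> 'k mpoly" and I
    using that by (induction I rule: infinite_finite_induct) (auto simp: D_0 D_add)
  have D_single: "Poly_Mapping.single t 1 \<in> D" if "t \<in> E" for t
    using finite_vars that
  proof (induction rule: mless_induct)
    case (less t)
    show ?case
    proof (cases "t \<in> std {0}")
      case True
      then show ?thesis using DI[of 0 "Poly_Mapping.single t 1"] less.hyps single_in_polys[of t n "1::'k"] by simp
    next
      case False
      then have "mdvd \<mu> t" using less.hyps std by blast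
      then obtain u where u: "t = \<mu> + u" by (auto simp: mdvd_iff)
      then have uE: "u \<in> E" using less.hyps by (simp del: One_nat_def)
      \<comment> \<open>One division step: modulo \<open>f\<close> the factor \<open>\<mu>\<close>
        of \<open>t\<close> is exchanged for \<open>g\<close>, all of whose monomials are
        smaller.\<close>
      have "Poly_Mapping.single t 1 = f * Poly_Mapping.single u 1 + g * Poly_Mapping.single u 1"
        by (simp add: f_def left_diff_distrib mult_single u)
      also have "g * Poly_Mapping.single u 1 = (\<Sum>s\<in>K. Poly_Mapping.single 0 (c s) * Poly_Mapping.single (s + u) 1)"
        by (simp add: g_def sum_distrib_right mult_single)
      also have "f * Poly_Mapping.single u 1 + \<dots> \<in> D"
      proof (intro D_add D_sum D_scale less.IH)
        show "f * Poly_Mapping.single u 1 \<in> D"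
          using DI[of "Poly_Mapping.single u 1" 0] single_in_polys[OF uE, of "1::'k"] by simp
        fix s assume s: "s \<in> K"
        then show "s + u \<in> E" using K(2) uE by (auto simp del: One_nat_def)
        have "mless s \<mu>" using s K(2) by blast
        then show "mless (s + u) t" unfolding u using mless_add_left[of s \<mu> u] by (simp add: add.commute)
      qed
      finally show ?thesis .
    qed
  qed
  have D_all: "p \<in> D" if p: "p \<in> polys n" for p
  proof -
    have "(\<Sum>t\<in>Poly_Mapping.keys p. Poly_Mapping.single 0 (Poly_Mapping.lookup p t) * Poly_Mapping.single t 1) \<in> D"
      by (intro D_sum D_scale D_single) (use p in \<open>auto simp: polys_iff\<close>)
    then show ?thesis using mpoly_decomp[of p] by (simp add: mult_single)
  qed
  have kernel: "\<exists>q\<in>polys n. p = f * q" if p: "p \<in> polys n" "ev p = 0" for p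
  proof -
    obtain q p' where q: "q \<in> polys n" "Poly_Mapping.keys p' \<subseteq> std {0}" "p = f * q + p'"
      using D_all[OF p(1)] by (auto simp: D_def)
    \<comment> \<open>The remainder of a relation is itself a relation among standard monomials,
      hence zero.\<close>
    have "ev p' = 0" using p(2) q(3) by (simp add: ev_add ev_mult ev_f)
    then have "(\<Sum>t\<in>Poly_Mapping.keys p'. scale (Poly_Mapping.lookup p' t) (mp t)) \<in> {0}"
      by (simp add: ev_def)
    then have "Poly_Mapping.lookup p' t = 0" if "t \<in> Poly_Mapping.keys p'" for t
      using std_independent[of "{0}", OF _ finite_keys q(2) _ that] by simp
    then have "p' = 0" by (metis in_keys_iff keys_eq_empty equals0I)
    then show ?thesis using q by auto
  qed

  have self: "p \<in> residue_class n f p" for p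
    unfolding residue_class_def by (auto intro!: exI[of _ 0])
  have ev_class: "ev q = ev p" if "q \<in> residue_class n f p" for p q
    using that by (auto simp: residue_class_def ev_add ev_mult ev_f)
  \<comment> \<open>The choice of representative is harmless because \<open>ev\<close> is constant
    on residue classes.\<close>
  define \<phi> where "\<phi> C = ev (SOME p. p \<in> C)" for C
  have \<phi>: "\<phi> (residue_class n f p) = ev p" for p
    unfolding \<phi>_def by (rule ev_class, rule someI, rule self)
  have class_eq: "residue_class n f p = residue_class n f q"
    if pq: "p \<in> polys n" "q \<in> polys n" "ev p = ev q" for p q
  proof -
    obtain u where u: "u \<in> polys n" "p - q = f * u"
      using kernel[of "p - q"] pq diff_in_polys by (auto simp: ev_diff)
    have p: "p = q + f * u" using u(2) by (simp add: algebra_simps)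
    show ?thesis
    proof (intro equalityI subsetI)
      fix x assume "x \<in> residue_class n f p"
      then obtain w where w: "x = p + f * w" "w \<in> polys n" by (auto simp: residue_class_def)
      have "x = q + f * (u + w)" by (simp add: w p algebra_simps)
      then show "x \<in> residue_class n f q" unfolding residue_class_def using add_in_polys u w by blast
    next
      fix x assume "x \<in> residue_class n f q"
      then obtain w where w: "x = q + f * w" "w \<in> polys n" by (auto simp: residue_class_def)
      have "x = p + f * (w - u)" by (simp add: w p algebra_simps)
      then show "x \<in> residue_class n f p" unfolding residue_class_def using diff_in_polys u w by blast
    qed
  qed
  \<comment> \<open>The support of the preimage is controlled, so that the same fact serves for
    surjectivity and for each graded component.\<close>
  have surj: "\<exists>p\<in>polys n. Poly_Mapping.keys p \<subseteq> S \<and> ev p = x"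
    if S: "S \<subseteq> E" "x \<in> span (mp ` S)" for x S
  proof -
    obtain K c where K: "finite K" "K \<subseteq> S" "x = (\<Sum>t\<in>K. scale (c t) (mp t))"
      using span_mp_explicit[OF S(2)] .
    let ?p = "\<Sum>t\<in>K. Poly_Mapping.single t (c t)"
    have "Poly_Mapping.keys ?p \<subseteq> K"
      using keys_sum[of "\<lambda>t. Poly_Mapping.single t (c t)" K] by (auto split: if_splits)
    then have keys: "Poly_Mapping.keys ?p \<subseteq> S" using K(2) by (rule subset_trans)
    have "?p \<in> polys n" unfolding polys_iff using keys S(1) by (rule subset_trans)
    moreover have "ev ?p = x" by (simp add: ev_sum K(3))
    ultimately show ?thesis using keys by (intro bexI[of _ ?p] conjI)
  qed
  have "graded_quotient_iso scale A n f \<phi>"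
    unfolding graded_quotient_iso_def
  proof (intro conjI ballI allI)
    have "inj_on \<phi> (residue_class n f ` polys n)"
    proof (rule inj_onI)
      fix C C' assume "C \<in> residue_class n f ` polys n" "C' \<in> residue_class n f ` polys n"
        and eq: "\<phi> C = \<phi> C'"
      then obtain p q where p: "p \<in> polys n" "C = residue_class n f p"
        and q: "q \<in> polys n" "C' = residue_class n f q" by blast
      have "ev p = ev q" using eq by (simp only: p q \<phi>)
      then show "C = C'" using class_eq p q by blast
    qed
    moreover have "\<phi> ` residue_class n f ` polys n = UNIV"
    proof (intro equalityI subsetI)
      fix x :: 'a
      have "x \<in> span (mp ` E)" unfolding span_mp by (rule UNIV_I)
      then obtain p where "p \<in> polys n" "ev p = x" using surj[OF order_refl] by blast
      then show "x \<in> \<phi> ` residue_class n f ` polys n" using \<phi> by (metis imageI)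
    qed simp
    ultimately show "bij_betw \<phi> (residue_class n f ` polys n) UNIV" by (simp add: bij_betw_def)
    show "\<phi> (residue_class n f 1) = 1" unfolding \<phi> using ev_single[of 0 1] by simp
    show "\<phi> ` residue_class n f ` {p \<in> polys n. homogeneous d p} = A d" for d
    proof (intro equalityI subsetI)
      fix x assume "x \<in> \<phi> ` residue_class n f ` {p \<in> polys n. homogeneous d p}"
      then show "x \<in> A d" using \<phi> ev_in_component by auto
    next
      fix x assume "x \<in> A d"
      then have "x \<in> span (mp ` {t \<in> E. mdeg t = d})" using component_subset_span by blast
      then obtain p where "p \<in> polys n" "Poly_Mapping.keys p \<subseteq> {t \<in> E. mdeg t = d}" "ev p = x"
        using surj[of "{t \<in> E. mdeg t = d}" x] by blast
      then have "p \<in> {p \<in> polys n. homogeneous d p}" "\<phi> (residue_class n f p) = x"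
        using \<phi> by (auto simp: homogeneous_iff)
      then show "x \<in> \<phi> ` residue_class n f ` {p \<in> polys n. homogeneous d p}" by blast
    qed
  qed (simp_all only: \<phi> ev_add ev_mult ev_single mp_0 scale_mult[symmetric] mult_1)
  then show ?thesis unfolding is_hypersurface_def using n f f0 by blast
qed

end

text \<open>The ideal of relations is \<open>(f)\<close> and leading monomials multiply, so the
  nonstandard monomials are the multiples of the leading monomial \<open>\<mu>\<close> of
  \<open>f\<close>.\<close>

lemma (in standard_graded_algebra) hypersurface_presentation:
  assumes "is_hypersurface scale A m"
  obtains n r \<mu> where "n \<ge> 1" "presented_algebra scale A r n" "\<mu> \<in> mons {1..n}" "mdeg \<mu> = m"
    "presented_algebra.std scale r n {0} = {t \<in> mons {1..n}. \<not> mdvd \<mu> t}"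
proof -
  obtain n f \<phi> where n: "n \<ge> 1" and f: "f \<in> polys n" "f \<noteq> 0" "homogeneous m f"
    and iso: "graded_quotient_iso scale A n f \<phi>"
    using assms unfolding is_hypersurface_def by blast
  define \<psi> where "\<psi> p = \<phi> (residue_class n f p)" for p
  have bij: "bij_betw \<phi> (residue_class n f ` polys n) UNIV"
    and \<psi>_1: "\<psi> 1 = 1"
    and \<psi>_add: "\<And>p q. p \<in> polys n \<Longrightarrow> q \<in> polys n \<Longrightarrow> \<psi> (p + q) = \<psi> p + \<psi> q"
    and \<psi>_mult: "\<And>p q. p \<in> polys n \<Longrightarrow> q \<in> polys n \<Longrightarrow> \<psi> (p * q) = \<psi> p * \<psi> q"
    and \<psi>_scale: "\<And>c p. p \<in> polys n \<Longrightarrow> \<psi> (Poly_Mapping.single 0 c * p) = scale c (\<psi> p)"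
    and \<psi>_graded: "\<And>d. \<psi> ` {p \<in> polys n. homogeneous d p} = A d"
    using iso unfolding graded_quotient_iso_def \<psi>_def image_image by blast+
  have \<psi>_0: "\<psi> 0 = 0" using \<psi>_add[of 0 0] by simp
  have \<psi>_sum: "\<psi> (sum h I) = (\<Sum>i\<in>I. \<psi> (h i))" if "\<And>i. i \<in> I \<Longrightarrow> h i \<in> polys n"
    for h :: "mon \<Rightarrow> 'k mpoly" and I
    using that by (induction I rule: infinite_finite_induct) (auto simp: \<psi>_0 \<psi>_add sum_in_polys)
  have \<psi>_expand: "\<psi> p = (\<Sum>t\<in>Poly_Mapping.keys p. scale (Poly_Mapping.lookup p t) (\<psi> (Poly_Mapping.single t 1)))"
    if "p \<in> polys n" for p
  proof -
    have s: "Poly_Mapping.single t c \<in> polys n" if "t \<in> Poly_Mapping.keys p" for t and c :: 'k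
      using \<open>p \<in> polys n\<close> that by (intro single_in_polys) (auto simp: polys_iff)
    have "\<psi> p = (\<Sum>t\<in>Poly_Mapping.keys p. \<psi> (Poly_Mapping.single t (Poly_Mapping.lookup p t)))"
      by (subst (1) mpoly_decomp[of p], rule \<psi>_sum, rule s)
    also have "\<dots> = (\<Sum>t\<in>Poly_Mapping.keys p. scale (Poly_Mapping.lookup p t) (\<psi> (Poly_Mapping.single t 1)))"
    proof (rule sum.cong[OF refl])
      fix t assume "t \<in> Poly_Mapping.keys p"
      from \<psi>_scale[OF s[OF this, of 1], of "Poly_Mapping.lookup p t"]
      show "\<psi> (Poly_Mapping.single t (Poly_Mapping.lookup p t)) = scale (Poly_Mapping.lookup p t) (\<psi> (Poly_Mapping.single t 1))"
        by (simp add: mult_single)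
    qed
    finally show ?thesis .
  qed
  define r where "r i = \<psi> (Poly_Mapping.single (Poly_Mapping.single i 1) 1)" for i
  have degree_one: "\<exists>i\<in>{1..n}. t = Poly_Mapping.single i 1" if t: "t \<in> mons {1..n}" "mdeg t = 1" for t
  proof -
    have "t \<noteq> 0" using t(2) by auto
    then obtain i where i: "i \<in> Poly_Mapping.keys t" by (metis keys_eq_empty equals0I)
    then have "mdvd (Poly_Mapping.single i 1) t" by (auto simp: mdvd_def lookup_single when_def in_keys_iff)
    then obtain u where u: "t = Poly_Mapping.single i 1 + u" by (auto simp: mdvd_iff)
    then have "u = 0" using t(2) by simp
    moreover have "i \<in> {1..n}" using i t(1) unfolding mons_def by blast
    ultimately show ?thesis using u by auto
  qed
  interpret presented_algebra scale A r n
  proof unfold_locales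
    fix i assume "i \<in> {1..n}"
    then have "Poly_Mapping.single (Poly_Mapping.single i 1) 1 \<in> {p \<in> polys n. homogeneous 1 p}"
      using single_in_mons[of i "{1..n}" 1] single_in_polys[of "Poly_Mapping.single i 1" n 1]
      by (simp add: homogeneous_iff del: One_nat_def)
    then show "r i \<in> A 1" unfolding r_def \<psi>_graded[symmetric] by blast
  next
    show "A 1 \<subseteq> span (r ` {1..n})"
    proof
      fix x assume "x \<in> A 1"
      then obtain p where p: "p \<in> polys n" "homogeneous 1 p" "x = \<psi> p" unfolding \<psi>_graded[symmetric] by blast
      show "x \<in> span (r ` {1..n})"
        unfolding p(3) \<psi>_expand[OF p(1)]
      proof (intro span_sum span_scale span_base)
        fix t assume "t \<in> Poly_Mapping.keys p"
        then have "t \<in> mons {1..n}" "mdeg t = 1" using p(1,2) by (auto simp: polys_iff homogeneous_iff)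
        then obtain i where "i \<in> {1..n}" "t = Poly_Mapping.single i 1" using degree_one by blast
        then show "\<psi> (Poly_Mapping.single t 1) \<in> r ` {1..n}" unfolding r_def by blast
      qed
    qed
  qed
  \<comment> \<open>The isomorphism is only known through its algebraic properties on
    \<open>polys n\<close>; splitting off one variable at a time identifies it with
    \<open>mp\<close> on monomials, and then with \<open>ev\<close> by linearity.\<close>
  have \<psi>_mp: "\<psi> (Poly_Mapping.single t 1) = mp t" if "t \<in> E" for t
    using that
  proof (induction t rule: measure_induct_rule[where f = mdeg])
    case (less t)
    show ?case
    proof (cases "t = 0")
      case True
      then show ?thesis using \<psi>_1 by simp
    next
      case False
      then obtain i where i: "i \<in> Poly_Mapping.keys t" by (metis keys_eq_empty equals0I)
      then have iV: "i \<in> {1..n}" using less.prems unfolding mons_def by blast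
      have "mdvd (Poly_Mapping.single i 1) t" using i by (auto simp: mdvd_def lookup_single when_def in_keys_iff)
      then obtain u where u: "t = Poly_Mapping.single i 1 + u" by (auto simp: mdvd_iff)
      have uE: "u \<in> E" using less.prems u by (simp del: One_nat_def)
      have "Poly_Mapping.single t 1 = Poly_Mapping.single (Poly_Mapping.single i 1) 1 * Poly_Mapping.single u (1::'k)"
        by (simp add: mult_single u)
      then have "\<psi> (Poly_Mapping.single t 1) = r i * \<psi> (Poly_Mapping.single u 1)"
        unfolding r_def using \<psi>_mult single_in_polys single_in_mons[OF iV] uE by metis
      also have "\<dots> = mp t" using less.IH[OF _ uE] mp_single[OF iV] by (simp only: u mp_add) simp
      finally show ?thesis .
    qed
  qed
  have \<psi>_ev: "\<psi> p = ev p" if "p \<in> polys n" for p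
    unfolding \<psi>_expand[OF that] ev_def using that by (intro sum.cong refl) (auto simp: \<psi>_mp polys_iff)
  have kernel: "\<exists>q\<in>polys n. p = f * q" if p: "p \<in> polys n" "ev p = 0" for p
  proof -
    \<comment> \<open>Injectivity of \<open>\<phi>\<close> on residue classes is what puts every
      relation into \<open>(f)\<close>.\<close>
    have "\<phi> (residue_class n f p) = \<phi> (residue_class n f 0)"
      using \<psi>_ev[OF p(1)] p(2) \<psi>_0 by (simp add: \<psi>_def)
    then have "residue_class n f p = residue_class n f 0"
      by (rule inj_onD[OF bij_betw_imp_inj_on[OF bij]]) (use p(1) in simp_all)
    moreover have "p \<in> residue_class n f p" unfolding residue_class_def by (auto intro!: exI[of _ 0])
    ultimately show ?thesis by (auto simp: residue_class_def)
  qed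
  have ev_f: "ev f = 0"
  proof -
    have "residue_class n f f = residue_class n f 0"
    proof (intro equalityI subsetI)
      fix x assume "x \<in> residue_class n f f"
      then obtain q where q: "x = f + f * q" "q \<in> polys n" by (auto simp: residue_class_def)
      have "x = 0 + f * (1 + q)" by (simp add: q algebra_simps)
      then show "x \<in> residue_class n f 0" unfolding residue_class_def using q add_in_polys one_in_polys by blast
    next
      fix x assume "x \<in> residue_class n f 0"
      then obtain q where q: "x = 0 + f * q" "q \<in> polys n" by (auto simp: residue_class_def)
      have "x = f + f * (q - 1)" by (simp add: q algebra_simps)
      then show "x \<in> residue_class n f f" unfolding residue_class_def using q diff_in_polys one_in_polys by blast
    qed
    then have "\<psi> f = \<psi> 0" by (simp add: \<psi>_def)
    then show ?thesis using \<psi>_ev[OF f(1)] \<psi>_0 by simp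
  qed
  have "finite (Poly_Mapping.keys f)" "Poly_Mapping.keys f \<noteq> {}" using f(2) by auto
  then obtain \<mu> where \<mu>: "\<mu> \<in> Poly_Mapping.keys f" "\<And>s. s \<in> Poly_Mapping.keys f \<Longrightarrow> s \<noteq> \<mu> \<Longrightarrow> mless s \<mu>"
    using mless_finite_max by blast
  have \<mu>E: "\<mu> \<in> E" "mdeg \<mu> = m" using \<mu>(1) f by (auto simp: polys_iff homogeneous_iff)
  have "std {0} = {t \<in> E. \<not> mdvd \<mu> t}"
  proof (intro equalityI subsetI)
    fix t assume t: "t \<in> std {0}"
    have tE: "t \<in> E" using t std_subset by blast
    have "\<not> mdvd \<mu> t"
    proof
      assume "mdvd \<mu> t"
      then obtain u where u: "t = \<mu> + u" by (auto simp: mdvd_iff)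
      then have uE: "u \<in> E" using tE by (simp del: One_nat_def)
      let ?s = "Poly_Mapping.single u (1::'k)"
      have sk: "u \<in> Poly_Mapping.keys ?s" "\<And>s. s \<in> Poly_Mapping.keys ?s \<Longrightarrow> s \<noteq> u \<Longrightarrow> mless s u" by auto
      \<comment> \<open>The product of \<open>f\<close> with the monomial \<open>u\<close> is a
        relation with leading monomial \<open>\<mu> + u\<close>.\<close>
      have "mp (\<mu> + u) \<in> span (mp ` {s \<in> E. mless s (\<mu> + u)})"
      proof (rule mp_leading_in_span)
        show "ev (f * ?s) = 0" by (simp add: ev_mult ev_f)
        show "f * ?s \<in> polys n" using f(1) uE by (intro mult_in_polys single_in_polys)
        show "\<mu> + u \<in> Poly_Mapping.keys (f * ?s)" by (rule leading_monomial_mult(1)[OF \<mu> sk])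
        show "mless v (\<mu> + u)" if "v \<in> Poly_Mapping.keys (f * ?s)" "v \<noteq> \<mu> + u" for v
          by (rule leading_monomial_mult(2)[OF \<mu>(1) _ sk(1)]) (use \<mu>(2) sk(2) that in auto)
      qed
      then show False using t not_std_0_iff[OF tE] u by simp
    qed
    then show "t \<in> {t \<in> E. \<not> mdvd \<mu> t}" using tE by blast
  next
    fix t assume t: "t \<in> {t \<in> E. \<not> mdvd \<mu> t}"
    show "t \<in> std {0}"
    proof (rule ccontr)
      assume "t \<notin> std {0}"
      then have span_t: "mp t \<in> span (mp ` {s \<in> E. mless s t})" using t not_std_0_iff by blast
      \<comment> \<open>A reduction of \<open>t\<close> is a relation \<open>p\<close> with leading
        monomial \<open>t\<close>. Since \<open>p = f * q\<close>, this monomial is also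
        \<open>\<mu> + \<nu>\<close> with \<open>\<nu>\<close> leading in \<open>q\<close>.\<close>
      obtain K c where K: "finite K" "K \<subseteq> {s \<in> E. mless s t}" "mp t = (\<Sum>s\<in>K. scale (c s) (mp s))"
        using span_mp_explicit[OF span_t] .
      define g where "g = (\<Sum>s\<in>K. Poly_Mapping.single s (c s))"
      define p where "p = Poly_Mapping.single t 1 - g"
      have gK: "Poly_Mapping.keys g \<subseteq> K" unfolding g_def
        using keys_sum[of "\<lambda>t. Poly_Mapping.single t (c t)" K] by (auto split: if_splits)
      have keys_p: "Poly_Mapping.keys p \<subseteq> insert t K"
        unfolding p_def using keys_diff[of "Poly_Mapping.single t 1" g] gK by auto
      have "t \<notin> Poly_Mapping.keys g" using gK K(2) by auto
      then have "Poly_Mapping.lookup p t = 1" by (simp add: p_def lookup_minus in_keys_iff)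
      then have tp: "t \<in> Poly_Mapping.keys p" by (simp add: in_keys_iff)
      have "p \<in> polys n" using keys_p K(2) t unfolding polys_iff by blast
      moreover have "ev p = 0" by (simp add: p_def g_def ev_diff ev_sum K(3))
      ultimately obtain q where q: "q \<in> polys n" "p = f * q" using kernel by blast
      have "q \<noteq> 0" using tp q(2) by auto
      then have "finite (Poly_Mapping.keys q)" "Poly_Mapping.keys q \<noteq> {}" by auto
      then obtain \<nu> where \<nu>: "\<nu> \<in> Poly_Mapping.keys q" "\<And>s. s \<in> Poly_Mapping.keys q \<Longrightarrow> s \<noteq> \<nu> \<Longrightarrow> mless s \<nu>"
        using mless_finite_max by blast
      have "\<mu> + \<nu> \<in> Poly_Mapping.keys p" unfolding q(2) by (rule leading_monomial_mult(1)[OF \<mu> \<nu>])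
      then have "\<mu> + \<nu> = t \<or> mless (\<mu> + \<nu>) t" using keys_p K(2) by blast
      moreover have "t = \<mu> + \<nu> \<or> mless t (\<mu> + \<nu>)"
        using leading_monomial_mult(2)[OF \<mu> \<nu>] tp q(2) by blast
      ultimately have "t = \<mu> + \<nu>" using mless_trans mless_irrefl by blast
      then have "mdvd \<mu> t" by (auto simp: mdvd_iff)
      then show False using t by blast
    qed
  qed
  then show ?thesis using that n presented_algebra_axioms \<mu>E by blast
qed

section \<open>Comparison of the two sides\<close>

text \<open>Take a common divisor of greatest degree. If all cofactors contained the variable
  \<open>v\<close>, the divisor could be enlarged by \<open>v\<close>.\<close>

lemma monomial_gcd:
  assumes M: "M \<subseteq> mons V" "M \<noteq> {}"
  obtains \<delta> where "\<delta> \<in> mons V" "\<forall>t\<in>M. mdvd \<delta> t"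
    "\<forall>v\<in>V. \<exists>u. \<delta> + u \<in> M \<and> exponent u v = 0"
proof -
  let ?P = "\<lambda>\<delta>. \<delta> \<in> mons V \<and> (\<forall>t\<in>M. mdvd \<delta> t)"
  obtain t0 where t0: "t0 \<in> M" using M(2) by blast
  have "?P 0" by (simp add: mdvd_def)
  moreover have "\<forall>\<delta>. ?P \<delta> \<longrightarrow> mdeg \<delta> < Suc (mdeg t0)" using t0 by (auto simp: mdvd_iff)
  ultimately obtain \<delta> where \<delta>: "?P \<delta>" "\<forall>\<delta>'. ?P \<delta>' \<longrightarrow> mdeg \<delta>' \<le> mdeg \<delta>"
    using ex_has_greatest_nat[of ?P 0 mdeg "Suc (mdeg t0)"] by blast
  have "\<exists>u. \<delta> + u \<in> M \<and> exponent u v = 0" if v: "v \<in> V" for v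
  proof (rule ccontr)
    assume no: "\<not> (\<exists>u. \<delta> + u \<in> M \<and> exponent u v = 0)"
    have "mdvd (\<delta> + Poly_Mapping.single v 1) t" if t: "t \<in> M" for t
    proof -
      have "mdvd \<delta> t" using \<delta>(1) t by simp
      then obtain u where u: "t = \<delta> + u" unfolding mdvd_iff by (rule exE)
      then have "exponent u v \<noteq> 0" using no t by metis
      then have "mdvd (Poly_Mapping.single v 1) u" by (auto simp: mdvd_def lookup_single when_def)
      then show ?thesis by (auto simp: u mdvd_def lookup_add)
    qed
    then have "mdeg (\<delta> + Poly_Mapping.single v 1) \<le> mdeg \<delta>"
      using \<delta> single_in_mons[OF v, of 1] by (metis add_in_mons_iff)
    then show False by simp
  qed
  then show ?thesis using \<delta>(1) that by blast
qed

section \<open>Values and derivatives at 1\<close>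

lemma poly_map_poly_of_int:
  "poly (map_poly of_int p) (of_int x) = (of_int (poly p x) :: 'a::comm_ring_1)"
  by (induction p) (simp_all add: map_poly_pCons)

lemma pderiv_map_poly_of_int:
  "pderiv (map_poly of_int p) = (map_poly of_int (pderiv p) :: 'a::{comm_ring_1,semiring_no_zero_divisors} poly)"
  by (rule poly_eqI) (simp add: coeff_pderiv coeff_map_poly)

lemma cyclotomic_int_poly:
  fixes h :: "int poly"
  assumes h: "map_poly of_int h = cyclotomic_poly m" and m: "m \<ge> 2"
  obtains b :: nat where "b > 0" "poly h 1 = int b" "2 * poly (pderiv h) 1 = int (degree h * b)"
    "prime m \<or> b \<le> degree h" "coeff h 1 \<in> {-1, 0, 1}" "degree h \<ge> 1"
proof -
  let ?P = "cyclotomic_poly m"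
  have m1: "m \<ge> 1" using m by simp
  from cyclotomic_poly_invariants[OF m1 refl]
  obtain b :: nat where b: "b > 0" "poly ?P 1 = of_nat b" "2 * poly (pderiv ?P) 1 = of_nat (degree ?P * b)"
      "prime m \<or> b \<le> degree ?P" and c: "coeff ?P 1 \<in> {-1, 0, 1}" using m by auto
  have deg: "degree ?P = degree h" unfolding h[symmetric] by (rule degree_map_poly) simp
  have "of_int (poly h 1) = (of_int (int b) :: complex)"
    using b(2) poly_map_poly_of_int[of h 1, where 'a = complex] by (simp add: h)
  then have h1: "poly h 1 = int b" by (simp only: of_int_eq_iff)
  have "of_int (2 * poly (pderiv h) 1) = (of_int (int (degree h * b)) :: complex)"
    using b(3) poly_map_poly_of_int[of "pderiv h" 1, where 'a = complex]
    by (simp add: h[symmetric] pderiv_map_poly_of_int deg[unfolded h[symmetric]])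
  then have h': "2 * poly (pderiv h) 1 = int (degree h * b)" by (simp only: of_int_eq_iff)
  have "of_int (coeff h 1) \<in> {of_int (-1), of_int 0, of_int 1 :: complex}"
    using c by (simp add: h[symmetric] coeff_map_poly)
  then have "coeff h 1 \<in> {-1, 0, 1}" by (simp only: insert_iff of_int_eq_iff empty_iff)
  moreover have "degree h \<ge> 1" using degree_cyclotomic_poly_pos[OF m1] deg by simp
  ultimately show ?thesis using that b(1,4) h1 h' deg by simp
qed

lemma poly_le_at_1:
  fixes p q :: "real poly"
  assumes "\<And>x. 0 < x \<Longrightarrow> x < 1 \<Longrightarrow> poly p x \<le> poly q x"
  shows "poly p 1 \<le> poly q 1"
proof (rule tendsto_le)
  show "(poly q \<longlongrightarrow> poly q 1) (at_left 1)" "(poly p \<longlongrightarrow> poly p 1) (at_left 1)"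
    using tendsto_poly[OF tendsto_ident_at] by blast+
  show "eventually (\<lambda>x. poly p x \<le> poly q x) (at_left 1)"
    using eventually_at_left_1 by eventually_elim (use assms in auto)
qed simp

text \<open>With \<open>S = 1 + x + ... + x^(e-1)\<close> the difference \<open>D = P - S\<close>
  satisfies \<open>0 <= D <= C (1 - x)\<close> on the unit interval. So \<open>D(1) = 0\<close>, and
  a function that is nonnegative to the left of a zero has nonpositive slope there.\<close>

lemma poly_expansion_at_1:
  fixes P :: "real poly"
  assumes lower: "\<And>x. 0 < x \<Longrightarrow> x < 1 \<Longrightarrow> 1 - x ^ e \<le> (1 - x) * poly P x"
    and upper: "\<And>x. 0 < x \<Longrightarrow> x < 1 \<Longrightarrow> (1 - x) * poly P x \<le> 1 - x ^ e + C * (1 - x)\<^sup>2"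
  shows "poly P 1 = real e" and "2 * poly (pderiv P) 1 \<le> real e * (real e - 1)"
proof -
  define S where "S = (\<Sum>i<e. monom (1::real) i)"
  have S: "(1 - x) * poly S x = 1 - x ^ e" for x
    by (simp add: S_def poly_sum poly_monom one_diff_power_eq)
  have S1: "poly S 1 = real e" by (simp add: S_def poly_sum poly_monom)
  have "poly (pderiv S) 1 = (\<Sum>i<e. real i)"
    using higher_pderiv_sum[of 1 "monom (1::real)" "{..<e}"]
    by (simp add: S_def pderiv_monom poly_sum poly_monom)
  also have "2 * \<dots> = real e * (real e - 1)"
    by (induction e) (simp_all add: algebra_simps)
  finally have S': "2 * poly (pderiv S) 1 = real e * (real e - 1)" .
  define D where "D = P - S"
  have D: "0 \<le> poly D x" "poly D x \<le> C * (1 - x)" if x: "0 < x" "x < 1" for x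
  proof -
    have eq: "(1 - x) * poly D x = (1 - x) * poly P x - (1 - x ^ e)"
      by (simp add: D_def S[symmetric] algebra_simps)
    have "0 \<le> (1 - x) * poly D x" using lower[OF x] eq by simp
    then show "0 \<le> poly D x" using x by (simp add: zero_le_mult_iff)
    have "(1 - x) * poly D x \<le> (1 - x) * (C * (1 - x))"
      using upper[OF x] eq by (simp add: power2_eq_square mult_ac)
    then show "poly D x \<le> C * (1 - x)" using x by (simp add: mult_le_cancel_left)
  qed
  have "poly 0 1 \<le> poly D 1" by (rule poly_le_at_1) (use D in auto)
  moreover have "poly D 1 \<le> poly [:C, - C:] 1"
    by (rule poly_le_at_1) (use D in \<open>auto simp: algebra_simps\<close>)
  ultimately have D1: "poly D 1 = 0" by simp
  then show "poly P 1 = real e" using S1 by (simp add: D_def)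
  \<comment> \<open>The derivative of \<open>D\<close> at \<open>1\<close> is the value of the
    cofactor \<open>Q\<close>, whose sign on the interval is opposite to that of
    \<open>D\<close>.\<close>
  obtain Q where Q: "D = [:- 1, 1:] * Q" using D1 by (auto simp: poly_eq_0_iff_dvd dvd_def)
  have "poly Q 1 \<le> poly 0 1"
  proof (rule poly_le_at_1)
    fix x :: real assume x: "0 < x" "x < 1"
    have "poly D x = (x - 1) * poly Q x" by (simp add: Q algebra_simps)
    then have "0 \<le> (x - 1) * poly Q x" using D(1)[OF x] by simp
    then show "poly Q x \<le> poly 0 x" using x by (simp add: zero_le_mult_iff)
  qed
  moreover have "poly (pderiv D) 1 = poly Q 1" unfolding Q pderiv_mult by (simp add: pderiv_pCons)
  moreover have "pderiv P = pderiv D + pderiv S" by (simp add: D_def pderiv_diff)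
  ultimately show "2 * poly (pderiv P) 1 \<le> real e * (real e - 1)" using S' by simp
qed

lemma fps_mult_one_minus_X_power_nth:
  fixes F :: "int fps"
  shows "fps_nth (F * (1 - fps_X) ^ d) 0 = fps_nth F 0"
    and "fps_nth (F * (1 - fps_X) ^ d) 1 = fps_nth F 1 - int d * fps_nth F 0"
proof -
  have step: "F * (1 - fps_X) ^ Suc d = F * (1 - fps_X) ^ d - F * (1 - fps_X) ^ d * fps_X" for d
    by (simp add: algebra_simps)
  show F0: "fps_nth (F * (1 - fps_X) ^ d) 0 = fps_nth F 0" for d
    by (induction d) (simp_all only: step, simp_all)
  show "fps_nth (F * (1 - fps_X) ^ d) 1 = fps_nth F 1 - int d * fps_nth F 0"
  proof (induction d)
    case (Suc d)
    have "fps_nth (F * (1 - fps_X) ^ Suc d) 1 =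
        fps_nth (F * (1 - fps_X) ^ d) 1 - fps_nth (F * (1 - fps_X) ^ d) 0"
      unfolding step by simp
    then show ?case unfolding Suc.IH F0 by (simp add: algebra_simps)
  qed simp
qed

lemma sums_fps_mult_one_minus_X_power:
  fixes F :: "int fps"
  assumes "(\<lambda>k. of_int (fps_nth F k) * x ^ k) sums (S :: real)"
  shows "(\<lambda>k. of_int (fps_nth (F * (1 - fps_X) ^ d) k) * x ^ k) sums ((1 - x) ^ d * S)"
proof (induction d)
  case 0
  then show ?case using assms by simp
next
  case (Suc d)
  have step: "F * (1 - fps_X) ^ Suc d = F * (1 - fps_X) ^ d - F * (1 - fps_X) ^ d * fps_X"
    by (simp add: algebra_simps)
  have "(\<lambda>k. of_int (fps_nth (F * (1 - fps_X) ^ Suc d) k) * x ^ k) sums ((1 - x) * ((1 - x) ^ d * S))"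
    by (rule sums_mult_one_minus[OF Suc]) (simp_all only: step, simp_all)
  then show ?case by (simp only: power_Suc mult.assoc)
qed

section \<open>Recovering a single relation from the Hilbert series\<close>

context presented_algebra
begin

lemma hilbert_series_nth: "fps_nth (hilbert_series scale A) k = int (cnt (std {0}) k)"
  by (simp add: hilbert_series_def dim_component)

lemma hilbert_series_val:
  assumes H: "hilbert_series scale A * (1 - fps_X) ^ d = fps_of_poly h" and x: "0 \<le> x" "x < 1"
  shows "(1 - x) ^ d * val (std {0}) x = poly (map_poly of_int h) x"
proof (rule sums_unique2)
  have "(\<lambda>k. of_int (fps_nth (hilbert_series scale A) k) * x ^ k) sums val (std {0}) x"
    using val_std_sums[OF x] by (simp add: hilbert_series_nth)
  from sums_fps_mult_one_minus_X_power[OF this, of d]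
  show "(\<lambda>k. of_int (coeff h k) * x ^ k) sums ((1 - x) ^ d * val (std {0}) x)"
    unfolding H by simp
  have "(\<lambda>k. of_int (coeff h k) * x ^ k) sums (\<Sum>k\<le>degree h. of_int (coeff h k) * x ^ k)"
    by (rule sums_finite) (auto simp: coeff_eq_0)
  also have "(\<Sum>k\<le>degree h. of_int (coeff h k) * x ^ k) = poly (map_poly of_int h) x"
    by (simp add: poly_altdef coeff_map_poly degree_map_poly)
  finally show "(\<lambda>k. of_int (coeff h k) * x ^ k) sums poly (map_poly of_int h) x" .
qed

lemma val_E: "0 \<le> x \<Longrightarrow> x < 1 \<Longrightarrow> val E x = 1 / (1 - x) ^ n"
  using val_mons[OF finite_vars] by simp

text \<open>
  If \<open>\<delta>\<close> is the greatest common divisor of the leading monomials of the relations, the leading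
  monomials divided by \<open>\<delta>\<close> define a set of codimension at least two.
\<close>

lemma val_std_gcd:
  assumes ne: "std {0} \<noteq> E" and n: "n \<ge> 1"
  obtains \<delta> U C where "\<delta> \<in> E" "U = {u \<in> E. \<delta> + u \<in> std {0}}"
    "\<forall>t\<in>E. \<not> mdvd \<delta> t \<longrightarrow> t \<in> std {0}"
    "\<forall>x. 0 \<le> x \<and> x < 1 \<longrightarrow> (1 - x) ^ n * val (std {0}) x = 1 - x ^ mdeg \<delta> + x ^ mdeg \<delta> * ((1 - x) ^ n * val U x)"
    "\<forall>x. 0 \<le> x \<and> x < 1 \<longrightarrow> (1 - x) ^ n * val U x \<le> C * (1 - x)\<^sup>2"
proof -
  let ?M = "E - std {0}"
  have "?M \<subseteq> E" "?M \<noteq> {}" using ne std_subset by blast+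
  then obtain \<delta> where \<delta>: "\<delta> \<in> E" "\<forall>t\<in>?M. mdvd \<delta> t"
      "\<forall>v\<in>{1..n}. \<exists>u. \<delta> + u \<in> ?M \<and> exponent u v = 0" by (rule monomial_gcd)
  define U where "U = {u \<in> E. \<delta> + u \<in> std {0}}"
  define W where "W = {t \<in> E. \<not> mdvd \<delta> t}"
  have UE: "U \<subseteq> E" and WE: "W \<subseteq> E" by (auto simp only: U_def W_def)
  have shiftE: "(+) \<delta> ` E = {t \<in> E. mdvd \<delta> t}"
    using \<delta>(1) by (auto simp: mdvd_iff simp del: One_nat_def)
  have shiftU: "(+) \<delta> ` U = {t \<in> std {0}. mdvd \<delta> t}"
  proof (intro equalityI subsetI)
    fix t assume t: "t \<in> {t \<in> std {0}. mdvd \<delta> t}"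
    then obtain u where u: "t = \<delta> + u" by (auto simp: mdvd_iff)
    have "t \<in> E" using t std_subset by blast
    then have "u \<in> U" using t by (simp add: U_def u del: One_nat_def)
    then show "t \<in> (+) \<delta> ` U" using u by blast
  qed (auto simp: U_def mdvd_iff)
  have Wstd: "t \<in> std {0}" if "t \<in> E" "\<not> mdvd \<delta> t" for t using \<delta>(2) that by blast
  have E_eq: "E = W \<union> (+) \<delta> ` E" "W \<inter> (+) \<delta> ` E = {}" unfolding shiftE W_def by blast+
  have std_eq: "std {0} = W \<union> (+) \<delta> ` U" unfolding shiftU W_def using Wstd std_subset by blast
  have disj: "W \<inter> (+) \<delta> ` U = {}" unfolding shiftU W_def by blast
  have subE: "(+) \<delta> ` E \<subseteq> E" "(+) \<delta> ` U \<subseteq> E"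
    unfolding shiftE shiftU using std_subset by blast+
  \<comment> \<open>For every variable \<open>v\<close> some nonstandard multiple of
    \<open>\<delta>\<close> has a cofactor free of \<open>v\<close>; these cofactors witness
    codimension two.\<close>
  obtain u where u: "\<And>v. v \<in> {1..n} \<Longrightarrow> \<delta> + u v \<in> ?M \<and> exponent (u v) v = 0"
    using \<delta>(3) by metis
  obtain C where C: "\<forall>x. 0 \<le> x \<and> x < 1 \<longrightarrow> (1 - x) ^ card {1..n} * val U x \<le> C * (1 - x)\<^sup>2"
  proof (rule val_codim_two[OF finite_vars _ UE])
    show "{1..n} \<noteq> {}" using n by simp
    fix v assume v: "v \<in> {1..n}"
    have "\<delta> + u v \<in> E" using u[OF v] by blast
    then show uE: "u v \<in> E" by (simp del: One_nat_def)
    show "exponent (u v) v = 0" using u[OF v] by blast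
    fix t assume t: "t \<in> U"
    show "\<not> mdvd (u v) t"
    proof
      assume "mdvd (u v) t"
      then obtain w where w: "t = u v + w" by (auto simp: mdvd_iff)
      have "t \<in> E" using t UE by blast
      then have "w \<in> E" by (simp add: w del: One_nat_def)
      \<comment> \<open>If \<open>u v\<close> divided \<open>t\<close>, then
        \<open>\<delta> + t\<close> would be a multiple of a nonstandard monomial.\<close>
      then have "w + (\<delta> + u v) \<notin> std {0}"
        using std_up_closed[OF ideal_singleton_0 _ _ \<open>w \<in> E\<close>] u[OF v] by blast
      moreover have "w + (\<delta> + u v) = \<delta> + t" by (simp add: w ac_simps)
      ultimately show False using t by (simp add: U_def)
    qed
  qed
  have eq: "(1 - x) ^ n * val (std {0}) x = 1 - x ^ mdeg \<delta> + x ^ mdeg \<delta> * ((1 - x) ^ n * val U x)"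
    if x: "0 \<le> x" "x < 1" for x
  proof -
    \<comment> \<open>Both \<open>E\<close> and \<open>std {0}\<close> consist of \<open>W\<close>
      and of multiples of \<open>\<delta>\<close>, the latter being translates of \<open>E\<close>
      and \<open>U\<close>. The first equation determines \<open>val W\<close>.\<close>
    have "val E x = val W x + x ^ mdeg \<delta> * val E x"
      using val_Un_disjoint[OF finite_vars WE subE(1) x E_eq(2)] E_eq(1)
        val_shift[OF finite_vars order_refl x \<delta>(1)] by simp
    then have W: "val W x = (1 - x ^ mdeg \<delta>) * val E x" by (simp add: algebra_simps)
    have V: "val (std {0}) x = val W x + x ^ mdeg \<delta> * val U x"
      using val_Un_disjoint[OF finite_vars WE subE(2) x disj] std_eq
        val_shift[OF finite_vars UE x \<delta>(1)] by simp
    have "(1 - x) ^ n * val (std {0}) x =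
        (1 - x) ^ n * ((1 - x ^ mdeg \<delta>) * val E x) + x ^ mdeg \<delta> * ((1 - x) ^ n * val U x)"
      unfolding V W by (simp only: distrib_left mult.left_commute)
    also have "(1 - x) ^ n * ((1 - x ^ mdeg \<delta>) * val E x) = 1 - x ^ mdeg \<delta>"
      using x val_E[OF x] by simp
    finally show ?thesis .
  qed
  show ?thesis
    by (rule that[OF \<delta>(1) U_def]) (use Wstd eq C in auto)
qed

lemma hypersurface_of_cyclotomic:
  assumes n: "n = dim (A 1)"
    and H: "hilbert_series scale A * (1 - fps_X) ^ d = fps_of_poly h" and h0: "poly h 0 = 1"
    and cyc: "map_poly of_int h = cyclotomic_poly m" and m: "m \<ge> 2"
  shows "prime m \<and> is_hypersurface scale A m"
proof -
  obtain b :: nat where b: "b > 0" "poly h 1 = int b" "2 * poly (pderiv h) 1 = int (degree h * b)"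
      "prime m \<or> b \<le> degree h" "coeff h 1 \<in> {-1, 0, 1}" "degree h \<ge> 1"
    using cyclotomic_int_poly[OF cyc m] .
  define P where "P = (map_poly of_int h :: real poly)"
  have P1: "poly P 1 = real b"
    using poly_map_poly_of_int[of h 1, where 'a = real] b(2) by (simp add: P_def)
  have "of_int (2 * poly (pderiv h) 1) = real (degree h * b)" unfolding b(3) by simp
  then have P': "2 * poly (pderiv P) 1 = real (degree h) * real b"
    using poly_map_poly_of_int[of "pderiv h" 1, where 'a = real]
    by (simp add: P_def pderiv_map_poly_of_int)
  have degP: "degree P = degree h" unfolding P_def by (rule degree_map_poly) simp
  have val0: "(1 - x) ^ d * val (std {0}) x = poly P x" if "0 \<le> x" "x < 1" for x
    using hilbert_series_val[OF H that] by (simp add: P_def)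
  have "fps_nth (hilbert_series scale A) 0 = coeff h 0"
    using fps_mult_one_minus_X_power_nth(1)[of "hilbert_series scale A" d] unfolding H by simp
  then have H0: "fps_nth (hilbert_series scale A) 0 = 1" using h0 by (simp add: poly_0_coeff_0)
  \<comment> \<open>Here the presentation has to be minimal: \<open>n\<close> is the linear
    coefficient of the Hilbert series.\<close>
  have "fps_nth (hilbert_series scale A) 1 = int n" unfolding n by (simp add: hilbert_series_def)
  then have "coeff h 1 = int n - int d"
    using fps_mult_one_minus_X_power_nth(2)[of "hilbert_series scale A" d] unfolding H H0 by simp
  then have cases: "d = Suc n \<or> d = n \<or> n = Suc d" using b(5) by auto
  have val_le: "val (std {0}) x \<le> 1 / (1 - x) ^ n" if "0 \<le> x" "x < 1" for x
    using val_mono[OF finite_vars std_subset order_refl that] val_E[OF that] by simp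
  have P1_pos: "\<not> poly P 1 \<le> 0" using P1 b(1) by simp

  have "d \<noteq> Suc n"
  proof
    assume d: "d = Suc n"
    have "poly P 1 \<le> poly [:1, - 1:] 1"
    proof (rule poly_le_at_1)
      fix x :: real assume x: "0 < x" "x < 1"
      have "poly P x = (1 - x) ^ d * val (std {0}) x" using val0[of x] x by simp
      also have "\<dots> \<le> (1 - x) ^ d * (1 / (1 - x) ^ n)"
        using x val_le[of x] by (intro mult_left_mono) auto
      also have "\<dots> = 1 - x" using x by (simp add: d)
      finally show "poly P x \<le> poly [:1, - 1:] x" by simp
    qed
    then show False using P1_pos by simp
  qed
  moreover have "d \<noteq> n"
  proof
    assume d: "d = n"
    show False
    proof (cases "std {0} = E")
      case True
      \<comment> \<open>Without relations \<open>P\<close> agrees with \<open>1\<close> at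
        infinitely many points, so it is constant, whereas \<open>h\<close> has positive
        degree.\<close>
      have "poly (P - 1) x = 0" if "x \<in> {0<..<1}" for x
        using val0[of x] val_E[of x] that d True by simp
      then have "{0<..<1} \<subseteq> {x. poly (P - 1) x = 0}" by blast
      moreover have "infinite {0<..<1::real}" by simp
      ultimately have "P - 1 = 0" using poly_roots_finite finite_subset by blast
      then have "degree P = 0" by simp
      then show False using degP b(6) by simp
    next
      case False
      then obtain \<mu> where \<mu>: "\<mu> \<in> E" "\<mu> \<notin> std {0}" using std_subset by blast
      have "poly P 1 \<le> poly (1 - monom 1 (mdeg \<mu>)) 1"
      proof (rule poly_le_at_1)
        fix x :: real assume x: "0 < x" "x < 1"
        \<comment> \<open>A single nonstandard \<open>\<mu>\<close> removes its whole translate of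
          \<open>E\<close>, leaving at most \<open>1 - x ^ mdeg \<mu>\<close> after multiplication
          by \<open>(1 - x)^n\<close>. This bound vanishes at \<open>1\<close>.\<close>
        have sub: "(+) \<mu> ` E \<subseteq> E" using \<mu>(1) by (auto simp del: One_nat_def)
        have "std {0} \<inter> (+) \<mu> ` E = {}"
          using std_up_closed[OF ideal_singleton_0 \<mu>] by (auto simp: add.commute)
        then have "val (std {0}) x + x ^ mdeg \<mu> * val E x = val (std {0} \<union> (+) \<mu> ` E) x"
          using val_Un_disjoint[OF finite_vars std_subset sub, of x] x
            val_shift[OF finite_vars order_refl _ _ \<mu>(1), of x] by simp
        also have "\<dots> \<le> val E x"
          using x sub std_subset by (intro val_mono[OF finite_vars]) auto
        finally have "val (std {0}) x \<le> (1 - x ^ mdeg \<mu>) * val E x" by (simp add: algebra_simps)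
        then have "(1 - x) ^ d * val (std {0}) x \<le> (1 - x) ^ d * ((1 - x ^ mdeg \<mu>) * val E x)"
          using x by (intro mult_left_mono) auto
        also have "\<dots> = 1 - x ^ mdeg \<mu>" using x val_E[of x] by (simp add: d)
        finally show "poly P x \<le> poly (1 - monom 1 (mdeg \<mu>)) x"
          using val0[of x] x by (simp add: poly_monom)
      qed
      then show False using P1_pos by (simp add: poly_monom)
    qed
  qed
  ultimately have nd: "n = Suc d" using cases by blast
  have val0': "(1 - x) ^ n * val (std {0}) x = (1 - x) * poly P x" if "0 \<le> x" "x < 1" for x
    using val0[OF that] by (simp add: nd)
  have "std {0} \<noteq> E"
  proof
    assume "std {0} = E"
    then have "(1 - x) * poly P x = 1" if "0 < x" "x < 1" for x
      using val0'[of x] val_E[of x] that by simp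
    \<comment> \<open>By continuity the identity would persist at \<open>x = 1\<close> and read
      \<open>1 <= 0\<close>.\<close>
    then have "poly 1 1 \<le> poly ([:1, - 1:] * P) 1" by (intro poly_le_at_1) (simp add: algebra_simps)
    then show False by simp
  qed
  moreover have "n \<ge> 1" using nd by simp
  ultimately obtain \<delta> U C where \<delta>: "\<delta> \<in> E" and U: "U = {u \<in> E. \<delta> + u \<in> std {0}}"
    and sub: "\<forall>t\<in>E. \<not> mdvd \<delta> t \<longrightarrow> t \<in> std {0}"
    and eq: "\<forall>x. 0 \<le> x \<and> x < 1 \<longrightarrow> (1 - x) ^ n * val (std {0}) x = 1 - x ^ mdeg \<delta> + x ^ mdeg \<delta> * ((1 - x) ^ n * val U x)"
    and C: "\<forall>x. 0 \<le> x \<and> x < 1 \<longrightarrow> (1 - x) ^ n * val U x \<le> C * (1 - x)\<^sup>2"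
    by (rule val_std_gcd)
  let ?e = "mdeg \<delta>"
  have UE: "U \<subseteq> E" unfolding U by blast
  have K: "0 \<le> (1 - x) ^ n * val U x" if "0 \<le> x" "x < 1" for x
    using that val_nonneg[OF finite_vars UE that] by simp
  have e1: "poly P 1 = real ?e" and e2: "2 * poly (pderiv P) 1 \<le> real ?e * (real ?e - 1)"
  proof -
    have lower: "1 - x ^ ?e \<le> (1 - x) * poly P x" if "0 < x" "x < 1" for x
      using val0'[of x] eq[rule_format, of x] mult_nonneg_nonneg[OF _ K, of "x ^ ?e" x] that by simp
    have upper: "(1 - x) * poly P x \<le> 1 - x ^ ?e + C * (1 - x)\<^sup>2" if x: "0 < x" "x < 1" for x
    proof -
      have "x ^ ?e * ((1 - x) ^ n * val U x) \<le> 1 * ((1 - x) ^ n * val U x)"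
        using x K[of x] by (intro mult_right_mono power_le_one) auto
      moreover have "(1 - x) ^ n * val U x \<le> C * (1 - x)\<^sup>2" using C x by simp
      moreover have "(1 - x) * poly P x = 1 - x ^ ?e + x ^ ?e * ((1 - x) ^ n * val U x)"
        using val0'[of x] eq[rule_format, of x] x by simp
      ultimately show ?thesis by linarith
    qed
    show "poly P 1 = real ?e" "2 * poly (pderiv P) 1 \<le> real ?e * (real ?e - 1)"
      using poly_expansion_at_1[of ?e P C] lower upper by blast+
  qed
  have be: "b = ?e" using P1 e1 by simp
  \<comment> \<open>Dividing by \<open>b\<close> gives \<open>degree h < b\<close>, which leaves
    only the prime alternative in \<open>b(4)\<close>.\<close>
  have "real (degree h) * real b \<le> (real b - 1) * real b" using P' e2 be by (simp add: mult.commute)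
  then have "real (degree h) \<le> real b - 1" using b(1) by simp
  then have prime: "prime m" using b(4) by linarith
  have hm: "h = (\<Sum>i<m. monom 1 i)"
  proof -
    have "map_poly of_int h = (map_poly of_int (\<Sum>i<m. monom 1 i) :: complex poly)"
      unfolding cyc cyclotomic_poly_prime[OF prime]
      by (rule poly_eqI) (simp add: coeff_map_poly coeff_sum)
    then have "of_int (coeff h k) = (of_int (coeff (\<Sum>i<m. monom 1 i) k) :: complex)" for k
      by (metis coeff_map_poly of_int_0)
    then show ?thesis by (intro poly_eqI) (simp only: of_int_eq_iff)
  qed
  have Pm: "P = (\<Sum>i<m. monom 1 i)"
    unfolding P_def hm by (rule poly_eqI) (simp add: coeff_map_poly coeff_sum)
  have em: "?e = m" using e1 by (simp add: Pm poly_sum poly_monom)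
  have "U = {}"
  proof (rule ccontr)
    assume "U \<noteq> {}"
    then obtain u where u: "u \<in> U" by blast
    \<comment> \<open>Any interior point would do: the term with \<open>U\<close> vanishes there
      since \<open>e = m\<close>, while every monomial in \<open>U\<close> contributes a positive
      amount.\<close>
    let ?x = "1 / 2 :: real"
    have "(1 - ?x) * poly P ?x = 1 - ?x ^ m"
      by (simp only: Pm poly_sum poly_monom mult_1 one_diff_power_eq)
    then have "?x ^ ?e * ((1 - ?x) ^ n * val U ?x) = 0"
      using val0'[of ?x] eq[rule_format, of ?x] em by simp
    then have "val U ?x = 0" by simp
    moreover have "?x ^ mdeg u \<le> val U ?x" by (rule val_ge_power[OF finite_vars UE u]) auto
    moreover have "?x ^ mdeg u > 0" by simp
    ultimately show False by linarith
  qed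
  have "std {0} = {t \<in> E. \<not> mdvd \<delta> t}"
  proof (intro equalityI subsetI)
    fix t assume t: "t \<in> std {0}"
    have tE: "t \<in> E" using t std_subset by blast
    have "\<not> mdvd \<delta> t"
    proof
      assume "mdvd \<delta> t"
      then obtain u where u: "t = \<delta> + u" by (auto simp: mdvd_iff)
      then have "u \<in> U" using t tE by (simp add: U del: One_nat_def)
      then show False using \<open>U = {}\<close> by blast
    qed
    then show "t \<in> {t \<in> E. \<not> mdvd \<delta> t}" using tE by blast
  qed (use sub in blast)
  then have "is_hypersurface scale A m" using is_hypersurface_of_std[OF \<open>n \<ge> 1\<close> \<delta> em] by blast
  then show ?thesis using prime by blast
qed

text \<open>\<open>E\<close> is the disjoint union of \<open>std {0}\<close> and the translate of
  \<open>E\<close> by \<open>\<mu>\<close>, so \<open>(1 - x)^n H = 1 - x^m\<close>, and one factor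
  \<open>1 - x\<close> cancels. The quotient takes the value \<open>m \<noteq> 0\<close> at
  \<open>1\<close>, so the pole has order exactly \<open>n - 1\<close>, which is therefore the Krull
  dimension.\<close>

lemma h_polynomial_of_std:
  assumes n: "n \<ge> 1" and m: "m \<ge> 1" and \<mu>: "\<mu> \<in> E" "mdeg \<mu> = m"
    and std: "std {0} = {t \<in> E. \<not> mdvd \<mu> t}"
  shows "h_polynomial scale A = (\<Sum>i<m. monom 1 i)"
proof (rule h_polynomial_eqI)
  let ?h = "\<Sum>i<m. monom 1 i :: int poly"
  let ?F = "Abs_fps (\<lambda>d. of_nat (cnt E d)) :: int fps"
  have cnt: "cnt E d = cnt (std {0}) d + cnt ((+) \<mu> ` E) d" for d
  proof -
    have shift: "(+) \<mu> ` E = {t \<in> E. mdvd \<mu> t}" using \<mu>(1) by (auto simp: mdvd_iff simp del: One_nat_def)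
    have "{t \<in> E. mdeg t = d} = {t \<in> std {0}. mdeg t = d} \<union> {t \<in> (+) \<mu> ` E. mdeg t = d}"
      unfolding shift std by blast
    moreover have "{t \<in> std {0}. mdeg t = d} \<inter> {t \<in> (+) \<mu> ` E. mdeg t = d} = {}"
      unfolding shift std by blast
    moreover have "finite {t \<in> (+) \<mu> ` E. mdeg t = d}"
      by (rule finite_mons_eq[OF finite_vars]) (auto simp: shift simp del: One_nat_def)
    ultimately show ?thesis unfolding cnt_def by (simp add: card_Un_disjoint finite_std_eq)
  qed
  have "hilbert_series scale A = ?F * (1 - fps_X ^ m)"
  proof (rule fps_ext)
    fix d
    show "fps_nth (hilbert_series scale A) d = fps_nth (?F * (1 - fps_X ^ m)) d"
      using cnt[of d] unfolding hilbert_series_nth cnt_shift \<mu>(2)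
      by (simp add: right_diff_distrib fps_X_power_mult_right_nth)
  qed
  then have "hilbert_series scale A * (1 - fps_X) ^ n = (?F * (1 - fps_X) ^ card {1..n}) * (1 - fps_X ^ m)"
    by (simp add: mult_ac)
  also have "\<dots> = 1 - fps_X ^ m" using fps_cnt_mons[OF finite_vars, where 'a = int] by simp
  also have "\<dots> = (1 - fps_X) * (\<Sum>i<m. fps_X ^ i)" by (rule one_diff_power_eq)
  also have "(\<Sum>i<m. fps_X ^ i) = fps_of_poly ?h" by (simp add: fps_of_poly_sum fps_of_poly_monom')
  finally have "(1 - fps_X) * (hilbert_series scale A * (1 - fps_X) ^ (n - 1)) = (1 - fps_X) * fps_of_poly ?h"
    using n by (cases n) (simp_all add: mult_ac)
  moreover have "(1 - fps_X :: int fps) \<noteq> 0"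
  proof
    assume "(1 - fps_X :: int fps) = 0"
    from arg_cong[OF this, of "\<lambda>f. fps_nth f 0"] show False by simp
  qed
  ultimately have H: "hilbert_series scale A * (1 - fps_X) ^ (n - 1) = fps_of_poly ?h" by simp
  have h1: "poly ?h 1 = int m" by (simp add: poly_sum poly_monom)
  have h0: "poly ?h 0 = 1"
  proof -
    have "poly ?h 0 = (\<Sum>i<m. if i = 0 then 1 else 0)" by (simp add: poly_sum poly_monom power_0_left)
    then show ?thesis using m by simp
  qed
  have lim: "((\<lambda>x. (1 - x) ^ (n - 1) * val (std {0}) x) \<longlongrightarrow> poly (map_poly of_int ?h) 1) (at_left 1)"
  proof (rule Lim_transform_eventually)
    show "(poly (map_poly of_int ?h :: real poly) \<longlongrightarrow> poly (map_poly of_int ?h) 1) (at_left 1)"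
      using tendsto_poly[OF tendsto_ident_at] by blast
    show "eventually (\<lambda>x. poly (map_poly of_int ?h) x = (1 - x) ^ (n - 1) * val (std {0}) x) (at_left 1)"
      using eventually_at_left_1 by eventually_elim (use hilbert_series_val[OF H] in auto)
  qed
  have "poly (map_poly of_int ?h) 1 = real m"
    using poly_map_poly_of_int[of ?h 1, where 'a = real] h1 by simp
  then have "krull_dim TYPE('a) = enat (n - 1)" using m by (intro krull_dim_eq_pole_order[OF lim]) simp
  then show "is_h_polynomial scale A ?h" unfolding is_h_polynomial_def using H h0 h1 m by auto
qed

end

text \<open>The variables are sent to a basis of \<open>A 1\<close>, which is finite because
  \<open>A 1\<close> has a finite spanning set.\<close>

lemma (in standard_graded_algebra) minimal_presentation:
  obtains r where "presented_algebra scale A r (dim (A 1))"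
proof -
  obtain S where S: "finite S" "A 1 \<subseteq> span S" using finite_spanning_component_1 by blast
  obtain B where B: "B \<subseteq> A 1" "independent B" "A 1 \<subseteq> span B" "card B = dim (A 1)"
    using basis_exists[of "A 1"] .
  have "finite B" using independent_span_bound[OF S(1) B(2) subset_trans[OF B(1) S(2)]] by (rule conjunct1)
  then obtain r where r: "bij_betw r {1..card B} B"
    using ex_bij_betw_nat_finite_1 by blast
  have "presented_algebra scale A r (card B)"
  proof unfold_locales
    show "r i \<in> A 1" if "i \<in> {1..card B}" for i using r B(1) that by (auto simp: bij_betw_def)
    show "A 1 \<subseteq> span (r ` {1..card B})" using r B(3) by (simp add: bij_betw_def)
  qed
  then show ?thesis using that B(4) by simp
qed

theorem theoremB:
  fixes scale :: "'k::field \<Rightarrow> 'a::comm_ring_1 \<Rightarrow> 'a"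
    and A :: "nat \<Rightarrow> 'a set"
    and m :: nat
  assumes "standard_graded_algebra scale A"
    and "m \<ge> 1"
  shows "map_poly of_int (h_polynomial scale A) = cyclotomic_poly m \<longleftrightarrow>
           prime m \<and> is_hypersurface scale A m"
proof
  interpret standard_graded_algebra scale A by fact
  assume cyc: "map_poly of_int (h_polynomial scale A) = cyclotomic_poly m"
  define h where "h = h_polynomial scale A"
  \<comment> \<open>This excludes the default value of \<open>h_polynomial\<close>, since a
    cyclotomic polynomial has positive degree.\<close>
  have "h \<noteq> 0"
  proof
    assume "h = 0"
    then have "degree (cyclotomic_poly m) = 0" using cyc by (simp add: h_def[symmetric] flip: cyc)
    then show False using degree_cyclotomic_poly_pos[OF assms(2)] by simp
  qed
  then obtain h' where h': "is_h_polynomial scale A h'"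
    unfolding h_def h_polynomial_def by (auto split: if_splits)
  then have "is_h_polynomial scale A h" using h_polynomial_eqI[OF h'] by (simp add: h_def)
  then obtain d where d: "hilbert_series scale A * (1 - fps_X) ^ d = fps_of_poly h"
    and h: "poly h 1 \<noteq> 0" "poly h 0 = 1" unfolding is_h_polynomial_def by blast
  \<comment> \<open>\<open>\<Phi>_1\<close> vanishes at \<open>1\<close>, which an h-polynomial must
    not.\<close>
  have "m \<noteq> 1"
  proof
    assume "m = 1"
    then have "poly (map_poly of_int h) (1 :: complex) = 0" using cyc by (simp add: h_def cyclotomic_poly_1[simplified])
    then show False using h(1) poly_map_poly_of_int[of h 1, where 'a = complex] by simp
  qed
  then have m: "m \<ge> 2" using assms(2) by simp
  obtain r where "presented_algebra scale A r (dim (A 1))" by (rule minimal_presentation)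
  then interpret presented_algebra scale A r "dim (A 1)" .
  show "prime m \<and> is_hypersurface scale A m"
    using hypersurface_of_cyclotomic[OF refl d h(2) _ m] cyc by (simp add: h_def)
next
  interpret standard_graded_algebra scale A by fact
  assume R: "prime m \<and> is_hypersurface scale A m"
  obtain n r \<mu> where n: "n \<ge> 1" and pres: "presented_algebra scale A r n"
    and \<mu>: "\<mu> \<in> mons {1..n}" "mdeg \<mu> = m"
    and std: "presented_algebra.std scale r n {0} = {t \<in> mons {1..n}. \<not> mdvd \<mu> t}"
    using hypersurface_presentation[OF conjunct2[OF R]] .
  interpret presented_algebra scale A r n by fact
  have "h_polynomial scale A = (\<Sum>i<m. monom 1 i)"
    by (rule h_polynomial_of_std[OF n assms(2) \<mu> std])
  then show "map_poly of_int (h_polynomial scale A) = cyclotomic_poly m"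
    unfolding cyclotomic_poly_prime[OF conjunct1[OF R]]
    by (intro poly_eqI) (simp add: coeff_map_poly coeff_sum)
qed

end
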